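(* Let $(D,\mathscr{C})$ be a constrained polydifferential operator of rank $r\ge 2$ and homogeneity $-2k$ on $n$-manifolds, $0<2k<n$, that satisfies the Frank--Lieb Property. Let $(S^n,d\theta^2)$ be the round $n$-sphere. If $u$ is a local minimizer of the functional $\mathcal{F}^{d\theta^2} : U_{\mathscr{C}}^{d\theta^2}\setminus\{0\}\to\mathbb{R}$ defined by $$\mathcal{F}^{d\theta^2}(u) := \frac{\mathfrak{D}^{d\theta^2}(u^{\otimes r})}{\lVert u\rVert_{r^\ast}^{r}},\qquad r^\ast:=\frac{rn}{n-2k},$$ then there is a constant $c\neq 0$ and a $\Phi\in\mathrm{Conf}(S^n,[d\theta^2])$ such that $$u = c\cdot\Phi .$$ Here $v\cdot\Phi := \lvert J_\Phi\rvert^{\frac{n-2k}{rn}}\Phi^\ast v$ for $v \in C^\infty(S^n)$, so that $c\cdot\Phi = c\,\lvert J_\Phi\rvert^{\frac{n-2k}{rn}}$.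
   Context: All tensor products are over $\mathbb{R}$. A (natural) polydifferential operator of rank $\ell+1$ ($\ell \ge 0$) on $n$-manifolds is an assignment $D$ to each Riemannian $n$-manifold $(M,g)$ of a linear operator $D^g : C^\infty(M)^{\otimes \ell} \to C^\infty(M)$ such that $D^g(u_1\otimes\cdots\otimes u_\ell)$ is expressed by a universal (coefficients independent of $(M,g)$) $\mathbb{R}$-linear combination of complete contractions, formed with $g$, of tensors $\nabla^{N_1}\mathrm{Rm}\otimes\cdots\otimes\nabla^{N_p}\mathrm{Rm}\otimes\nabla^{N_{p+1}}u_1\otimes\cdots\otimes\nabla^{N_{p+\ell}}u_\ell$, where $\mathrm{Rm}$ is the Riemann curvature tensor. It is symmetric if $D^g(u_1\otimes\cdots\otimes u_\ell)$ is invariant under permutations of the $u_j$, and conformally covariant if there are $a_1,\dots,a_\ell,b\in\mathbb{R}$ with $D^{e^{2\Upsilon}g}(u_1\otimes\cdots\otimes u_\ell)=e^{b\Upsilon}D^g(e^{-a_1\Upsilon}u_1\otimes\cdots\otimes e^{-a_\ell\Upsilon}u_\ell)$ always. $D$ has homogeneity $h$ if $D^{c^2g}=c^{h}D^g$ for all $(M,g)$ and all constants $c>0$. A formally self-adjoint, conformally covariant, polydifferential operator of rank $r\ge 1$ and homogeneity $-2k$ on $n$-manifolds is a natural polydifferential operator $D$ of rank $r$ and homogeneity $-2k$ such that (1) the Dirichlet form $\mathfrak{D}^g(u_1\otimes\cdots\otimes u_r) := \int_M u_1 D^g(u_2\otimes\cdots\otimes u_r)\,dV_g$ on $C_0^\infty(M)^{\otimes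 r}$ is invariant under permutations of $u_1,\dots,u_r$; and (2) with $w=-\frac{n-2k}{r}$, if $\hat g=e^{2\Upsilon}g$ then $\mathfrak{D}^{\hat g}(e^{w\Upsilon}u_1\otimes\cdots\otimes e^{w\Upsilon}u_r)=\mathfrak{D}^g(u_1\otimes\cdots\otimes u_r)$. A constrained polydifferential operator of rank $r$ and homogeneity $-2k$ on $n$-manifolds is a pair $(D,\mathscr{C})$ of such an operator $D$ and a (possibly empty) finite set $\mathscr{C}$ of symmetric conformally covariant polydifferential operators such that for each $C\in\mathscr{C}$, with $r(C)$ the rank of $C$, there is a $b(C)\in\mathbb{R}$ with $C^{e^{2\Upsilon}g}\bigl(u^{\otimes(r(C)-1)}\bigr)=e^{b(C)\Upsilon}C^g\bigl((e^{\frac{n-2k}{r}\Upsilon}u)^{\otimes(r(C)-1)}\bigr)$ for all $(M,g)$ and all $\Upsilon,u\in C^\infty(M)$. Its constrained cone is $U_{\mathscr{C}}^g := \{u\in C^\infty(M) : C^g(u^{\otimes(r(C)-1)})>0 \text{ for all } C\in\mathscr{C}\}$. $(D,\mathscr{C})$ satisfies the Frank--Lieb Property if (a) the constant function $1$ lies in $U_{\mathscr{C}}^{d\theta^2}$; and (b) for every $u\in U_{\mathscr{C}}^{d\theta^2}$, $$\mathfrak{D}^{d\theta^2}(u^{\otimes r})\ \ge\ \frac{(r-1)(n-2k)}{2rk}\int_{S^n}\sum_{i=0}^n x^i u\,[D,x^i]_1\bigl(u^{\otimes(r-1)}\bigr)\,dV_{d\theta^2},$$ with equality if and only if $u$ is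 constant. Here $x^0,\dots,x^n$ are the restrictions to $S^n\subset\mathbb{R}^{n+1}$ of the standard Cartesian coordinates, $D=D^{d\theta^2}$, and $[D,x]_1(u_1\otimes\cdots\otimes u_{r-1}):=D(xu_1\otimes u_2\otimes\cdots\otimes u_{r-1})-xD(u_1\otimes\cdots\otimes u_{r-1})$. $\lVert\cdot\rVert_{r^\ast}$ is the $L^{r^\ast}$-norm for $dV_{d\theta^2}$. $\mathrm{Conf}(S^n,[d\theta^2])$ is the group of diffeomorphisms $\Phi$ of $S^n$ with $\Phi^\ast d\theta^2$ conformal to $d\theta^2$, and $\lvert J_\Phi\rvert$ is the positive function with $dV_{\Phi^\ast d\theta^2}=\lvert J_\Phi\rvert\,dV_{d\theta^2}$. "Local minimizer" is with respect to the $C^\infty$ topology. *)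

theory Defs
  imports "HOL-Analysis.Analysis" "HOL-Library.Multiset"
begin

section \<open>Calculus on open subsets of \<open>\<real>\<^sup>n\<close>\<close>

fun Ck_on :: "nat \<Rightarrow> 'a::real_normed_vector set \<Rightarrow> ('a \<Rightarrow> 'b::real_normed_vector) \<Rightarrow> bool" where
  "Ck_on 0 S f \<longleftrightarrow> continuous_on S f"
| "Ck_on (Suc m) S f \<longleftrightarrow> (\<forall>x\<in>S. f differentiable (at x))
     \<and> (\<forall>v. Ck_on m S (\<lambda>x. frechet_derivative f (at x) v))"

text \<open>Only used for open \<open>S\<close>; the derivatives are taken in the ambient space.\<close>

definition smooth_on :: "'a::real_normed_vector set \<Rightarrow> ('a \<Rightarrow> 'b::real_normed_vector) \<Rightarrow> bool" where
  "smooth_on S f \<longleftrightarrow> (\<forall>m. Ck_on m S f)"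

definition partial :: "'n::finite \<Rightarrow> (real^'n \<Rightarrow> 'b::real_normed_vector) \<Rightarrow> real^'n \<Rightarrow> 'b" where
  "partial i f x = frechet_derivative f (at x) (axis i 1)"

fun partials :: "'n::finite list \<Rightarrow> (real^'n \<Rightarrow> real) \<Rightarrow> real^'n \<Rightarrow> real" where
  "partials [] f = f"
| "partials (i # I) f = partial i (partials I f)"


section \<open>Smooth manifolds\<close>

text \<open>
  Following do Carmo, the charts of a manifold are local parametrizations: a pair \<open>(V, \<psi>)\<close> consists
  of an open set \<open>V\<close> of \<open>\<real>\<^sup>n\<close> and an injection \<open>\<psi>\<close> of \<open>V\<close> into the set of points.  The values of
  \<open>\<psi>\<close> off \<open>V\<close> are junk.  The dimension is \<open>CARD('n)\<close>.  A manifold is given by its maximal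
  smooth atlas; its points are the points covered by the atlas.  Functions on the manifold are
  HOL functions on the type of points whose values off the carrier are ignored.
\<close>

type_synonym ('n, 'p) chart = "(real^'n) set \<times> (real^'n \<Rightarrow> 'p)"

type_synonym ('n, 'p) atlas = "('n, 'p) chart set"

definition carrier :: "('n::finite, 'p) atlas \<Rightarrow> 'p set" where
  "carrier A = (\<Union>(V, \<psi>)\<in>A. \<psi> ` V)"

definition chart_top :: "('n::finite, 'p) atlas \<Rightarrow> 'p topology" where
  "chart_top A = topology (\<lambda>W. W \<subseteq> carrier A \<and> (\<forall>(V, \<psi>)\<in>A. open {y \<in> V. \<psi> y \<in> W}))"

lemma openin_chart_top:
  fixes A :: "('n::finite, 'p) atlas"
  shows "openin (chart_top A) W \<longleftrightarrow> W \<subseteq> carrier A \<and> (\<forall>(V, \<psi>)\<in>A. open {y \<in> V. \<psi> y \<in> W})"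
proof -
  have "istopology (\<lambda>W. W \<subseteq> carrier A \<and> (\<forall>(V, \<psi>)\<in>A. open {y \<in> V. \<psi> y \<in> W}))"
    unfolding istopology_def
  proof (intro conjI allI impI)
    fix S T assume "S \<subseteq> carrier A \<and> (\<forall>(V, \<psi>)\<in>A. open {y \<in> V. \<psi> y \<in> S})"
      "T \<subseteq> carrier A \<and> (\<forall>(V, \<psi>)\<in>A. open {y \<in> V. \<psi> y \<in> T})"
    moreover have "{y \<in> V. \<psi> y \<in> S \<inter> T} = {y \<in> V. \<psi> y \<in> S} \<inter> {y \<in> V. \<psi> y \<in> T}"
      for V :: "(real^'n) set" and \<psi> :: "real^'n \<Rightarrow> 'p" by auto
    ultimately show "S \<inter> T \<subseteq> carrier A" "\<forall>(V, \<psi>)\<in>A. open {y \<in> V. \<psi> y \<in> S \<inter> T}"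
      by (auto intro: open_Int)
  next
    fix K assume "\<forall>S\<in>K. S \<subseteq> carrier A \<and> (\<forall>(V, \<psi>)\<in>A. open {y \<in> V. \<psi> y \<in> S})"
    moreover have "{y \<in> V. \<psi> y \<in> \<Union>K} = (\<Union>S\<in>K. {y \<in> V. \<psi> y \<in> S})"
      for V :: "(real^'n) set" and \<psi> :: "real^'n \<Rightarrow> 'p" by auto
    ultimately show "\<Union>K \<subseteq> carrier A" "\<forall>(V, \<psi>)\<in>A. open {y \<in> V. \<psi> y \<in> \<Union>K}"
      by (auto intro!: open_UN)
  qed
  then show ?thesis by (simp add: chart_top_def)
qed

definition smooth_transition :: "('n::finite, 'p) chart \<Rightarrow> ('n, 'p) chart \<Rightarrow> bool" where
  "smooth_transition = (\<lambda>(V, \<psi>) (V', \<psi>').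
     open {y \<in> V. \<psi> y \<in> \<psi>' ` V'} \<and>
     smooth_on {y \<in> V. \<psi> y \<in> \<psi>' ` V'} (inv_into V' \<psi>' \<circ> \<psi>))"

definition smooth_manifold :: "('n::finite, 'p) atlas \<Rightarrow> bool" where
  "smooth_manifold A \<longleftrightarrow>
     (\<forall>(V, \<psi>)\<in>A. open V \<and> inj_on \<psi> V) \<and>
     (\<forall>c\<in>A. \<forall>d\<in>A. smooth_transition c d) \<and>
     (\<forall>V \<psi>. open V \<and> inj_on \<psi> V \<and> \<psi> ` V \<subseteq> carrier A \<and>
        (\<forall>d\<in>A. smooth_transition (V, \<psi>) d \<and> smooth_transition d (V, \<psi>)) \<longrightarrow> (V, \<psi>) \<in> A) \<and>
     Hausdorff_space (chart_top A) \<and> second_countable (chart_top A)"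

definition Cinf :: "('n::finite, 'p) atlas \<Rightarrow> ('p \<Rightarrow> real) set" where
  "Cinf A = {u. \<forall>(V, \<psi>)\<in>A. smooth_on V (u \<circ> \<psi>)}"

definition Cinf0 :: "('n::finite, 'p) atlas \<Rightarrow> ('p \<Rightarrow> real) set" where
  "Cinf0 A = {u \<in> Cinf A. \<exists>K. compactin (chart_top A) K \<and> (\<forall>x\<in>carrier A - K. u x = 0)}"

text \<open>The topology of uniform convergence of all derivatives on compact subsets of charts.\<close>

definition Cinf_top :: "('n::finite, 'p) atlas \<Rightarrow> ('p \<Rightarrow> real) topology" where
  "Cinf_top A = topology_generated_by
     {{v \<in> Cinf A. \<forall>y\<in>K. \<bar>partials I (\<lambda>z. v (\<psi> z) - u (\<psi> z)) y\<bar> < \<epsilon>} | V \<psi> K I u \<epsilon>.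
        (V, \<psi>) \<in> A \<and> compact K \<and> K \<subseteq> V \<and> u \<in> Cinf A \<and> \<epsilon> > 0}"

definition smooth_map :: "('n::finite, 'p) atlas \<Rightarrow> ('p \<Rightarrow> 'p) \<Rightarrow> bool" where
  "smooth_map A \<Phi> \<longleftrightarrow> \<Phi> ` carrier A \<subseteq> carrier A \<and>
     (\<forall>(V, \<psi>)\<in>A. \<forall>d\<in>A. smooth_transition (V, \<Phi> \<circ> \<psi>) d)"

definition diffeo :: "('n::finite, 'p) atlas \<Rightarrow> ('p \<Rightarrow> 'p) \<Rightarrow> bool" where
  "diffeo A \<Phi> \<longleftrightarrow> bij_betw \<Phi> (carrier A) (carrier A) \<and>
     smooth_map A \<Phi> \<and> smooth_map A (inv_into (carrier A) \<Phi>)"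


section \<open>Riemannian metrics\<close>

text \<open>A metric is the family of its component matrices in all charts.\<close>

type_synonym ('n, 'p) metric = "('n, 'p) chart \<Rightarrow> real^'n \<Rightarrow> real^'n^'n"

definition riemannian_metric :: "('n::finite, 'p) atlas \<Rightarrow> ('n, 'p) metric \<Rightarrow> bool" where
  "riemannian_metric A g \<longleftrightarrow>
     (\<forall>(V, \<psi>)\<in>A.
        (\<forall>i j. smooth_on V (\<lambda>y. g (V, \<psi>) y $ i $ j)) \<and>
        (\<forall>y\<in>V. transpose (g (V, \<psi>) y) = g (V, \<psi>) y \<and> (\<forall>v. v \<noteq> 0 \<longrightarrow> v \<bullet> (g (V, \<psi>) y *v v) > 0))) \<and>
     (\<forall>(V, \<psi>)\<in>A. \<forall>(V', \<psi>')\<in>A. \<forall>y\<in>V. \<psi> y \<in> \<psi>' ` V' \<longrightarrow>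
        (let \<tau> = inv_into V' \<psi>' \<circ> \<psi> in
         \<forall>i j. g (V, \<psi>) y $ i $ j =
           (\<Sum>a\<in>UNIV. \<Sum>b\<in>UNIV. g (V', \<psi>') (\<tau> y) $ a $ b * partial i \<tau> y $ a * partial j \<tau> y $ b)))"

definition riemannian_manifold :: "('n::finite, 'p) atlas \<Rightarrow> ('n, 'p) metric \<Rightarrow> bool" where
  "riemannian_manifold A g \<longleftrightarrow> smooth_manifold A \<and> riemannian_metric A g"

definition conf_metric :: "('p \<Rightarrow> real) \<Rightarrow> ('n::finite, 'p) metric \<Rightarrow> ('n, 'p) metric" where
  "conf_metric \<Upsilon> g = (\<lambda>(V, \<psi>) y. exp (2 * \<Upsilon> (\<psi> y)) *\<^sub>R g (V, \<psi>) y)"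

text \<open>
  For a diffeomorphism \<open>\<Phi>\<close>, the components of \<open>\<Phi>\<^sup>* g\<close> in the chart \<open>\<psi>\<close> are those of \<open>g\<close>
  in the chart \<open>\<Phi> \<circ> \<psi>\<close>, which belongs to the atlas by maximality.
\<close>

definition pullback_metric :: "('p \<Rightarrow> 'p) \<Rightarrow> ('n::finite, 'p) metric \<Rightarrow> ('n, 'p) metric" where
  "pullback_metric \<Phi> g = (\<lambda>(V, \<psi>) y. g (V, \<Phi> \<circ> \<psi>) y)"

definition Conf_group :: "('n::finite, 'p) atlas \<Rightarrow> ('n, 'p) metric \<Rightarrow> ('p \<Rightarrow> 'p) set" where
  "Conf_group A g = {\<Phi>. diffeo A \<Phi> \<and> (\<exists>\<Upsilon>\<in>Cinf A. \<forall>(V, \<psi>)\<in>A. \<forall>y\<in>V.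
      pullback_metric \<Phi> g (V, \<psi>) y = conf_metric \<Upsilon> g (V, \<psi>) y)}"

text \<open>The Borel measure with density \<open>sqrt (det g\<^sub>i\<^sub>j)\<close> in every chart.\<close>

definition dV :: "('n::finite, 'p) atlas \<Rightarrow> ('n, 'p) metric \<Rightarrow> 'p measure" where
  "dV A g = (THE \<mu>. space \<mu> = carrier A \<and>
     sets \<mu> = sigma_sets (carrier A) {W. openin (chart_top A) W} \<and>
     (\<forall>(V, \<psi>)\<in>A. \<forall>B\<in>sets borel. B \<subseteq> V \<longrightarrow>
        emeasure \<mu> (\<psi> ` B) = (\<integral>\<^sup>+ y\<in>B. ennreal (sqrt (det (g (V, \<psi>) y))) \<partial>lborel)))"

text \<open>\<open>jacobian A g \<Phi>\<close> is \<open>|J\<^sub>\<Phi>|\<close>; the conditions determine it on the carrier.\<close>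

definition jacobian :: "('n::finite, 'p) atlas \<Rightarrow> ('n, 'p) metric \<Rightarrow> ('p \<Rightarrow> 'p) \<Rightarrow> 'p \<Rightarrow> real" where
  "jacobian A g \<Phi> = (SOME J. J \<in> Cinf A \<and> (\<forall>x\<in>carrier A. J x > 0) \<and>
     dV A (pullback_metric \<Phi> g) = density (dV A g) (\<lambda>x. ennreal (J x)))"

definition Lp_norm :: "('n::finite, 'p) atlas \<Rightarrow> ('n, 'p) metric \<Rightarrow> real \<Rightarrow> ('p \<Rightarrow> real) \<Rightarrow> real" where
  "Lp_norm A g q u = (LINT x|dV A g. \<bar>u x\<bar> powr q) powr (1 / q)"


section \<open>Covariant derivatives and curvature in coordinates\<close>

text \<open>
  \<open>G\<close> is the matrix of metric components in a chart.  A covariant tensor of rank \<open>m\<close> is the family of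
  its component functions indexed by lists of length \<open>m\<close>.
\<close>

type_synonym 'n tensor = "'n list \<Rightarrow> real^'n \<Rightarrow> real"

text \<open>\<open>christoffel G k i j\<close> is \<open>\<Gamma>\<^sup>k\<^sub>i\<^sub>j\<close>.\<close>

definition christoffel :: "(real^'n \<Rightarrow> real^'n^'n) \<Rightarrow> 'n::finite \<Rightarrow> 'n \<Rightarrow> 'n \<Rightarrow> real^'n \<Rightarrow> real" where
  "christoffel G k i j y = (1/2) * (\<Sum>l\<in>UNIV. matrix_inv (G y) $ k $ l *
     (partial i (\<lambda>z. G z $ j $ l) y + partial j (\<lambda>z. G z $ i $ l) y - partial l (\<lambda>z. G z $ i $ j) y))"

text \<open>The components \<open>g (R (\<partial>\<^sub>i, \<partial>\<^sub>j) \<partial>\<^sub>k, \<partial>\<^sub>l)\<close> for \<open>I = [i, j, k, l]\<close>.\<close>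

definition Rm :: "(real^'n \<Rightarrow> real^'n^'n) \<Rightarrow> 'n::finite tensor" where
  "Rm G I y = (let i = I ! 0; j = I ! 1; k = I ! 2; l = I ! 3 in
     \<Sum>m\<in>UNIV. G y $ m $ l *
       (partial i (christoffel G m j k) y - partial j (christoffel G m i k) y
        + (\<Sum>p\<in>UNIV. christoffel G m i p y * christoffel G p j k y
                   - christoffel G m j p y * christoffel G p i k y)))"

text \<open>The direction of differentiation is the first index.\<close>

fun cov_deriv :: "(real^'n \<Rightarrow> real^'n^'n) \<Rightarrow> 'n::finite tensor \<Rightarrow> 'n tensor" where
  "cov_deriv G T [] y = 0"
| "cov_deriv G T (i # J) y = partial i (T J) y
     - (\<Sum>s<length J. \<Sum>m\<in>UNIV. christoffel G m i (J ! s) y * T (J[s := m]) y)"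


section \<open>Polydifferential operators\<close>

text \<open>
  A complete contraction of \<open>\<nabla>\<^sup>N\<^sup>1 Rm \<otimes> \<dots> \<otimes> \<nabla>\<^sup>N\<^sup>p Rm \<otimes> \<nabla>\<^sup>M\<^sup>1 u\<^sub>1 \<otimes> \<dots> \<otimes> \<nabla>\<^sup>M\<^sup>l u\<^sub>l\<close> is given by
  the orders \<open>N\<close> and \<open>M\<close> and by a list of pairs that matches up all the index slots, numbered
  consecutively from \<open>0\<close>.
\<close>

datatype contraction =
  Contraction (curv_orders: "nat list") (fun_orders: "nat list") (pairing: "(nat \<times> nat) list")

definition slots :: "contraction \<Rightarrow> nat" where
  "slots K = sum_list (map (\<lambda>N. N + 4) (curv_orders K)) + sum_list (fun_orders K)"

definition wf_contraction :: "nat \<Rightarrow> contraction \<Rightarrow> bool" where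
  "wf_contraction l K \<longleftrightarrow> length (fun_orders K) = l \<and>
     distinct (map fst (pairing K) @ map snd (pairing K)) \<and>
     set (map fst (pairing K) @ map snd (pairing K)) = {..<slots K}"

fun tensor_prod :: "(nat \<times> 'n tensor) list \<Rightarrow> 'n::finite tensor" where
  "tensor_prod [] I y = 1"
| "tensor_prod ((m, T) # Ts) I y = T (take m I) y * tensor_prod Ts (drop m I) y"

definition factors ::
  "(real^'n \<Rightarrow> real^'n^'n) \<Rightarrow> (real^'n \<Rightarrow> real) list \<Rightarrow> contraction \<Rightarrow> (nat \<times> 'n::finite tensor) list" where
  "factors G fs K =
     map (\<lambda>N. (N + 4, (cov_deriv G ^^ N) (Rm G))) (curv_orders K) @
     map2 (\<lambda>N f. (N, (cov_deriv G ^^ N) (\<lambda>_. f))) (fun_orders K) fs"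

definition contract ::
  "(real^'n \<Rightarrow> real^'n^'n) \<Rightarrow> (real^'n \<Rightarrow> real) list \<Rightarrow> contraction \<Rightarrow> real^'n::finite \<Rightarrow> real" where
  "contract G fs K y = (\<Sum>I\<in>{I. length I = slots K}.
     (\<Prod>(s, t)\<leftarrow>pairing K. matrix_inv (G y) $ (I ! s) $ (I ! t)) * tensor_prod (factors G fs K) I y)"

text \<open>
  An operator assigns to each Riemannian manifold a map on lists of functions; a list
  \<open>[u\<^sub>1, \<dots>, u\<^sub>l]\<close> stands for \<open>u\<^sub>1 \<otimes> \<dots> \<otimes> u\<^sub>l\<close>.  Multilinearity and smoothness of the values
  are consequences of the local formula.  Quantification over all Riemannian manifolds ranges over
  those whose points belong to the type \<open>'p\<close>; up to isometry these are all of them as soon as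
  \<open>'p\<close> has the cardinality of the continuum, and a complete contraction is isometry invariant.
\<close>

type_synonym ('n, 'p) poly_op =
  "('n, 'p) atlas \<Rightarrow> ('n, 'p) metric \<Rightarrow> ('p \<Rightarrow> real) list \<Rightarrow> 'p \<Rightarrow> real"

definition polydiff_op :: "nat \<Rightarrow> ('n::finite, 'p) poly_op \<Rightarrow> bool" where
  "polydiff_op r D \<longleftrightarrow> r \<ge> 1 \<and>
     (\<exists>E :: (real \<times> contraction) list. (\<forall>(a, K)\<in>set E. wf_contraction (r - 1) K) \<and>
        (\<forall>A g us. riemannian_manifold A g \<and> set us \<subseteq> Cinf A \<and> length us = r - 1 \<longrightarrow>
           (\<forall>(V, \<psi>)\<in>A. \<forall>y\<in>V. D A g us (\<psi> y) =
              (\<Sum>(a, K)\<leftarrow>E. a * contract (g (V, \<psi>)) (map (\<lambda>u. u \<circ> \<psi>) us) K y))))"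

definition symmetric_op :: "nat \<Rightarrow> ('n::finite, 'p) poly_op \<Rightarrow> bool" where
  "symmetric_op r D \<longleftrightarrow>
     (\<forall>A g us vs. riemannian_manifold A g \<and> set us \<subseteq> Cinf A \<and> length us = r - 1 \<and> mset vs = mset us \<longrightarrow>
        (\<forall>x\<in>carrier A. D A g vs x = D A g us x))"

definition conformally_covariant :: "nat \<Rightarrow> ('n::finite, 'p) poly_op \<Rightarrow> bool" where
  "conformally_covariant r D \<longleftrightarrow>
     (\<exists>(a :: nat \<Rightarrow> real) (b :: real). \<forall>A g \<Upsilon> us.
        riemannian_manifold A g \<and> \<Upsilon> \<in> Cinf A \<and> set us \<subseteq> Cinf A \<and> length us = r - 1 \<longrightarrow>
        (\<forall>x\<in>carrier A. D A (conf_metric \<Upsilon> g) us x =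
           exp (b * \<Upsilon> x) * D A g (map (\<lambda>j q. exp (- a j * \<Upsilon> q) * (us ! j) q) [0..<r - 1]) x))"

definition homogeneity :: "nat \<Rightarrow> real \<Rightarrow> ('n::finite, 'p) poly_op \<Rightarrow> bool" where
  "homogeneity r h D \<longleftrightarrow>
     (\<forall>A g us. riemannian_manifold A g \<and> set us \<subseteq> Cinf A \<and> length us = r - 1 \<longrightarrow>
        (\<forall>c>0. \<forall>x\<in>carrier A. D A (\<lambda>ch y. c\<^sup>2 *\<^sub>R g ch y) us x = c powr h * D A g us x))"

definition dirichlet ::
  "('n::finite, 'p) poly_op \<Rightarrow> ('n, 'p) atlas \<Rightarrow> ('n, 'p) metric \<Rightarrow> ('p \<Rightarrow> real) list \<Rightarrow> real" where
  "dirichlet D A g us = (LINT x|dV A g. hd us x * D A g (tl us) x)"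

definition fsa_conf_cov_op :: "nat \<Rightarrow> real \<Rightarrow> ('n::finite, 'p) poly_op \<Rightarrow> bool" where
  "fsa_conf_cov_op r k D \<longleftrightarrow>
     polydiff_op r D \<and> homogeneity r (- 2 * k) D \<and>
     (\<forall>A g us vs. riemannian_manifold A g \<and> set us \<subseteq> Cinf0 A \<and> length us = r \<and> mset vs = mset us \<longrightarrow>
        dirichlet D A g vs = dirichlet D A g us) \<and>
     (let w = - (real CARD('n) - 2 * k) / real r in
      \<forall>A g \<Upsilon> us. riemannian_manifold A g \<and> \<Upsilon> \<in> Cinf A \<and> set us \<subseteq> Cinf0 A \<and> length us = r \<longrightarrow>
        dirichlet D A (conf_metric \<Upsilon> g) (map (\<lambda>u q. exp (w * \<Upsilon> q) * u q) us) = dirichlet D A g us)"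

text \<open>
  An element \<open>(\<rho>, C)\<close> of the finite set \<open>\<C>\<close> is an operator \<open>C\<close> together with its rank \<open>\<rho>\<close>.
\<close>

definition constrained_op ::
  "nat \<Rightarrow> real \<Rightarrow> ('n::finite, 'p) poly_op \<Rightarrow> (nat \<times> ('n, 'p) poly_op) set \<Rightarrow> bool" where
  "constrained_op r k D \<C> \<longleftrightarrow>
     fsa_conf_cov_op r k D \<and> finite \<C> \<and>
     (\<forall>(\<rho>, C)\<in>\<C>. polydiff_op \<rho> C \<and> symmetric_op \<rho> C \<and> conformally_covariant \<rho> C \<and>
        (\<exists>b :: real. \<forall>A g \<Upsilon> u. riemannian_manifold A g \<and> \<Upsilon> \<in> Cinf A \<and> u \<in> Cinf A \<longrightarrow>
           (\<forall>x\<in>carrier A. C A (conf_metric \<Upsilon> g) (replicate (\<rho> - 1) u) x =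
              exp (b * \<Upsilon> x) * C A g (replicate (\<rho> - 1)
                (\<lambda>q. exp ((real CARD('n) - 2 * k) / real r * \<Upsilon> q) * u q)) x)))"

definition constrained_cone ::
  "(nat \<times> ('n::finite, 'p) poly_op) set \<Rightarrow> ('n, 'p) atlas \<Rightarrow> ('n, 'p) metric \<Rightarrow> ('p \<Rightarrow> real) set" where
  "constrained_cone \<C> A g = {u \<in> Cinf A. \<forall>(\<rho>, C)\<in>\<C>. \<forall>x\<in>carrier A. C A g (replicate (\<rho> - 1) u) x > 0}"


section \<open>The round sphere\<close>

text \<open>
  The points of \<open>\<real>\<^sup>n\<^sup>+\<^sup>1\<close> are vectors indexed by \<open>'n option\<close>.  The atlas consists of all smooth
  injective immersions of open subsets of \<open>\<real>\<^sup>n\<close> into the sphere; by the inverse function theorem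
  this is the maximal atlas of the sphere as a submanifold.
\<close>

definition sphere_atlas :: "('n::finite, real^('n option)) atlas" where
  "sphere_atlas = {(V, \<psi>). open V \<and> inj_on \<psi> V \<and> \<psi> ` V \<subseteq> sphere 0 1 \<and> smooth_on V \<psi> \<and>
     (\<forall>y\<in>V. inj (frechet_derivative \<psi> (at y)))}"

definition round_metric :: "('n::finite, real^('n option)) metric" where
  "round_metric = (\<lambda>(V, \<psi>) y. \<chi> i j. partial i \<psi> y \<bullet> partial j \<psi> y)"

text \<open>\<open>comm1 T x [u\<^sub>1, \<dots>, u\<^sub>l]\<close> is \<open>[T, x]\<^sub>1 (u\<^sub>1 \<otimes> \<dots> \<otimes> u\<^sub>l)\<close>; it is only used for \<open>l \<ge> 1\<close>.\<close>

definition comm1 ::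
  "(('p \<Rightarrow> real) list \<Rightarrow> 'p \<Rightarrow> real) \<Rightarrow> ('p \<Rightarrow> real) \<Rightarrow> ('p \<Rightarrow> real) list \<Rightarrow> 'p \<Rightarrow> real" where
  "comm1 T x us p = T ((\<lambda>q. x q * hd us q) # tl us) p - x p * T us p"

definition frank_lieb ::
  "nat \<Rightarrow> real \<Rightarrow> ('n::finite, real^('n option)) poly_op \<Rightarrow> (nat \<times> ('n, real^('n option)) poly_op) set \<Rightarrow> bool"
where
  "frank_lieb r k D \<C> \<longleftrightarrow>
     (\<lambda>_. 1) \<in> constrained_cone \<C> sphere_atlas round_metric \<and>
     (\<forall>u\<in>constrained_cone \<C> sphere_atlas round_metric.
        let lhs = dirichlet D sphere_atlas round_metric (replicate r u);
            rhs = (real r - 1) * (real CARD('n) - 2 * k) / (2 * real r * k) *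
              (LINT p|dV sphere_atlas round_metric. (\<Sum>i\<in>UNIV. p $ i * u p *
                 comm1 (D sphere_atlas round_metric) (\<lambda>q. q $ i) (replicate (r - 1) u) p))
        in lhs \<ge> rhs \<and> (lhs = rhs \<longleftrightarrow> (\<exists>c. \<forall>p\<in>sphere 0 1. u p = c)))"

definition quotient_functional ::
  "nat \<Rightarrow> real \<Rightarrow> ('n::finite, real^('n option)) poly_op \<Rightarrow> (real^('n option) \<Rightarrow> real) \<Rightarrow> real" where
  "quotient_functional r k D u =
     dirichlet D sphere_atlas round_metric (replicate r u) /
     Lp_norm sphere_atlas round_metric (real r * real CARD('n) / (real CARD('n) - 2 * k)) u ^ r"

definition local_minimizer_on :: "'a topology \<Rightarrow> 'a set \<Rightarrow> ('a \<Rightarrow> real) \<Rightarrow> 'a \<Rightarrow> bool" where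
  "local_minimizer_on X S F u \<longleftrightarrow>
     u \<in> S \<and> (\<exists>W. openin X W \<and> u \<in> W \<and> (\<forall>v\<in>W \<inter> S. F u \<le> F v))"

text \<open>The action \<open>v \<cdot> \<Phi>\<close> of the conformal group of the round sphere.\<close>

definition conf_act ::
  "nat \<Rightarrow> real \<Rightarrow> (real^('n option) \<Rightarrow> real) \<Rightarrow> (real^('n option) \<Rightarrow> real^('n option)) \<Rightarrow> real^('n::finite) option \<Rightarrow> real"
where
  "conf_act r k v \<Phi> p =
     jacobian (sphere_atlas :: ('n, real^('n option)) atlas) round_metric \<Phi> p
       powr ((real CARD('n) - 2 * k) / (real r * real CARD('n))) * v (\<Phi> p)"

end

(*
  Let u be a local minimizer and q = r*.  By Brouwer's theorem some Moebius transformation Phi of the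
  sphere moves the centre of mass of |u|^q dV to the origin.  Let v be u transported by Phi.  Perturb
  u in the directions u (x_i o Phi), that is, v in the directions x_i v: the first variation of the
  L^q norm vanishes because of the balancing, and the second variation of the quotient is
  nonnegative.  Summed over i, with sum x_i^2 = 1 and the conformal invariance of the Dirichlet form
  E, this reads (r - 1) (I + E(v)) >= (q - 1) E(v), where I is the commutator integral in the
  Frank-Lieb Property.  Since q - r = 2rk / (n - 2k), this is the reverse of the Frank-Lieb
  inequality, so v is constant by the equality case, and u is the transport of a constant.
  Perturbing u instead of v makes the continuity of the conformal action in the C^infinity topology
  irrelevant.
*)
theory Submission
  imports Defs "HOL-Real_Asymp.Real_Asymp"
begin

section \<open>Calculus of \<open>C\<^sup>k\<close> functions\<close>

text \<open>The volume is only given as the unique measure with prescribed densities in all charts,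
  and an operator only through its coordinate formula. Invariance under a conformal map
  \<open>\<Phi>\<close> therefore comes from comparing the chart \<open>\<psi>\<close> for the
  conformally changed metric with the chart \<open>\<Phi> \<circ> \<psi>\<close> for the round one:
  same matrix, same functions, hence the same contraction and the same density. No tensor is ever
  pulled back.

  The perturbations are kept in the product form u (1 + t y) with |y| \<le> 1. For |t| < 1 the
  integrand of the norm splits as |u|^q (1 + t y)^q, which is smooth in t even where u vanishes or
  changes sign. The Dirichlet form along the line is a polynomial in t, by symmetry and linearity in
  one slot.

  Two signs are unknown. The value E(u) may be negative or zero, so the minimality inequality is
  only multiplied by powers of the norm. The first variation of E is not computed either: adding the
  inequalities for t and -t removes it.\<close>

lemma Ck_on_cong_imp:
  assumes "open S" "\<And>x. x \<in> S \<Longrightarrow> f x = g x" "Ck_on m S f"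
  shows "Ck_on m S g"
  using assms(2,3)
proof (induction m arbitrary: f g)
  case 0
  then show ?case by (simp cong: continuous_on_cong)
next
  case (Suc m)
  have d: "(g has_derivative frechet_derivative f (at x)) (at x)" if "x \<in> S" for x
    using that Suc.prems assms(1)
    by (auto intro!: has_derivative_transform_within_open[of f _ x UNIV S g]
        simp: frechet_derivative_works[symmetric])
  have "Ck_on m S (\<lambda>x. frechet_derivative g (at x) v)" for v
  proof (rule Suc.IH)
    show "Ck_on m S (\<lambda>x. frechet_derivative f (at x) v)" using Suc.prems by simp
    show "frechet_derivative f (at x) v = frechet_derivative g (at x) v" if "x \<in> S" for x
      using frechet_derivative_at[OF d[OF that]] by simp
  qed
  with d show ?case by (auto simp: differentiable_def)
qed

lemma Ck_on_cong:
  assumes "open S" "\<And>x. x \<in> S \<Longrightarrow> f x = g x"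
  shows "Ck_on m S f \<longleftrightarrow> Ck_on m S g"
  using Ck_on_cong_imp[of S f g m] Ck_on_cong_imp[of S g f m] assms by auto

lemma Ck_on_Suc_has_derivative:
  "Ck_on (Suc m) S f \<Longrightarrow> x \<in> S \<Longrightarrow> (f has_derivative frechet_derivative f (at x)) (at x)"
  by (auto simp: frechet_derivative_works[symmetric])

text \<open>\<open>Ck_on\<close> recurses through the choice term \<open>frechet_derivative\<close>.
  This form lets an explicit derivative formula take its place, so that the induction hypotheses
  below apply to sums and products of known functions.\<close>

lemma Ck_on_SucI:
  assumes "open S" "\<And>x. x \<in> S \<Longrightarrow> (f has_derivative f' x) (at x)" "\<And>v. Ck_on m S (\<lambda>x. f' x v)"
  shows "Ck_on (Suc m) S f"
proof -
  have "Ck_on m S (\<lambda>x. frechet_derivative f (at x) v)" for v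
    using assms(3)[of v] frechet_derivative_at[OF assms(2)]
    by (subst Ck_on_cong[OF assms(1), of _ "\<lambda>x. f' x v"]) auto
  with assms(2) show ?thesis by (auto simp: differentiable_def)
qed

lemma Ck_on_imp_continuous_on: "Ck_on m S f \<Longrightarrow> continuous_on S f"
  by (cases m) (auto intro!: continuous_at_imp_continuous_on differentiable_imp_continuous_within)

lemma Ck_on_Suc_imp: "Ck_on (Suc m) S f \<Longrightarrow> Ck_on m S f"
  by (induction m arbitrary: f) (auto intro: Ck_on_imp_continuous_on intro!: continuous_at_imp_continuous_on differentiable_imp_continuous_within)

lemma Ck_on_subset: "Ck_on m S f \<Longrightarrow> T \<subseteq> S \<Longrightarrow> Ck_on m T f"
  by (induction m arbitrary: f) (auto intro: continuous_on_subset)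

lemma Ck_on_local:
  assumes "\<And>x. x \<in> S \<Longrightarrow> \<exists>U. open U \<and> x \<in> U \<and> Ck_on m U f"
  shows "Ck_on m S f"
  using assms
proof (induction m arbitrary: f)
  case 0
  show ?case unfolding Ck_on.simps
  proof (rule continuous_at_imp_continuous_on, rule ballI)
    fix x assume "x \<in> S"
    then obtain U where "open U" "x \<in> U" "continuous_on U f" using 0 by auto
    then show "isCont f x" by (simp add: continuous_on_eq_continuous_at)
  qed
next
  case (Suc m)
  have "f differentiable at x" if "x \<in> S" for x using Suc.prems[OF that] by auto
  moreover have "Ck_on m S (\<lambda>x. frechet_derivative f (at x) v)" for v
  proof (rule Suc.IH)
    fix x assume "x \<in> S"
    from Suc.prems[OF this] show "\<exists>U. open U \<and> x \<in> U \<and> Ck_on m U (\<lambda>x. frechet_derivative f (at x) v)" by auto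
  qed
  ultimately show ?case by simp
qed

lemma Ck_on_const [simp]: "Ck_on m S (\<lambda>x. c)"
  by (induction m arbitrary: c) auto

lemma Ck_on_linear:
  assumes "bounded_linear f" "open S"
  shows "Ck_on m S f"
proof (cases m)
  case 0
  then show ?thesis using assms(1) by (simp add: linear_continuous_on)
next
  case (Suc j)
  show ?thesis unfolding Suc
    by (rule Ck_on_SucI[OF assms(2), of _ "\<lambda>x. f"]) (auto intro: bounded_linear_imp_has_derivative assms)
qed

lemma Ck_on_linear_compose:
  assumes "bounded_linear h" "open S" "Ck_on m S f"
  shows "Ck_on m S (\<lambda>x. h (f x))"
  using assms(3)
proof (induction m arbitrary: f)
  case 0
  then show ?case using assms(1) by (auto intro: bounded_linear.continuous_on)
next
  case (Suc m)
  show ?case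
    by (rule Ck_on_SucI[OF assms(2) bounded_linear.has_derivative[OF assms(1)]])
      (use Suc Ck_on_Suc_has_derivative[OF Suc.prems] in auto)
qed

lemma Ck_on_add:
  assumes "open S" "Ck_on m S f" "Ck_on m S g"
  shows "Ck_on m S (\<lambda>x. f x + g x)"
  using assms(2,3)
proof (induction m arbitrary: f g)
  case 0
  then show ?case by (auto intro: continuous_intros)
next
  case (Suc m)
  show ?case
    by (rule Ck_on_SucI[OF assms(1) has_derivative_add])
      (use Suc Ck_on_Suc_has_derivative[OF Suc.prems(1)] Ck_on_Suc_has_derivative[OF Suc.prems(2)] in auto)
qed

text \<open>In the product rule one factor is differentiated and the other is kept, so both terms
  are again bilinear in functions of the lower class; hence the induction runs over all pairs
  \<open>f\<close>, \<open>g\<close>. Products, scalar multiples and inner products are the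
  instances used.\<close>

lemma Ck_on_bilinear:
  assumes "bounded_bilinear B" "open S" "Ck_on m S f" "Ck_on m S g"
  shows "Ck_on m S (\<lambda>x. B (f x) (g x))"
  using assms(3,4)
proof (induction m arbitrary: f g)
  case 0
  then show ?case using assms(1) by (auto intro: bounded_bilinear.continuous_on)
next
  case (Suc m)
  show ?case
  proof (rule Ck_on_SucI[OF assms(2)])
    show "((\<lambda>x. B (f x) (g x)) has_derivative (\<lambda>v. B (f x) (frechet_derivative g (at x) v)
        + B (frechet_derivative f (at x) v) (g x))) (at x)" if "x \<in> S" for x
      by (rule bounded_bilinear.FDERIV[OF assms(1) Ck_on_Suc_has_derivative[OF Suc.prems(1) that]
            Ck_on_Suc_has_derivative[OF Suc.prems(2) that]])
    show "Ck_on m S (\<lambda>x. B (f x) (frechet_derivative g (at x) v)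
        + B (frechet_derivative f (at x) v) (g x))" for v
      using Suc.prems Ck_on_Suc_imp[OF Suc.prems(1)] Ck_on_Suc_imp[OF Suc.prems(2)]
      by (intro Ck_on_add[OF assms(2)] Suc.IH) simp_all
  qed
qed

lemma Ck_on_sum:
  assumes "open S" "\<And>i. i \<in> I \<Longrightarrow> Ck_on m S (f i)"
  shows "Ck_on m S (\<lambda>x. \<Sum>i\<in>I. f i x)"
  using assms(2) by (induction I rule: infinite_finite_induct) (auto intro: Ck_on_add[OF assms(1)])

lemma Ck_on_euclideanI:
  fixes f :: "'a::real_normed_vector \<Rightarrow> 'b::euclidean_space"
  assumes "open S" "\<And>b. b \<in> Basis \<Longrightarrow> Ck_on m S (\<lambda>x. f x \<bullet> b)"
  shows "Ck_on m S f"
proof -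
  have "Ck_on m S (\<lambda>x. \<Sum>b\<in>Basis. (f x \<bullet> b) *\<^sub>R b)"
    using assms by (intro Ck_on_sum Ck_on_linear_compose[OF bounded_linear_scaleR_left])
  then show ?thesis by (simp add: euclidean_representation)
qed

lemma linear_expansion_Basis:
  fixes L :: "'a::euclidean_space \<Rightarrow> 'b::real_normed_vector"
  assumes "linear L"
  shows "L w = (\<Sum>b\<in>Basis. (w \<bullet> b) *\<^sub>R L b)"
proof -
  have "L w = L (\<Sum>b\<in>Basis. (w \<bullet> b) *\<^sub>R b)" by (simp only: euclidean_representation)
  also have "\<dots> = (\<Sum>b\<in>Basis. L ((w \<bullet> b) *\<^sub>R b))" using assms by (rule linear_sum)
  finally show ?thesis by (simp only: linear_cmul[OF assms])
qed

text \<open>\<open>Ck_on\<close> controls the derivative of \<open>f\<close> only in fixed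
  directions, while the chain rule evaluates it in a direction that moves with the point. Expanding
  this direction in the basis gives finitely many products of a component of the derivative of
  \<open>g\<close> with a fixed directional derivative of \<open>f\<close> along \<open>g\<close>,
  and the induction hypothesis applies to the latter. This is why the middle space is
  Euclidean.\<close>

lemma Ck_on_compose:
  fixes f :: "'b::euclidean_space \<Rightarrow> 'c::real_normed_vector" and g :: "'a::real_normed_vector \<Rightarrow> 'b"
  assumes "open S" "open T" "Ck_on m S g" "Ck_on m T f" "g ` S \<subseteq> T"
  shows "Ck_on m S (\<lambda>x. f (g x))"
  using assms(3,4)
proof (induction m arbitrary: f)
  case 0
  then show ?case using assms(5) by (auto intro: continuous_on_compose2)
next
  case (Suc m)
  let ?f = "\<lambda>x. frechet_derivative f (at x)" and ?g = "\<lambda>x. frechet_derivative g (at x)"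
  have f': "(f has_derivative ?f (g x)) (at (g x))" if "x \<in> S" for x
    using Ck_on_Suc_has_derivative[OF Suc.prems(2)] that assms(5) by auto
  have "((\<lambda>x. f (g x)) has_derivative (\<lambda>v. \<Sum>b\<in>Basis. (?g x v \<bullet> b) *\<^sub>R ?f (g x) b)) (at x)" if "x \<in> S" for x
  proof -
    have "?f (g x) w = (\<Sum>b\<in>Basis. (w \<bullet> b) *\<^sub>R ?f (g x) b)" for w
      using linear_expansion_Basis[OF has_derivative_linear[OF f'[OF that]]] .
    then show ?thesis
      by (intro has_derivative_eq_rhs[OF has_derivative_compose[OF
            Ck_on_Suc_has_derivative[OF Suc.prems(1) that] f'[OF that]]] ext)
  qed
  then show ?case
  proof (rule Ck_on_SucI[OF assms(1)])
    show "Ck_on m S (\<lambda>x. \<Sum>b\<in>Basis. (?g x v \<bullet> b) *\<^sub>R ?f (g x) b)" for v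
      using Suc Ck_on_Suc_imp[OF Suc.prems(1)]
      by (intro Ck_on_sum[OF assms(1)] Ck_on_bilinear[OF bounded_bilinear_scaleR assms(1)]
          Ck_on_linear_compose[OF bounded_linear_inner_left assms(1)] Suc.IH) auto
  qed
qed

lemma smooth_onI: "(\<And>m. Ck_on m S f) \<Longrightarrow> smooth_on S f"
  by (simp add: smooth_on_def)

lemma smooth_onD: "smooth_on S f \<Longrightarrow> Ck_on m S f"
  by (simp add: smooth_on_def)

lemma smooth_on_cong:
  "open S \<Longrightarrow> (\<And>x. x \<in> S \<Longrightarrow> f x = g x) \<Longrightarrow> smooth_on S f \<longleftrightarrow> smooth_on S g"
  using Ck_on_cong[of S f g] by (simp add: smooth_on_def)

lemma smooth_on_imp_continuous_on: "smooth_on S f \<Longrightarrow> continuous_on S f"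
  using smooth_onD Ck_on_imp_continuous_on by blast

lemma smooth_on_has_derivative:
  "smooth_on S f \<Longrightarrow> x \<in> S \<Longrightarrow> (f has_derivative frechet_derivative f (at x)) (at x)"
  using Ck_on_Suc_has_derivative smooth_onD by blast

lemma smooth_on_differentiable: "smooth_on S f \<Longrightarrow> x \<in> S \<Longrightarrow> f differentiable (at x)"
  using smooth_on_has_derivative differentiable_def by blast

lemma smooth_on_subset: "smooth_on S f \<Longrightarrow> T \<subseteq> S \<Longrightarrow> smooth_on T f"
  unfolding smooth_on_def by (blast intro: Ck_on_subset)

lemma smooth_on_local:
  "(\<And>x. x \<in> S \<Longrightarrow> \<exists>U. open U \<and> x \<in> U \<and> smooth_on U f) \<Longrightarrow> smooth_on S f"
  by (rule smooth_onI, rule Ck_on_local) (metis smooth_onD)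

lemma smooth_on_frechet_derivative: "smooth_on S f \<Longrightarrow> smooth_on S (\<lambda>x. frechet_derivative f (at x) v)"
  unfolding smooth_on_def by (metis Ck_on.simps(2))

lemma smooth_on_const [simp]: "smooth_on S (\<lambda>x. c)"
  by (simp add: smooth_on_def)

lemma smooth_on_linear: "bounded_linear f \<Longrightarrow> open S \<Longrightarrow> smooth_on S f"
  by (simp add: smooth_on_def Ck_on_linear)

lemma smooth_on_ident: "open S \<Longrightarrow> smooth_on S (\<lambda>x. x)"
  by (simp add: smooth_on_linear)

lemma smooth_on_linear_compose:
  "bounded_linear h \<Longrightarrow> open S \<Longrightarrow> smooth_on S f \<Longrightarrow> smooth_on S (\<lambda>x. h (f x))"
  by (simp add: smooth_on_def Ck_on_linear_compose)

lemma smooth_on_add: "open S \<Longrightarrow> smooth_on S f \<Longrightarrow> smooth_on S g \<Longrightarrow> smooth_on S (\<lambda>x. f x + g x)"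
  by (simp add: smooth_on_def Ck_on_add)

lemma smooth_on_bilinear:
  "bounded_bilinear B \<Longrightarrow> open S \<Longrightarrow> smooth_on S f \<Longrightarrow> smooth_on S g \<Longrightarrow> smooth_on S (\<lambda>x. B (f x) (g x))"
  by (simp add: smooth_on_def Ck_on_bilinear)

lemmas smooth_on_scaleR = smooth_on_bilinear[OF bounded_bilinear_scaleR]
lemmas smooth_on_mult = smooth_on_bilinear[OF bounded_bilinear_mult]
lemmas smooth_on_inner = smooth_on_bilinear[OF bounded_bilinear_inner]

lemma smooth_on_uminus: "open S \<Longrightarrow> smooth_on S f \<Longrightarrow> smooth_on S (\<lambda>x. - f x)"
  by (rule smooth_on_linear_compose) (auto intro: bounded_linear_minus bounded_linear_ident)

lemma smooth_on_diff: "open S \<Longrightarrow> smooth_on S f \<Longrightarrow> smooth_on S g \<Longrightarrow> smooth_on S (\<lambda>x. f x - g x)"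
  using smooth_on_add[OF _ _ smooth_on_uminus, of S f g] by simp

lemma smooth_on_sum:
  "open S \<Longrightarrow> (\<And>i. i \<in> I \<Longrightarrow> smooth_on S (f i)) \<Longrightarrow> smooth_on S (\<lambda>x. \<Sum>i\<in>I. f i x)"
  by (simp add: smooth_on_def Ck_on_sum)

lemma smooth_on_prod:
  fixes f :: "'i \<Rightarrow> 'a::real_normed_vector \<Rightarrow> real"
  assumes "open S" "\<And>i. i \<in> I \<Longrightarrow> smooth_on S (f i)"
  shows "smooth_on S (\<lambda>x. \<Prod>i\<in>I. f i x)"
  using assms(2) by (induction I rule: infinite_finite_induct) (auto intro: smooth_on_mult[OF assms(1)])

lemma smooth_on_compose:
  fixes f :: "'b::euclidean_space \<Rightarrow> 'c::real_normed_vector" and g :: "'a::real_normed_vector \<Rightarrow> 'b"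
  shows "open S \<Longrightarrow> open T \<Longrightarrow> smooth_on S g \<Longrightarrow> smooth_on T f \<Longrightarrow> g ` S \<subseteq> T \<Longrightarrow> smooth_on S (\<lambda>x. f (g x))"
  by (simp add: smooth_on_def Ck_on_compose)

lemma smooth_on_vec_nth: "open S \<Longrightarrow> smooth_on S f \<Longrightarrow> smooth_on S (\<lambda>x. f x $ i)"
  by (rule smooth_on_linear_compose[OF bounded_linear_vec_nth])

lemma Ck_on_vecI:
  fixes f :: "'a::real_normed_vector \<Rightarrow> real^'m::finite"
  shows "open S \<Longrightarrow> (\<And>i. Ck_on m S (\<lambda>x. f x $ i)) \<Longrightarrow> Ck_on m S f"
  by (rule Ck_on_euclideanI) (auto simp: Basis_vec_def inner_axis)

lemma smooth_on_vecI:
  fixes f :: "'a::real_normed_vector \<Rightarrow> real^'m::finite"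
  shows "open S \<Longrightarrow> (\<And>i. smooth_on S (\<lambda>x. f x $ i)) \<Longrightarrow> smooth_on S f"
  using Ck_on_vecI[of S _ f] by (auto simp: smooth_on_def)

lemma Ck_on_inverse:
  fixes f :: "'a::real_normed_vector \<Rightarrow> real"
  assumes "open S" "Ck_on m S f" "\<And>x. x \<in> S \<Longrightarrow> f x \<noteq> 0"
  shows "Ck_on m S (\<lambda>x. inverse (f x))"
  using assms(2)
proof (induction m)
  case 0
  then show ?case using assms(3) by (auto intro: continuous_intros)
next
  case (Suc m)
  show ?case
  proof (rule Ck_on_SucI[OF assms(1)])
    show "((\<lambda>x. inverse (f x)) has_derivative
        (\<lambda>v. - (inverse (f x) * frechet_derivative f (at x) v * inverse (f x)))) (at x)" if "x \<in> S" for x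
      using Deriv.has_derivative_inverse[OF assms(3)[OF that] Ck_on_Suc_has_derivative[OF Suc.prems that]]
      by simp
    show "Ck_on m S (\<lambda>x. - (inverse (f x) * frechet_derivative f (at x) v * inverse (f x)))" for v
      using Suc Ck_on_Suc_imp[OF Suc.prems]
      by (intro Ck_on_linear_compose[OF bounded_linear_minus[OF bounded_linear_ident]]
           Ck_on_bilinear[OF bounded_bilinear_mult] assms(1)) auto
  qed
qed

lemma smooth_on_inverse:
  fixes f :: "'a::real_normed_vector \<Rightarrow> real"
  shows "open S \<Longrightarrow> smooth_on S f \<Longrightarrow> (\<And>x. x \<in> S \<Longrightarrow> f x \<noteq> 0) \<Longrightarrow> smooth_on S (\<lambda>x. inverse (f x))"
  by (simp add: smooth_on_def Ck_on_inverse)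

lemma smooth_on_divide:
  fixes f g :: "'a::real_normed_vector \<Rightarrow> real"
  shows "open S \<Longrightarrow> smooth_on S f \<Longrightarrow> smooth_on S g \<Longrightarrow> (\<And>x. x \<in> S \<Longrightarrow> g x \<noteq> 0) \<Longrightarrow> smooth_on S (\<lambda>x. f x / g x)"
  unfolding divide_inverse by (intro smooth_on_mult smooth_on_inverse)

lemma smooth_on_exp:
  fixes f :: "'a::real_normed_vector \<Rightarrow> real"
  assumes "open S" "smooth_on S f"
  shows "smooth_on S (\<lambda>x. exp (f x))"
proof (rule smooth_onI)
  show "Ck_on m S (\<lambda>x. exp (f x))" for m
  proof (induction m)
    case 0
    then show ?case using smooth_on_imp_continuous_on[OF assms(2)] by (auto intro: continuous_intros)
  next
    case (Suc m)
    show ?case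
    proof (rule Ck_on_SucI[OF assms(1)])
      show "((\<lambda>x. exp (f x)) has_derivative (\<lambda>v. exp (f x) * frechet_derivative f (at x) v)) (at x)"
        if "x \<in> S" for x
        using has_derivative_exp[OF smooth_on_has_derivative[OF assms(2) that]] by (simp add: mult.commute)
      show "Ck_on m S (\<lambda>x. exp (f x) * frechet_derivative f (at x) v)" for v
        using Suc assms smooth_onD[OF smooth_on_frechet_derivative]
        by (intro Ck_on_bilinear[OF bounded_bilinear_mult]) auto
    qed
  qed
qed

lemma smooth_on_ln:
  fixes f :: "'a::real_normed_vector \<Rightarrow> real"
  assumes "open S" "smooth_on S f" "\<And>x. x \<in> S \<Longrightarrow> f x > 0"
  shows "smooth_on S (\<lambda>x. ln (f x))"
proof (rule smooth_onI)
  show "Ck_on m S (\<lambda>x. ln (f x))" for m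
  proof (cases m)
    case 0
    then show ?thesis using smooth_on_imp_continuous_on[OF assms(2)] assms(3)
      by (auto intro!: continuous_intros simp: less_imp_neq[THEN not_sym])
  next
    case (Suc j)
    show ?thesis unfolding Suc
    proof (rule Ck_on_SucI[OF assms(1)])
      show "((\<lambda>x. ln (f x)) has_derivative (\<lambda>v. frechet_derivative f (at x) v * inverse (f x))) (at x)"
        if "x \<in> S" for x
        using has_derivative_ln[OF assms(3) smooth_on_has_derivative[OF assms(2)], OF that that] by simp
      show "Ck_on j S (\<lambda>x. frechet_derivative f (at x) v * inverse (f x))" for v
        using assms(3)
        by (intro Ck_on_bilinear[OF bounded_bilinear_mult assms(1)] Ck_on_inverse[OF assms(1)]
            smooth_onD[OF smooth_on_frechet_derivative[OF assms(2)]] smooth_onD[OF assms(2)])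
          (metis order_less_irrefl)
    qed
  qed
qed

lemma smooth_on_det:
  fixes A :: "'a::real_normed_vector \<Rightarrow> real^'n^'n::finite"
  assumes "open S" "\<And>i j. smooth_on S (\<lambda>x. A x $ i $ j)"
  shows "smooth_on S (\<lambda>x. det (A x))"
  unfolding det_def using assms
  by (intro smooth_on_sum smooth_on_mult smooth_on_prod smooth_on_const) auto

section \<open>Matrix inverses and the inverse function theorem\<close>

lemma matrix_inv_works:
  fixes A :: "real^'n^'n"
  assumes "det A \<noteq> 0"
  shows "A ** matrix_inv A = mat 1" "matrix_inv A ** A = mat 1"
proof -
  have "\<exists>B. A ** B = mat 1 \<and> B ** A = mat 1"
    using assms invertible_det_nz unfolding invertible_def by blast
  then show "A ** matrix_inv A = mat 1" "matrix_inv A ** A = mat 1"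
    unfolding matrix_inv_def by (metis (mono_tags, lifting) someI_ex)+
qed

lemma matrix_inv_cramer:
  fixes A :: "real^'n^'n"
  assumes "det A \<noteq> 0"
  shows "matrix_inv A $ k $ l = det (\<chi> i j. if j = k then axis l 1 $ i else A $ i $ j) / det A"
proof -
  have "A *v (matrix_inv A *v axis l 1) = axis l 1"
    using matrix_inv_works[OF assms] by (simp add: matrix_vector_mul_assoc)
  from cramer[OF assms, THEN iffD1, OF this]
  have "(matrix_inv A *v axis l 1) $ k = det (\<chi> i j. if j = k then axis l 1 $ i else A $ i $ j) / det A"
    by simp
  then show ?thesis by (simp add: matrix_vector_mul_component inner_axis)
qed

text \<open>By Cramer's rule the entries are quotients of polynomials in the entries of
  \<open>A\<close>.\<close>

lemma smooth_on_matrix_inv: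
  fixes A :: "'a::real_normed_vector \<Rightarrow> real^'n^'n::finite"
  assumes "open S" "\<And>i j. smooth_on S (\<lambda>x. A x $ i $ j)" "\<And>x. x \<in> S \<Longrightarrow> det (A x) \<noteq> 0"
  shows "smooth_on S (\<lambda>x. matrix_inv (A x) $ k $ l)"
proof -
  have "smooth_on S (\<lambda>x. det (\<chi> i j. if j = k then axis l 1 $ i else A x $ i $ j) / det (A x))"
  proof (intro smooth_on_divide smooth_on_det assms)
    show "smooth_on S (\<lambda>x. (\<chi> i j. if j = k then axis l 1 $ i else A x $ i $ j) $ i $ j)" for i j
      using assms(2) by (cases "j = k") simp_all
  qed
  then show ?thesis
    using matrix_inv_cramer[OF assms(3)] by (subst smooth_on_cong[OF assms(1)]) auto
qed

lemma matrix_frechet_det_nonzero: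
  fixes f :: "real^'n \<Rightarrow> real^'n"
  assumes "f differentiable (at x)" "inj (frechet_derivative f (at x))"
  shows "det (matrix (frechet_derivative f (at x))) \<noteq> 0"
  using assms linear_frechet_derivative det_nz_iff_inj by blast

text \<open>A global inverse function theorem for injective immersions between equal dimensions.
  Invariance of domain makes the image open and the inverse continuous. Regularity then bootstraps:
  the derivative of the inverse \<open>?g\<close> at \<open>z\<close> is the inverse matrix taken at
  \<open>?g z\<close>, so if \<open>?g\<close> is of class m, its derivative is too.\<close>

lemma smooth_on_inv_into:
  fixes f :: "real^'n::finite \<Rightarrow> real^'n"
  assumes "open V" "inj_on f V" "smooth_on V f" "\<And>y. y \<in> V \<Longrightarrow> inj (frechet_derivative f (at y))"
  shows "open (f ` V)" "smooth_on (f ` V) (inv_into V f)"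
proof -
  show op: "open (f ` V)"
    using invariance_of_domain[OF smooth_on_imp_continuous_on[OF assms(3)] assms(1,2)] .
  let ?g = "inv_into V f" and ?A = "\<lambda>y. matrix (frechet_derivative f (at y))"
  have gV: "?g z \<in> V" "f (?g z) = z" if "z \<in> f ` V" for z
    using that by (auto intro: inv_into_into f_inv_into_f)
  have nz: "det (?A y) \<noteq> 0" if "y \<in> V" for y
    using matrix_frechet_det_nonzero smooth_on_differentiable[OF assms(3) that] assms(4)[OF that] by blast
  have sm: "smooth_on V (\<lambda>y. ?A y $ i $ j)" for i j
    unfolding matrix_def using smooth_on_vec_nth[OF assms(1) smooth_on_frechet_derivative[OF assms(3)]] by simp
  have smi: "smooth_on V (\<lambda>y. matrix_inv (?A y) $ i $ j)" for i j
    using smooth_on_matrix_inv[OF assms(1) sm nz] .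
  have cont: "continuous_on (f ` V) ?g"
    using continuous_on_inverse_open[of V f ?g] assms(1,2) smooth_on_imp_continuous_on[OF assms(3)]
    by (simp add: inv_into_f_f)
  have der: "(?g has_derivative (\<lambda>v. matrix_inv (?A (?g z)) *v v)) (at z)" if z: "z \<in> f ` V" for z
  proof -
    let ?y = "?g z"
    have d: "(f has_derivative frechet_derivative f (at ?y)) (at ?y)"
      using smooth_on_has_derivative[OF assms(3)] gV z by blast
    have lin: "linear (frechet_derivative f (at ?y))" using d has_derivative_linear by blast
    have "(?g has_derivative (\<lambda>v. matrix_inv (?A (?g z)) *v v)) (at (f ?y))"
    proof (rule has_derivative_inverse_strong[where f = f and x = ?y and S = V, OF assms(1)])
      show "?y \<in> V" using gV z by blast
      show "continuous_on V f" using smooth_on_imp_continuous_on[OF assms(3)] .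
      show "?g (f x) = x" if "x \<in> V" for x using assms(2) that by simp
      have "matrix_inv (?A ?y) ** ?A ?y = mat 1" "?A ?y ** matrix_inv (?A ?y) = mat 1"
        using matrix_inv_works nz gV(1)[OF z] by blast+
      then show "frechet_derivative f (at ?y) \<circ> (\<lambda>v. matrix_inv (?A ?y) *v v) = id"
        by (auto simp: fun_eq_iff matrix_vector_mul_assoc
            simp flip: matrix_works[OF lin[folded linear_matrix_vector_mul_eq]])
    qed (rule d)
    then show ?thesis using gV z by simp
  qed
  show "smooth_on (f ` V) ?g"
  proof (rule smooth_onI)
    show "Ck_on m (f ` V) ?g" for m
    proof (induction m)
      case 0
      then show ?case using cont by simp
    next
      case (Suc m)
      show ?case
      proof (rule Ck_on_SucI[OF op der])
        show "Ck_on m (f ` V) (\<lambda>z. matrix_inv (?A (?g z)) *v v)" for v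
        proof (rule Ck_on_vecI[OF op])
          fix i
          have "Ck_on m (f ` V) (\<lambda>z. \<Sum>j\<in>UNIV. matrix_inv (?A (?g z)) $ i $ j * v $ j)"
            using gV op assms(1) Suc.IH
            by (intro Ck_on_sum Ck_on_linear_compose[OF bounded_linear_mult_left]
                Ck_on_compose[OF op assms(1) Suc.IH smooth_onD[OF smi]]) auto
          then show "Ck_on m (f ` V) (\<lambda>z. (matrix_inv (?A (?g z)) *v v) $ i)"
            by (simp add: matrix_vector_mult_def)
        qed
      qed
    qed
  qed
qed

section \<open>The smooth structure of the sphere\<close>

text \<open>Differentiating \<open>h (f z) = z\<close> exhibits a left inverse of the derivative. In
  this way maps into the sphere are recognised as immersions.\<close>

lemma inj_frechet_derivative_if_left_inverse:
  fixes f :: "'a::real_normed_vector \<Rightarrow> 'b::real_normed_vector" and h :: "'b \<Rightarrow> 'a"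
  assumes "f differentiable (at y)" "h differentiable (at (f y))" "open U" "y \<in> U"
    "\<And>z. z \<in> U \<Longrightarrow> h (f z) = z"
  shows "inj (frechet_derivative f (at y))"
proof -
  have "((\<lambda>z. h (f z)) has_derivative
      (\<lambda>v. frechet_derivative h (at (f y)) (frechet_derivative f (at y) v))) (at y)"
    using assms(1,2) by (auto intro: has_derivative_compose simp: frechet_derivative_works[symmetric])
  moreover have "((\<lambda>z. h (f z)) has_derivative (\<lambda>v. v)) (at y)"
    by (rule has_derivative_transform_within_open[OF has_derivative_ident assms(3,4)]) (simp add: assms(5))
  ultimately have "(\<lambda>v. frechet_derivative h (at (f y)) (frechet_derivative f (at y) v)) = (\<lambda>v. v)"
    by (rule has_derivative_unique)
  then show ?thesis by (metis injI)
qed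

lemma frechet_derivative_expansion:
  fixes f :: "real^'n::finite \<Rightarrow> 'b::real_normed_vector"
  assumes "f differentiable (at y)"
  shows "frechet_derivative f (at y) v = (\<Sum>i\<in>UNIV. v $ i *\<^sub>R partial i f y)"
proof -
  have lin: "linear (frechet_derivative f (at y))" using assms by (rule linear_frechet_derivative)
  have "frechet_derivative f (at y) v = frechet_derivative f (at y) (\<Sum>i\<in>UNIV. v $ i *\<^sub>R axis i 1)"
    using basis_expansion[of v] by (simp add: scalar_mult_eq_scaleR)
  also have "\<dots> = (\<Sum>i\<in>UNIV. v $ i *\<^sub>R frechet_derivative f (at y) (axis i 1))"
    by (simp add: linear_sum[OF lin] linear_cmul[OF lin])
  finally show ?thesis by (simp add: partial_def)
qed

section \<open>Stereographic charts\<close>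

lemma sum_option: "(\<Sum>i\<in>UNIV. f (i :: 'n::finite option)) = f None + (\<Sum>j\<in>UNIV. f (Some j))"
  by (simp add: UNIV_option_conv sum.reindex)

text \<open>Inverse stereographic projection from the pole with \<open>None\<close> coordinate
  \<open>s\<close>, for \<open>s = 1\<close> or \<open>s = -1\<close>. The sign is kept as a
  parameter so that both poles are treated at once.\<close>

definition stereo :: "real \<Rightarrow> real^'n::finite \<Rightarrow> real^('n option)" where
  "stereo s y = (\<chi> i. case i of None \<Rightarrow> s * (y \<bullet> y - 1) / (y \<bullet> y + 1) | Some j \<Rightarrow> 2 * y $ j / (y \<bullet> y + 1))"

definition stereo_proj :: "real \<Rightarrow> real^('n::finite option) \<Rightarrow> real^'n" where
  "stereo_proj s p = (\<chi> j. p $ Some j / (1 - s * p $ None))"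

lemma inner_self_add_one_pos: "(y::'a::real_inner) \<bullet> y + 1 > 0"
  by (simp add: add_nonneg_pos)

lemma stereo_nth [simp]:
  "stereo s y $ None = s * (y \<bullet> y - 1) / (y \<bullet> y + 1)"
  "stereo s y $ Some j = 2 * y $ j / (y \<bullet> y + 1)"
  by (simp_all add: stereo_def)

lemma stereo_denominator: "s\<^sup>2 = 1 \<Longrightarrow> 1 - s * stereo s y $ None = 2 / (y \<bullet> y + 1)"
  using inner_self_add_one_pos[of y] by (simp add: field_simps power2_eq_square)

lemma stereo_proj_stereo [simp]:
  assumes "s\<^sup>2 = 1"
  shows "stereo_proj s (stereo s y) = y"
  using inner_self_add_one_pos[of y]
  unfolding stereo_proj_def stereo_denominator[OF assms] by (simp add: vec_eq_iff)

lemma inner_option: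
  "(p :: real^('n::finite option)) \<bullet> q = p $ None * q $ None + (\<Sum>j\<in>UNIV. p $ Some j * q $ Some j)"
  by (simp add: inner_vec_def sum_option)

lemma stereo_in_sphere:
  assumes "s\<^sup>2 = 1"
  shows "stereo s y \<in> sphere 0 1"
proof -
  have "stereo s y \<bullet> stereo s y = s\<^sup>2 * (y \<bullet> y - 1)\<^sup>2 / (y \<bullet> y + 1)\<^sup>2 + (\<Sum>j\<in>UNIV. 4 * (y $ j * y $ j) / (y \<bullet> y + 1)\<^sup>2)"
    by (simp add: inner_option power2_eq_square algebra_simps)
  also have "\<dots> = (y \<bullet> y - 1)\<^sup>2 / (y \<bullet> y + 1)\<^sup>2 + 4 * (y \<bullet> y) / (y \<bullet> y + 1)\<^sup>2"
    using assms by (simp add: inner_vec_def sum_distrib_left sum_divide_distrib)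
  also have "\<dots> = ((y \<bullet> y - 1)\<^sup>2 + 4 * (y \<bullet> y)) / (y \<bullet> y + 1)\<^sup>2" by (simp add: add_divide_distrib)
  also have "(y \<bullet> y - 1)\<^sup>2 + 4 * (y \<bullet> y) = (y \<bullet> y + 1)\<^sup>2" by (simp add: power2_eq_square algebra_simps)
  finally have "stereo s y \<bullet> stereo s y = 1" using inner_self_add_one_pos[of y] by simp
  then show ?thesis by (simp add: norm_eq_1)
qed

lemma stereo_stereo_proj:
  assumes "s\<^sup>2 = 1" "p \<in> sphere 0 1" "1 - s * p $ None \<noteq> 0"
  shows "stereo s (stereo_proj s p) = p"
proof -
  define c where "c = 1 - s * p $ None"
  let ?y = "stereo_proj s p"
  have c: "c \<noteq> 0" using assms(3) by (simp add: c_def)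
  have "p \<bullet> p = 1" using assms(2) by (simp add: norm_eq_1)
  then have sq: "(\<Sum>j\<in>UNIV. (p $ Some j)\<^sup>2) = 1 - (p $ None)\<^sup>2" by (simp add: inner_option power2_eq_square)
  have h: "1 - (p $ None)\<^sup>2 = c * (2 - c)"
    using assms(1) by (simp add: c_def power2_eq_square algebra_simps)
  have "?y \<bullet> ?y = (\<Sum>j\<in>UNIV. (p $ Some j)\<^sup>2) / c\<^sup>2"
    by (simp add: inner_vec_def stereo_proj_def c_def power2_eq_square sum_divide_distrib)
  also have "\<dots> = (2 - c) / c"
    unfolding sq h using c by (simp add: power2_eq_square)
  finally have yy: "?y \<bullet> ?y = (2 - c) / c" .
  have y1: "?y \<bullet> ?y + 1 = 2 / c" "?y \<bullet> ?y - 1 = (2 - 2 * c) / c" using c by (simp_all add: yy field_simps)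
  have "s * (1 - c) = p $ None" using assms(1) by (simp add: c_def power2_eq_square algebra_simps)
  moreover have "stereo s ?y $ None = s * ((2 - 2 * c) / c) / (2 / c)" by (simp only: stereo_nth y1)
  moreover have "s * ((2 - 2 * c) / c) / (2 / c) = s * (1 - c)" using c by (simp add: field_simps)
  ultimately have "stereo s ?y $ None = p $ None" by (simp only:)
  moreover have "stereo s ?y $ Some j = p $ Some j" for j
    using c by (simp add: y1) (simp add: stereo_proj_def c_def)
  ultimately show ?thesis by (simp add: vec_eq_iff split_option_all)
qed

lemma open_stereo_domain: "open {p :: real^('n::finite option). 1 - s * p $ None \<noteq> 0}"
  by (intro open_Collect_neq continuous_intros)

lemma smooth_on_stereo: "smooth_on UNIV (stereo s :: real^'n::finite \<Rightarrow> _)"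
proof (rule smooth_on_vecI)
  have *: "smooth_on UNIV (\<lambda>y::real^'n. y \<bullet> y)" by (intro smooth_on_inner smooth_on_ident) auto
  fix i :: "'n option"
  show "smooth_on UNIV (\<lambda>y. stereo s (y::real^'n) $ i)"
    using inner_self_add_one_pos[where ?'a = "real^'n", THEN less_imp_neq, THEN not_sym]
    by (cases i)
      (auto intro!: smooth_on_divide smooth_on_mult smooth_on_add smooth_on_diff smooth_on_vec_nth smooth_on_ident *)
qed simp

lemma smooth_on_stereo_proj:
  "smooth_on {p :: real^('n::finite option). 1 - s * p $ None \<noteq> 0} (stereo_proj s)"
  by (rule smooth_on_vecI[OF open_stereo_domain])
    (auto simp: stereo_proj_def intro!: open_stereo_domain[simplified] smooth_on_divide smooth_on_mult smooth_on_diff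
      smooth_on_vec_nth smooth_on_ident)

lemma sphere_atlas_iff:
  "(V, \<psi>) \<in> sphere_atlas \<longleftrightarrow> open V \<and> inj_on \<psi> V \<and> \<psi> ` V \<subseteq> sphere 0 1 \<and> smooth_on V \<psi> \<and>
     (\<forall>y\<in>V. inj (frechet_derivative \<psi> (at y)))"
  by (simp add: sphere_atlas_def)

lemma stereo_in_atlas:
  fixes s :: real
  assumes "s\<^sup>2 = 1"
  shows "(UNIV, stereo s :: real^'n::finite \<Rightarrow> _) \<in> sphere_atlas"
  unfolding sphere_atlas_iff
proof (intro conjI ballI)
  show "inj (stereo s :: real^'n \<Rightarrow> _)" using stereo_proj_stereo[OF assms] by (rule inj_on_inverseI)
  show "range (stereo s :: real^'n \<Rightarrow> _) \<subseteq> sphere 0 1" using stereo_in_sphere[OF assms] by blast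
  fix y :: "real^'n"
  show "inj (frechet_derivative (stereo s) (at y))"
  proof (rule inj_frechet_derivative_if_left_inverse[where U = UNIV and h = "stereo_proj s"])
    show "stereo s differentiable (at y)" using smooth_on_differentiable[OF smooth_on_stereo] by blast
    show "stereo_proj s differentiable (at (stereo s y))"
    proof (intro smooth_on_differentiable[OF smooth_on_stereo_proj[of s]] CollectI)
      show "1 - s * stereo s y $ None \<noteq> 0"
        unfolding stereo_denominator[OF assms] using inner_self_add_one_pos[of y] by simp
    qed
  qed (use assms in auto)
qed (auto intro: smooth_on_stereo)

lemma sphere_stereo_cover:
  obtains s :: real where "s\<^sup>2 = 1" "1 - s * p $ None \<noteq> 0"
  using that[of 1] that[of "-1"] by (cases "p $ None = 1") auto

lemma carrier_sphere [simp]: "carrier (sphere_atlas :: ('n::finite, real^('n option)) atlas) = sphere 0 1"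
proof
  show "carrier (sphere_atlas :: ('n, real^('n option)) atlas) \<subseteq> sphere 0 1"
    unfolding carrier_def by (auto simp: sphere_atlas_def)
  show "sphere 0 1 \<subseteq> carrier (sphere_atlas :: ('n, real^('n option)) atlas)"
  proof
    fix p :: "real^('n option)" assume "p \<in> sphere 0 1"
    moreover obtain s :: real where "s\<^sup>2 = 1" "1 - s * p $ None \<noteq> 0" by (rule sphere_stereo_cover)
    ultimately have "p \<in> range (stereo s)" "(UNIV, stereo s :: real^'n \<Rightarrow> _) \<in> sphere_atlas"
      using stereo_stereo_proj stereo_in_atlas by (metis rangeI)+
    then show "p \<in> carrier (sphere_atlas :: ('n, real^('n option)) atlas)" unfolding carrier_def by blast
  qed
qed

lemma frechet_derivative_compose_apply:
  assumes "f differentiable (at x)" "g differentiable (at (f x))"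
  shows "frechet_derivative (\<lambda>z. g (f z)) (at x) v = frechet_derivative g (at (f x)) (frechet_derivative f (at x) v)"
proof -
  have "((\<lambda>z. g (f z)) has_derivative (\<lambda>v. frechet_derivative g (at (f x)) (frechet_derivative f (at x) v))) (at x)"
    using assms by (auto intro: has_derivative_compose simp: frechet_derivative_works[symmetric])
  from frechet_derivative_at[OF this] show ?thesis by metis
qed

text \<open>A chart maps into an ambient space of one dimension more, where the inverse function
  theorem does not apply. Away from one pole, stereographic projection turns the chart into an
  injective immersion \<open>\<tau>\<close> between equal dimensions, from which
  \<open>stereo s\<close> recovers the chart.\<close>

lemma stereo_coordinates:
  assumes "(V, \<psi>) \<in> sphere_atlas" "s\<^sup>2 = 1"
  defines "W \<equiv> {y \<in> V. 1 - s * \<psi> y $ None \<noteq> 0}" and "\<tau> \<equiv> \<lambda>y. stereo_proj s (\<psi> y)"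
  shows "open W" "smooth_on W \<tau>" "inj_on \<tau> W" "\<And>y. y \<in> W \<Longrightarrow> inj (frechet_derivative \<tau> (at y))"
    "\<And>y. y \<in> W \<Longrightarrow> stereo s (\<tau> y) = \<psi> y"
proof -
  have V: "open V" "inj_on \<psi> V" "\<psi> ` V \<subseteq> sphere 0 1" "smooth_on V \<psi>" "\<And>y. y \<in> V \<Longrightarrow> inj (frechet_derivative \<psi> (at y))"
    using assms(1) by (auto simp: sphere_atlas_iff)
  show op: "open W"
  proof -
    have "W = V \<inter> \<psi> -` {p. 1 - s * p $ None \<noteq> 0}" by (auto simp: W_def)
    then show ?thesis
      using continuous_open_preimage[OF smooth_on_imp_continuous_on[OF V(4)] V(1) open_stereo_domain[of s]]
      by (simp only:)
  qed
  show sm: "smooth_on W \<tau>" unfolding \<tau>_def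
    by (rule smooth_on_compose[OF op open_stereo_domain smooth_on_subset[OF V(4)] smooth_on_stereo_proj[of s]])
      (auto simp: W_def)
  show eq: "stereo s (\<tau> y) = \<psi> y" if "y \<in> W" for y
    using stereo_stereo_proj[OF assms(2)] that V(3) by (auto simp: W_def \<tau>_def image_subset_iff)
  show "inj_on \<tau> W" by (rule inj_onI) (metis (mono_tags, lifting) eq V(2) W_def inj_onD mem_Collect_eq)
  show "inj (frechet_derivative \<tau> (at y))" if "y \<in> W" for y
  proof -
    have "frechet_derivative \<psi> (at y) = frechet_derivative (\<lambda>z. stereo s (\<tau> z)) (at y)"
    proof (rule frechet_derivative_transform_within_open[OF _ op that])
      show "\<psi> differentiable at y" using smooth_on_differentiable[OF V(4)] that by (simp add: W_def)
    qed (simp add: eq)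
    then have "frechet_derivative \<psi> (at y) v
        = frechet_derivative (stereo s) (at (\<tau> y)) (frechet_derivative \<tau> (at y) v)" for v
      using frechet_derivative_compose_apply[OF smooth_on_differentiable[OF sm that]
          smooth_on_differentiable[OF smooth_on_stereo UNIV_I]] by simp
    with V(5)[of y] that show ?thesis by (auto simp: W_def inj_def)
  qed
qed

text \<open>Near a given point choose a pole that the point avoids. Both charts then factor through
  the same stereographic chart, and the transition is
  \<open>inv_into W' \<tau>' \<circ> \<tau>\<close>, smooth by the inverse function theorem.\<close>

lemma sphere_smooth_transition:
  assumes c: "(V, \<psi>) \<in> sphere_atlas" and d: "(V', \<psi>') \<in> sphere_atlas"
  shows "smooth_transition (V, \<psi>) (V', \<psi>')"
proof -
  define O' where "O' = {y \<in> V. \<psi> y \<in> \<psi>' ` V'}"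
  have inj': "inj_on \<psi>' V'" using d by (simp add: sphere_atlas_iff)
  have loc: "\<exists>U. open U \<and> y \<in> U \<and> U \<subseteq> O' \<and> smooth_on U (inv_into V' \<psi>' \<circ> \<psi>)" if yO: "y \<in> O'" for y
  proof -
    obtain s :: real where s: "s\<^sup>2 = 1" "1 - s * \<psi> y $ None \<noteq> 0" by (rule sphere_stereo_cover)
    define W where "W = {y \<in> V. 1 - s * \<psi> y $ None \<noteq> 0}"
    define W' where "W' = {y \<in> V'. 1 - s * \<psi>' y $ None \<noteq> 0}"
    define \<tau> where "\<tau> = (\<lambda>y. stereo_proj s (\<psi> y))"
    define \<tau>' where "\<tau>' = (\<lambda>y. stereo_proj s (\<psi>' y))"
    note t = stereo_coordinates[OF c s(1), folded W_def \<tau>_def]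
    note t' = stereo_coordinates[OF d s(1), folded W'_def \<tau>'_def]
    note si = smooth_on_inv_into[OF t'(1,3,2,4)]
    define U where "U = {y \<in> W. \<tau> y \<in> \<tau>' ` W'}"
    have "U = W \<inter> \<tau> -` (\<tau>' ` W')" by (auto simp: U_def)
    then have "open U"
      using continuous_open_preimage[OF smooth_on_imp_continuous_on[OF t(2)] t(1) si(1)] by (simp only:)
    moreover have "y \<in> U"
    proof -
      obtain y' where "y' \<in> V'" "\<psi> y = \<psi>' y'" using yO unfolding O'_def by blast
      with s(2) yO show ?thesis by (auto simp: U_def W_def W'_def O'_def \<tau>_def \<tau>'_def)
    qed
    moreover have U: "\<exists>y'\<in>V'. \<psi> y = \<psi>' y' \<and> y' \<in> W' \<and> \<tau> y = \<tau>' y'" if yU: "y \<in> U" for y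
    proof -
      obtain y' where y': "y' \<in> W'" "\<tau> y = \<tau>' y'" using yU unfolding U_def by blast
      have "y \<in> W" using yU by (simp add: U_def)
      from t(5)[OF this] have "\<psi> y = stereo s (\<tau> y)" unfolding \<tau>_def by (rule sym)
      also have "\<dots> = stereo s (\<tau>' y')" by (simp only: y'(2))
      also have "\<dots> = \<psi>' y'" using t'(5)[OF y'(1)] unfolding \<tau>'_def .
      finally have "\<psi> y = \<psi>' y'" .
      with y' show ?thesis by (auto simp: W'_def)
    qed
    moreover have "U \<subseteq> O'" using U by (auto simp: O'_def U_def W_def)
    moreover have "smooth_on U (inv_into V' \<psi>' \<circ> \<psi>)"
    proof -
      have "smooth_on U (\<lambda>y. inv_into W' \<tau>' (\<tau> y))"
        by (rule smooth_on_compose[OF \<open>open U\<close> si(1) smooth_on_subset[OF t(2)] si(2)]) (auto simp: U_def)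
      moreover have "inv_into W' \<tau>' (\<tau> y) = (inv_into V' \<psi>' \<circ> \<psi>) y" if "y \<in> U" for y
        using U[OF that] inj' t'(3) by (auto simp: inv_into_f_f)
      ultimately show ?thesis by (subst smooth_on_cong[OF \<open>open U\<close>]) auto
    qed
    ultimately show ?thesis by blast
  qed
  then have "open O'" by (subst open_subopen) blast
  moreover have "smooth_on O' (inv_into V' \<psi>' \<circ> \<psi>)" by (rule smooth_on_local) (use loc in blast)
  ultimately show ?thesis by (simp add: smooth_transition_def O'_def)
qed

text \<open>One inclusion is the continuity of the chart maps. For the other, a chart-open set is,
  near each of its points, the trace on the sphere of the preimage of an open parameter set under
  the continuous \<open>stereo_proj s\<close>.\<close>

lemma chart_top_sphere:
  "chart_top (sphere_atlas :: ('n::finite, real^('n option)) atlas) = top_of_set (sphere 0 1)"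
  unfolding topology_eq
proof (intro allI iffI)
  let ?A = "sphere_atlas :: ('n, real^('n option)) atlas"
  fix W :: "(real^('n option)) set"
  assume "openin (top_of_set (sphere 0 1)) W"
  then obtain U where U: "open U" "W = sphere 0 1 \<inter> U" by (auto simp: openin_open)
  have "open {y \<in> V. \<psi> y \<in> W}" if "(V, \<psi>) \<in> ?A" for V \<psi>
  proof -
    have V: "open V" "\<psi> ` V \<subseteq> sphere 0 1" "smooth_on V \<psi>" using that by (auto simp: sphere_atlas_iff)
    then have "{y \<in> V. \<psi> y \<in> W} = V \<inter> \<psi> -` U" using U by auto
    then show ?thesis
      using continuous_open_preimage[OF smooth_on_imp_continuous_on[OF V(3)] V(1) U(1)] by simp
  qed
  then show "openin (chart_top ?A) W" using U by (auto simp: openin_chart_top)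
next
  let ?A = "sphere_atlas :: ('n, real^('n option)) atlas"
  fix W :: "(real^('n option)) set"
  assume W: "openin (chart_top ?A) W"
  show "openin (top_of_set (sphere 0 1)) W"
  proof (subst openin_subopen, rule ballI)
    fix p assume "p \<in> W"
    then have p: "p \<in> sphere 0 1" using W by (auto simp: openin_chart_top)
    obtain s :: real where s: "s\<^sup>2 = 1" "1 - s * p $ None \<noteq> 0" by (rule sphere_stereo_cover)
    define O' where "O' = {y :: real^'n. stereo s y \<in> W}"
    have "open O'" using W stereo_in_atlas[OF s(1)] by (auto simp: O'_def openin_chart_top)
    define U where "U = {q :: real^('n option). 1 - s * q $ None \<noteq> 0} \<inter> stereo_proj s -` O'"
    have "open U" unfolding U_def
      by (rule continuous_open_preimage[OF smooth_on_imp_continuous_on[OF smooth_on_stereo_proj]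
            open_stereo_domain \<open>open O'\<close>])
    moreover have "p \<in> U" using s p \<open>p \<in> W\<close> by (simp add: U_def O'_def stereo_stereo_proj)
    moreover have "sphere 0 1 \<inter> U \<subseteq> W" using s by (auto simp: U_def O'_def stereo_stereo_proj)
    ultimately show "\<exists>T. openin (top_of_set (sphere 0 1)) T \<and> p \<in> T \<and> T \<subseteq> W"
      using p by (meson IntI openin_open_Int)
  qed
qed

lemma second_countable_euclidean:
  "second_countable (euclidean :: 'a::second_countable_topology topology)"
proof -
  obtain \<B> :: "'a set set" where \<B>: "countable \<B>" "\<And>C. C \<in> \<B> \<Longrightarrow> open C"
    "\<And>S. open S \<Longrightarrow> \<exists>U. U \<subseteq> \<B> \<and> S = \<Union>U"
    using univ_second_countable by blast
  have "\<exists>V\<in>\<B>. x \<in> V \<and> V \<subseteq> U" if "open U" "x \<in> U" for U x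
    using \<B>(3)[OF that(1)] that(2) by blast
  with \<B>(1,2) show ?thesis
    unfolding second_countable_def open_openin[symmetric] by (intro exI[of _ \<B>] conjI) auto
qed

lemma smooth_manifold_sphere: "smooth_manifold (sphere_atlas :: ('n::finite, real^('n option)) atlas)"
  unfolding smooth_manifold_def
proof (intro conjI allI impI)
  let ?A = "sphere_atlas :: ('n, real^('n option)) atlas"
  show "\<forall>(V, \<psi>)\<in>?A. open V \<and> inj_on \<psi> V" by (auto simp: sphere_atlas_def)
  show "\<forall>c\<in>?A. \<forall>d\<in>?A. smooth_transition c d" using sphere_smooth_transition by fast
  show "Hausdorff_space (chart_top ?A)"
    unfolding chart_top_sphere by (rule Hausdorff_space_subtopology[OF Hausdorff_space_euclidean])
  show "second_countable (chart_top ?A)"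
    unfolding chart_top_sphere by (rule second_countable_subtopology[OF second_countable_euclidean])
  fix V \<psi>
  assume *: "open V \<and> inj_on \<psi> V \<and> \<psi> ` V \<subseteq> carrier ?A \<and>
    (\<forall>d\<in>?A. smooth_transition (V, \<psi>) d \<and> smooth_transition d (V, \<psi>))"
  \<comment> \<open>Maximality of the atlas. Near a point, a compatible chart is a smooth transition
    followed by \<open>stereo s\<close>, hence smooth. The transition in the other direction,
    composed with \<open>stereo_proj s\<close>, is a differentiable left inverse, so the chart is
    also an immersion.\<close>
  have loc: "\<exists>U. open U \<and> y \<in> U \<and> smooth_on U \<psi> \<and> inj (frechet_derivative \<psi> (at y))" if y: "y \<in> V" for y
  proof -
    have p: "\<psi> y \<in> sphere 0 1" using * y by auto
    obtain s :: real where s: "s\<^sup>2 = 1" "1 - s * \<psi> y $ None \<noteq> 0" by (rule sphere_stereo_cover)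
    let ?inv = "inv_into UNIV (stereo s) :: _ \<Rightarrow> real^'n"
    define U where "U = {y \<in> V. \<psi> y \<in> range (stereo s :: real^'n \<Rightarrow> _)}"
    define U' where "U' = {z :: real^'n. stereo s z \<in> \<psi> ` V}"
    have "smooth_transition (V, \<psi>) (UNIV, stereo s)" "smooth_transition (UNIV, stereo s) (V, \<psi>)"
      using * stereo_in_atlas[OF s(1), where 'n = 'n] by blast+
    then have U: "open U" "smooth_on U (?inv \<circ> \<psi>)" and U': "open U'" "smooth_on U' (inv_into V \<psi> \<circ> stereo s)"
      by (auto simp: smooth_transition_def U_def U'_def)
    have yU: "y \<in> U" using y stereo_stereo_proj[OF s(1) p s(2)] unfolding U_def by (metis (mono_tags) mem_Collect_eq rangeI)
    have eq: "stereo s ((?inv \<circ> \<psi>) z) = \<psi> z" if "z \<in> U" for z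
      using that by (simp add: U_def f_inv_into_f)
    have sm: "smooth_on U \<psi>"
    proof -
      have "smooth_on U (\<lambda>z. stereo s ((?inv \<circ> \<psi>) z))"
        by (rule smooth_on_compose[OF U(1) open_UNIV U(2) smooth_on_stereo]) simp
      then show ?thesis using eq by (subst (asm) smooth_on_cong[OF U(1)]) auto
    qed
    have "inj (frechet_derivative \<psi> (at y))"
    proof (rule inj_frechet_derivative_if_left_inverse[where U = U and h = "(inv_into V \<psi> \<circ> stereo s) \<circ> stereo_proj s"])
      show "\<psi> differentiable (at y)" using smooth_on_differentiable[OF sm yU] .
      show "(inv_into V \<psi> \<circ> stereo s \<circ> stereo_proj s) differentiable (at (\<psi> y))"
      proof (rule differentiable_chain_at)
        show "stereo_proj s differentiable (at (\<psi> y))"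
          by (rule smooth_on_differentiable[OF smooth_on_stereo_proj[of s]]) (use s in simp)
        show "inv_into V \<psi> \<circ> stereo s differentiable (at (stereo_proj s (\<psi> y)))"
          by (rule smooth_on_differentiable[OF U'(2)]) (use y stereo_stereo_proj[OF s(1) p s(2)] in \<open>simp add: U'_def\<close>)
      qed
      fix z assume z: "z \<in> U"
      then obtain w :: "real^'n" where w: "\<psi> z = stereo s w" "z \<in> V" by (auto simp: U_def)
      then have "(inv_into V \<psi> \<circ> stereo s \<circ> stereo_proj s) (\<psi> z) = inv_into V \<psi> (\<psi> z)"
        using s(1) by simp
      then show "(inv_into V \<psi> \<circ> stereo s \<circ> stereo_proj s) (\<psi> z) = z"
        using w(2) * by (simp add: inv_into_f_f)
    qed (use U yU in auto)
    with U sm yU show ?thesis by blast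
  qed
  then have "smooth_on V \<psi>" by (intro smooth_on_local) metis
  with * loc show "(V, \<psi>) \<in> ?A" by (auto simp: sphere_atlas_iff)
qed

section \<open>Metrics\<close>

lemma round_metric_nth: "round_metric (V, \<psi>) y $ i $ j = partial i \<psi> y \<bullet> partial j \<psi> y"
  by (simp add: round_metric_def)

lemma round_metric_quadratic:
  assumes "\<psi> differentiable (at y)"
  shows "v \<bullet> (round_metric (V, \<psi>) y *v w) = frechet_derivative \<psi> (at y) v \<bullet> frechet_derivative \<psi> (at y) w"
  unfolding frechet_derivative_expansion[OF assms]
  by (simp add: round_metric_nth inner_vec_def[of v] matrix_vector_mult_def inner_sum_left inner_sum_right
      sum_distrib_left ac_simps) (rule sum.swap)

lemma riemannian_metric_round:
  "riemannian_metric (sphere_atlas :: ('n::finite, real^('n option)) atlas) round_metric"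
  unfolding riemannian_metric_def
proof (intro conjI ballI, goal_cases)
  case (1 c)
  obtain V \<psi> where c: "c = (V, \<psi>)" by force
  with 1 have V: "open V" "smooth_on V \<psi>" "\<And>y. y \<in> V \<Longrightarrow> inj (frechet_derivative \<psi> (at y))"
    by (auto simp: sphere_atlas_iff)
  have "smooth_on V (\<lambda>y. round_metric (V, \<psi>) y $ i $ j)" for i j
    unfolding round_metric_nth partial_def using V by (intro smooth_on_inner smooth_on_frechet_derivative)
  moreover have "v \<bullet> (round_metric (V, \<psi>) y *v v) > 0" if "y \<in> V" "v \<noteq> 0" for y v
  proof -
    have d: "\<psi> differentiable (at y)" using smooth_on_differentiable[OF V(2) that(1)] .
    have "frechet_derivative \<psi> (at y) v \<noteq> 0"
      using V(3)[OF that(1)] that(2) linear_frechet_derivative[OF d] linear_injective_0 by blast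
    then show ?thesis by (simp add: round_metric_quadratic[OF d])
  qed
  ultimately show ?case
    by (auto simp: c vec_eq_iff transpose_def round_metric_nth inner_commute)
next
  case (2 c)
  obtain V \<psi> where cd: "c = (V, \<psi>)" by force
  with 2 have c: "(V, \<psi>) \<in> sphere_atlas" by auto
  have "round_metric (V, \<psi>) y $ i $ j = (\<Sum>a\<in>UNIV. \<Sum>b\<in>UNIV.
      round_metric (V', \<psi>') (\<tau> y) $ a $ b * partial i \<tau> y $ a * partial j \<tau> y $ b)"
    if y: "y \<in> V" "\<psi> y \<in> \<psi>' ` V'" and d: "(V', \<psi>') \<in> sphere_atlas" and \<tau>_def: "\<tau> = inv_into V' \<psi>' \<circ> \<psi>"
    for V' \<psi>' y i j \<tau>
  proof -
    let ?O = "{y \<in> V. \<psi> y \<in> \<psi>' ` V'}"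
    have O: "open ?O" "smooth_on ?O \<tau>"
      using sphere_smooth_transition[OF c d] by (auto simp: smooth_transition_def \<tau>_def)
    have dt: "\<tau> differentiable (at y)" using smooth_on_differentiable[OF O(2)] y by blast
    have ty: "\<tau> y \<in> V'" using y by (auto simp: \<tau>_def inv_into_into)
    have d': "\<psi>' differentiable (at (\<tau> y))" using d ty smooth_on_differentiable by (auto simp: sphere_atlas_iff)
    have dp: "\<psi> differentiable (at y)" using c y smooth_on_differentiable by (auto simp: sphere_atlas_iff)
    have "frechet_derivative \<psi> (at y) = frechet_derivative (\<lambda>z. \<psi>' (\<tau> z)) (at y)"
      by (rule frechet_derivative_transform_within_open[OF dp O(1)]) (use y in \<open>auto simp: \<tau>_def f_inv_into_f\<close>)
    then have "partial i \<psi> y = frechet_derivative \<psi>' (at (\<tau> y)) (partial i \<tau> y)" for i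
      using frechet_derivative_compose_apply[OF dt d'] by (simp add: partial_def)
    then have "round_metric (V, \<psi>) y $ i $ j = partial i \<tau> y \<bullet> (round_metric (V', \<psi>') (\<tau> y) *v partial j \<tau> y)"
      by (simp add: round_metric_quadratic[OF d'] round_metric_nth)
    then show ?thesis
      by (simp add: inner_vec_def matrix_vector_mult_def sum_distrib_left ac_simps)
  qed
  then show ?case unfolding cd Let_def by blast
qed

lemma riemannian_manifold_sphere:
  "riemannian_manifold (sphere_atlas :: ('n::finite, real^('n option)) atlas) round_metric"
  by (simp add: riemannian_manifold_def smooth_manifold_sphere riemannian_metric_round)

lemma riemannian_metric_transform:
  assumes "riemannian_metric A g" "(V, \<psi>) \<in> A" "(V', \<psi>') \<in> A" "y \<in> V" "\<psi> y \<in> \<psi>' ` V'"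
  defines "\<tau> \<equiv> inv_into V' \<psi>' \<circ> \<psi>"
  shows "g (V, \<psi>) y $ i $ j = (\<Sum>a\<in>UNIV. \<Sum>b\<in>UNIV.
      g (V', \<psi>') (\<tau> y) $ a $ b * partial i \<tau> y $ a * partial j \<tau> y $ b)"
proof -
  note assms(1)[unfolded riemannian_metric_def, THEN conjunct2]
  from bspec[OF this assms(2), unfolded prod.case]
  have "\<forall>(V', \<psi>')\<in>A. \<forall>y\<in>V. \<psi> y \<in> \<psi>' ` V' \<longrightarrow> (let \<tau> = inv_into V' \<psi>' \<circ> \<psi> in
         \<forall>i j. g (V, \<psi>) y $ i $ j =
           (\<Sum>a\<in>UNIV. \<Sum>b\<in>UNIV. g (V', \<psi>') (\<tau> y) $ a $ b * partial i \<tau> y $ a * partial j \<tau> y $ b))" .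
  from bspec[OF this assms(3), unfolded prod.case] assms(4,5)
  show ?thesis unfolding Let_def \<tau>_def by blast
qed

lemma riemannian_manifold_conf_metric:
  assumes "riemannian_manifold A g" "\<Upsilon> \<in> Cinf A"
  shows "riemannian_manifold A (conf_metric \<Upsilon> g)"
proof -
  have m: "smooth_manifold A" and r: "riemannian_metric A g" using assms(1) by (auto simp: riemannian_manifold_def)
  have nth: "conf_metric \<Upsilon> g (V, \<psi>) y $ i $ j = exp (2 * \<Upsilon> (\<psi> y)) * g (V, \<psi>) y $ i $ j" for V \<psi> y i j
    by (simp add: conf_metric_def)
  have "riemannian_metric A (conf_metric \<Upsilon> g)"
    unfolding riemannian_metric_def
  proof (intro conjI ballI, goal_cases)
    case (1 c)
    obtain V \<psi> where c: "c = (V, \<psi>)" by force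
    with 1 m assms(2) have V: "open V" "smooth_on V (\<lambda>y. \<Upsilon> (\<psi> y))"
      by (auto simp: smooth_manifold_def Cinf_def comp_def)
    have g: "smooth_on V (\<lambda>y. g (V, \<psi>) y $ i $ j)" "y \<in> V \<Longrightarrow> transpose (g (V, \<psi>) y) = g (V, \<psi>) y"
      "y \<in> V \<Longrightarrow> v \<noteq> 0 \<Longrightarrow> v \<bullet> (g (V, \<psi>) y *v v) > 0" for i j y v
      using r 1 unfolding riemannian_metric_def c by blast+
    have "smooth_on V (\<lambda>y. conf_metric \<Upsilon> g (V, \<psi>) y $ i $ j)" for i j
      unfolding nth using V g by (intro smooth_on_mult smooth_on_exp smooth_on_const)
    moreover have "conf_metric \<Upsilon> g (V, \<psi>) y *v v = exp (2 * \<Upsilon> (\<psi> y)) *\<^sub>R (g (V, \<psi>) y *v v)" for y v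
      by (simp add: vec_eq_iff matrix_vector_mult_def nth sum_distrib_left ac_simps)
    moreover have "transpose (conf_metric \<Upsilon> g (V, \<psi>) y) = exp (2 * \<Upsilon> (\<psi> y)) *\<^sub>R transpose (g (V, \<psi>) y)" for y
      by (simp add: vec_eq_iff transpose_def nth)
    ultimately show ?case using g by (auto simp: c) (simp add: conf_metric_def)
  next
    case (2 c)
    obtain V \<psi> where cd: "c = (V, \<psi>)" by force
    have "conf_metric \<Upsilon> g (V, \<psi>) y $ i $ j = (\<Sum>a\<in>UNIV. \<Sum>b\<in>UNIV. conf_metric \<Upsilon> g (V', \<psi>') ((inv_into V' \<psi>' \<circ> \<psi>) y) $ a $ b
        * partial i (inv_into V' \<psi>' \<circ> \<psi>) y $ a * partial j (inv_into V' \<psi>' \<circ> \<psi>) y $ b)"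
      if y: "(V', \<psi>') \<in> A" "y \<in> V" "\<psi> y \<in> \<psi>' ` V'" for V' \<psi>' y i j
    proof -
      have "g (V, \<psi>) y $ i $ j = (\<Sum>a\<in>UNIV. \<Sum>b\<in>UNIV. g (V', \<psi>') ((inv_into V' \<psi>' \<circ> \<psi>) y) $ a $ b
        * partial i (inv_into V' \<psi>' \<circ> \<psi>) y $ a * partial j (inv_into V' \<psi>' \<circ> \<psi>) y $ b)"
        using riemannian_metric_transform[OF r 2[unfolded cd] y] .
      moreover have "\<psi>' ((inv_into V' \<psi>' \<circ> \<psi>) y) = \<psi> y" using y by (simp add: f_inv_into_f)
      ultimately show ?thesis unfolding nth by (simp only: sum_distrib_left mult.assoc)
    qed
    then show ?case unfolding cd Let_def by blast
  qed
  with m show ?thesis by (simp add: riemannian_manifold_def)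
qed

section \<open>Regularity, locality and linearity of contractions\<close>

text \<open>True without differentiability as well: both choice terms select from the same set of
  derivatives. The congruence lemmas for coordinate formulas below therefore carry no smoothness
  hypotheses.\<close>

lemma frechet_derivative_cong_open:
  assumes "open V" "y \<in> V" "\<And>z. z \<in> V \<Longrightarrow> f z = g z"
  shows "frechet_derivative f (at y) = frechet_derivative g (at y)"
proof -
  have "(f has_derivative D) (at y) \<longleftrightarrow> (g has_derivative D) (at y)" for D
    using has_derivative_transform_within_open[OF _ assms(1,2), of f D UNIV g]
      has_derivative_transform_within_open[OF _ assms(1,2), of g D UNIV f] assms(3) by auto
  then show ?thesis by (simp add: frechet_derivative_def)
qed

lemma partial_cong:
  "open V \<Longrightarrow> y \<in> V \<Longrightarrow> (\<And>z. z \<in> V \<Longrightarrow> f z = g z) \<Longrightarrow> partial i f y = partial i g y"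
  unfolding partial_def by (subst frechet_derivative_cong_open[of V y f g]) auto

lemma partial_linear:
  fixes f g :: "real^'n::finite \<Rightarrow> real"
  assumes "f differentiable (at y)" "g differentiable (at y)"
  shows "partial i (\<lambda>z. a * f z + b * g z) y = a * partial i f y + b * partial i g y"
proof -
  have "((\<lambda>z. a * f z + b * g z) has_derivative
      (\<lambda>v. a * frechet_derivative f (at y) v + b * frechet_derivative g (at y) v)) (at y)"
    using assms by (intro has_derivative_add has_derivative_mult_right) (simp_all add: frechet_derivative_works[symmetric])
  from frechet_derivative_at[OF this] show ?thesis unfolding partial_def by metis
qed

lemma smooth_on_partial: "smooth_on V f \<Longrightarrow> smooth_on V (partial i f)"
  unfolding partial_def[abs_def] by (rule smooth_on_frechet_derivative)

lemma smooth_on_prod_list: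
  fixes f :: "'i \<Rightarrow> 'a::real_normed_vector \<Rightarrow> real"
  assumes "open V" "\<And>i. i \<in> set xs \<Longrightarrow> smooth_on V (f i)"
  shows "smooth_on V (\<lambda>y. \<Prod>i\<leftarrow>xs. f i y)"
  using assms(2) by (induction xs) (auto intro: smooth_on_mult[OF assms(1)])

lemma smooth_on_sum_list:
  fixes f :: "'i \<Rightarrow> 'a::real_normed_vector \<Rightarrow> real"
  assumes "open V" "\<And>i. i \<in> set xs \<Longrightarrow> smooth_on V (f i)"
  shows "smooth_on V (\<lambda>y. \<Sum>i\<leftarrow>xs. f i y)"
  using assms(2) by (induction xs) (auto intro: smooth_on_add[OF assms(1)])

context
  fixes V :: "(real^'n::finite) set" and G :: "real^'n \<Rightarrow> real^'n^'n"
  assumes V: "open V" and G: "\<And>i j. smooth_on V (\<lambda>y. G y $ i $ j)" and det_G: "\<And>y. y \<in> V \<Longrightarrow> det (G y) \<noteq> 0"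
begin

lemma smooth_on_christoffel: "smooth_on V (christoffel G k i j)"
  unfolding christoffel_def[abs_def]
  by (intro smooth_on_mult smooth_on_sum smooth_on_add smooth_on_diff smooth_on_const smooth_on_partial
      smooth_on_matrix_inv V G det_G)

lemma smooth_on_Rm: "smooth_on V (Rm G I)"
  unfolding Rm_def[abs_def] Let_def
  by (intro smooth_on_mult smooth_on_sum smooth_on_add smooth_on_diff smooth_on_partial
      smooth_on_christoffel V G)

lemma smooth_on_cov_deriv:
  assumes "\<And>J. smooth_on V (T J)"
  shows "smooth_on V (cov_deriv G T I)"
proof (cases I)
  case Nil
  then show ?thesis by (simp add: fun_eq_iff[symmetric] cong: smooth_on_cong[OF V])
next
  case (Cons i J)
  have "smooth_on V (\<lambda>y. partial i (T J) y
     - (\<Sum>s<length J. \<Sum>m\<in>UNIV. christoffel G m i (J ! s) y * T (J[s := m]) y))"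
    by (intro smooth_on_diff smooth_on_sum smooth_on_mult smooth_on_partial smooth_on_christoffel V assms)
  then show ?thesis unfolding Cons by (subst smooth_on_cong[OF V]) auto
qed

lemma smooth_on_cov_deriv_power:
  assumes "\<And>J. smooth_on V (T J)"
  shows "smooth_on V ((cov_deriv G ^^ N) T I)"
  using assms by (induction N arbitrary: I) (auto intro: smooth_on_cov_deriv)

lemma smooth_on_tensor_prod:
  assumes "\<And>m T J. (m, T) \<in> set Ts \<Longrightarrow> smooth_on V (T J)"
  shows "smooth_on V (tensor_prod Ts I)"
  using assms
proof (induction Ts arbitrary: I)
  case Nil
  then show ?case by (subst smooth_on_cong[OF V, of _ "\<lambda>_. 1"]) auto
next
  case (Cons mT Ts)
  obtain m T where mT: "mT = (m, T)" by force
  have "smooth_on V (\<lambda>y. T (take m I) y * tensor_prod Ts (drop m I) y)"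
    using Cons by (intro smooth_on_mult V) (auto simp: mT)
  then show ?case unfolding mT by (subst smooth_on_cong[OF V]) auto
qed

lemma smooth_on_contract:
  assumes "\<And>f. f \<in> set fs \<Longrightarrow> smooth_on V f"
  shows "smooth_on V (contract G fs K)"
proof -
  have "smooth_on V ((cov_deriv G ^^ N) (Rm G) J)" for N J
    by (intro smooth_on_cov_deriv_power smooth_on_Rm)
  moreover have "smooth_on V ((cov_deriv G ^^ N) (\<lambda>_. f) J)" if "f \<in> set fs" for N f J
    using assms[OF that] by (rule smooth_on_cov_deriv_power)
  ultimately have "smooth_on V (T J)" if "(m, T) \<in> set (factors G fs K)" for m T J
    using that unfolding factors_def by (auto dest!: set_zip_rightD)
  then have "smooth_on V (\<lambda>y. \<Sum>I\<in>{I. length I = slots K}.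
     (\<Prod>st\<leftarrow>pairing K. matrix_inv (G y) $ (I ! fst st) $ (I ! snd st)) * tensor_prod (factors G fs K) I y)"
    by (intro smooth_on_sum smooth_on_mult smooth_on_prod_list smooth_on_matrix_inv smooth_on_tensor_prod V G det_G)
  then show ?thesis
    by (subst smooth_on_cong[OF V]) (auto simp: contract_def case_prod_unfold)
qed

lemma cov_deriv_linear:
  assumes "\<And>J. smooth_on V (T J)" "\<And>J. smooth_on V (T' J)" "y \<in> V"
  shows "cov_deriv G (\<lambda>I y. a * T I y + b * T' I y) I y = a * cov_deriv G T I y + b * cov_deriv G T' I y"
proof (cases I)
  case (Cons i J)
  have "partial i (\<lambda>y. a * T J y + b * T' J y) y = a * partial i (T J) y + b * partial i (T' J) y"
    using smooth_on_differentiable assms by (intro partial_linear) blast+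
  then show ?thesis unfolding Cons by (simp add: sum.distrib sum_distrib_left algebra_simps)
qed simp

end

section \<open>Locality and linearity of contractions\<close>

lemma christoffel_cong:
  assumes "open V" "\<And>y. y \<in> V \<Longrightarrow> G y = G' y" "y \<in> V"
  shows "christoffel G k i j y = christoffel G' k i j y"
  using assms partial_cong[OF assms(1,3), of "\<lambda>z. G z $ p $ q" "\<lambda>z. G' z $ p $ q" for p q]
  by (simp add: christoffel_def)

lemma Rm_cong:
  assumes "open V" "\<And>y. y \<in> V \<Longrightarrow> G y = G' y" "y \<in> V"
  shows "Rm G I y = Rm G' I y"
  using assms christoffel_cong[OF assms(1,2)]
    partial_cong[OF assms(1,3), of "christoffel G p q s" "christoffel G' p q s" for p q s]
  by (simp add: Rm_def Let_def)

lemma cov_deriv_cong: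
  assumes "open V" "\<And>y. y \<in> V \<Longrightarrow> G y = G' y" "\<And>I y. y \<in> V \<Longrightarrow> T I y = T' I y" "y \<in> V"
  shows "cov_deriv G T I y = cov_deriv G' T' I y"
proof (cases I)
  case (Cons i J)
  have "partial i (T J) y = partial i (T' J) y" using assms by (intro partial_cong) auto
  then show ?thesis using assms(3,4) christoffel_cong[OF assms(1,2,4)] unfolding Cons by simp
qed simp

lemma cov_deriv_power_cong:
  assumes "open V" "\<And>y. y \<in> V \<Longrightarrow> G y = G' y" "\<And>I y. y \<in> V \<Longrightarrow> T I y = T' I y" "y \<in> V"
  shows "(cov_deriv G ^^ N) T I y = (cov_deriv G' ^^ N) T' I y"
  using assms(4)
proof (induction N arbitrary: I y)
  case (Suc N)
  then show ?case using cov_deriv_cong[OF assms(1,2) Suc.IH Suc.prems] by simp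
qed (use assms in simp)

lemma tensor_prod_cong:
  assumes "list_all2 (\<lambda>mT mT'. fst mT = fst mT' \<and> (\<forall>I. snd mT I y = snd mT' I y)) Ts Ts'"
  shows "tensor_prod Ts I y = tensor_prod Ts' I y"
  using assms
proof (induction Ts Ts' arbitrary: I rule: list_all2_induct)
  case (Cons x Ts x' Ts')
  then show ?case by (cases x; cases x') simp
qed simp

text \<open>All ingredients are derivatives at a point of an open set, so a contraction sees only
  the germs of the metric and of the functions. This is the common core of naturality under
  diffeomorphisms and of independence from values off the manifold.\<close>

lemma contract_cong:
  assumes "open V" "\<And>y. y \<in> V \<Longrightarrow> G y = G' y" "list_all2 (\<lambda>f f'. \<forall>y\<in>V. f y = f' y) fs fs'" "y \<in> V"
  shows "contract G fs K y = contract G' fs' K y"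
proof -
  have "list_all2 (\<lambda>mT mT'. fst mT = fst mT' \<and> (\<forall>I. snd mT I y = snd mT' I y)) (factors G fs K) (factors G' fs' K)"
    unfolding factors_def
  proof (rule list_all2_appendI)
    show "list_all2 (\<lambda>mT mT'. fst mT = fst mT' \<and> (\<forall>I. snd mT I y = snd mT' I y))
        (map (\<lambda>N. (N + 4, (cov_deriv G ^^ N) (Rm G))) (curv_orders K))
        (map (\<lambda>N. (N + 4, (cov_deriv G' ^^ N) (Rm G'))) (curv_orders K))"
      using cov_deriv_power_cong[OF assms(1,2) Rm_cong[OF assms(1,2)] assms(4)]
      by (simp add: list.rel_map list.rel_refl)
    have len: "length fs = length fs'" and nth: "\<And>i y. i < length fs \<Longrightarrow> y \<in> V \<Longrightarrow> (fs ! i) y = (fs' ! i) y"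
      using assms(3) by (auto simp: list_all2_conv_all_nth)
    have "(cov_deriv G ^^ N) (\<lambda>_. fs ! i) I y = (cov_deriv G' ^^ N) (\<lambda>_. fs' ! i) I y"
      if "i < length fs" for i N I
      by (rule cov_deriv_power_cong[OF assms(1,2) _ assms(4)]) (use nth that in auto)
    then show "list_all2 (\<lambda>mT mT'. fst mT = fst mT' \<and> (\<forall>I. snd mT I y = snd mT' I y))
        (map2 (\<lambda>N f. (N, (cov_deriv G ^^ N) (\<lambda>_. f))) (fun_orders K) fs)
        (map2 (\<lambda>N f. (N, (cov_deriv G' ^^ N) (\<lambda>_. f))) (fun_orders K) fs')"
      by (simp add: list_all2_conv_all_nth len)
  qed
  from tensor_prod_cong[OF this] show ?thesis using assms(2,4) by (simp add: contract_def)
qed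

lemma tensor_prod_append:
  "tensor_prod (Ts @ Ts') I y = tensor_prod Ts I y * tensor_prod Ts' (drop (sum_list (map fst Ts)) I) y"
  by (induction Ts arbitrary: I) (auto simp: add.commute)

lemma cov_deriv_power_linear:
  assumes V: "open V" "\<And>i j. smooth_on V (\<lambda>y. G y $ i $ j)" "\<And>y. y \<in> V \<Longrightarrow> det (G y) \<noteq> 0"
    and "\<And>J. smooth_on V (T J)" "\<And>J. smooth_on V (T' J)" "y \<in> V"
  shows "(cov_deriv G ^^ N) (\<lambda>I y. a * T I y + b * T' I y) I y
    = a * (cov_deriv G ^^ N) T I y + b * (cov_deriv G ^^ N) T' I y"
  using assms(6)
proof (induction N arbitrary: I y)
  case (Suc N)
  have "cov_deriv G ((cov_deriv G ^^ N) (\<lambda>I y. a * T I y + b * T' I y)) I y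
      = cov_deriv G (\<lambda>I y. a * (cov_deriv G ^^ N) T I y + b * (cov_deriv G ^^ N) T' I y) I y"
    by (rule cov_deriv_cong[OF V(1) refl Suc.IH Suc.prems])
  also have "\<dots> = a * cov_deriv G ((cov_deriv G ^^ N) T) I y + b * cov_deriv G ((cov_deriv G ^^ N) T') I y"
    by (rule cov_deriv_linear[OF V smooth_on_cov_deriv_power[OF V assms(4)] smooth_on_cov_deriv_power[OF V assms(5)] Suc.prems])
  finally show ?case by simp
qed simp

text \<open>The first function enters through exactly one factor of the tensor product, the one
  whose order heads \<open>fun_orders K\<close>; for an empty list of orders \<open>factors\<close>
  would drop the function. Linearity in the head suffices, since the operators expanded later are
  symmetric.\<close>

lemma contract_linear_head:
  assumes V: "open V" "\<And>i j. smooth_on V (\<lambda>y. G y $ i $ j)" "\<And>y. y \<in> V \<Longrightarrow> det (G y) \<noteq> 0"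
    and "smooth_on V f" "smooth_on V f'" "y \<in> V" "fun_orders K \<noteq> []"
  shows "contract G ((\<lambda>y. a * f y + b * f' y) # fs) K y = a * contract G (f # fs) K y + b * contract G (f' # fs) K y"
proof -
  obtain N Ns where N: "fun_orders K = N # Ns" using assms(7) by (cases "fun_orders K") auto
  have "(cov_deriv G ^^ N) (\<lambda>_ y. a * f y + b * f' y) I y
    = a * (cov_deriv G ^^ N) (\<lambda>_. f) I y + b * (cov_deriv G ^^ N) (\<lambda>_. f') I y" for I
    using cov_deriv_power_linear[OF V, of "\<lambda>_. f" "\<lambda>_. f'"] assms by simp
  then have "tensor_prod (factors G ((\<lambda>y. a * f y + b * f' y) # fs) K) I y
    = a * tensor_prod (factors G (f # fs) K) I y + b * tensor_prod (factors G (f' # fs) K) I y" for I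
    unfolding factors_def N by (simp add: tensor_prod_append algebra_simps)
  then show ?thesis
    unfolding contract_def by (simp add: sum.distrib sum_distrib_left algebra_simps)
qed

section \<open>Natural operators\<close>

lemma det_nonzero_if_positive:
  fixes M :: "real^'n::finite^'n"
  assumes "\<And>v. v \<noteq> 0 \<Longrightarrow> v \<bullet> (M *v v) > 0"
  shows "det M \<noteq> 0"
proof -
  have "\<forall>v. M *v v = 0 \<longrightarrow> v = 0" using assms by (metis inner_zero_right less_irrefl)
  then show ?thesis using matrix_left_invertible_ker invertible_left_inverse invertible_det_nz by metis
qed

lemma riemannian_chart:
  assumes "riemannian_manifold A g" "(V, \<psi>) \<in> A"
  shows "open V" "smooth_on V (\<lambda>y. g (V, \<psi>) y $ i $ j)" "y \<in> V \<Longrightarrow> det (g (V, \<psi>) y) \<noteq> 0"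
proof -
  have m: "smooth_manifold A" and r: "riemannian_metric A g" using assms(1) by (auto simp: riemannian_manifold_def)
  show "open V" using m assms(2) by (auto simp: smooth_manifold_def)
  note r[unfolded riemannian_metric_def, THEN conjunct1]
  from bspec[OF this assms(2), unfolded prod.case]
  have *: "\<forall>i j. smooth_on V (\<lambda>y. g (V, \<psi>) y $ i $ j)"
    "\<forall>y\<in>V. \<forall>v. v \<noteq> 0 \<longrightarrow> v \<bullet> (g (V, \<psi>) y *v v) > 0" by blast+
  then show "smooth_on V (\<lambda>y. g (V, \<psi>) y $ i $ j)" by blast
  show "det (g (V, \<psi>) y) \<noteq> 0" if "y \<in> V"
    using *(2) that by (intro det_nonzero_if_positive) blast
qed

lemma Cinf_chart: "u \<in> Cinf A \<Longrightarrow> (V, \<psi>) \<in> A \<Longrightarrow> smooth_on V (\<lambda>y. u (\<psi> y))"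
  by (auto simp: Cinf_def comp_def)

lemma CinfI: "(\<And>V \<psi>. (V, \<psi>) \<in> A \<Longrightarrow> smooth_on V (\<lambda>y. u (\<psi> y))) \<Longrightarrow> u \<in> Cinf A"
  by (auto simp: Cinf_def comp_def)

lemma polydiff_op_formula:
  assumes "polydiff_op r D"
  obtains E where "\<And>a K. (a, K) \<in> set E \<Longrightarrow> length (fun_orders K) = r - 1"
    "\<And>A g us V \<psi> y. riemannian_manifold A g \<Longrightarrow> set us \<subseteq> Cinf A \<Longrightarrow> length us = r - 1 \<Longrightarrow> (V, \<psi>) \<in> A \<Longrightarrow> y \<in> V \<Longrightarrow>
      D A g us (\<psi> y) = (\<Sum>(a, K)\<leftarrow>E. a * contract (g (V, \<psi>)) (map (\<lambda>u. u \<circ> \<psi>) us) K y)"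
proof -
  obtain E where E: "\<forall>(a, K)\<in>set E. wf_contraction (r - 1) K"
    "\<forall>A g us. riemannian_manifold A g \<and> set us \<subseteq> Cinf A \<and> length us = r - 1 \<longrightarrow>
           (\<forall>(V, \<psi>)\<in>A. \<forall>y\<in>V. D A g us (\<psi> y) =
              (\<Sum>(a, K)\<leftarrow>E. a * contract (g (V, \<psi>)) (map (\<lambda>u. u \<circ> \<psi>) us) K y))"
    using assms unfolding polydiff_op_def by blast
  show thesis
  proof (rule that)
    show "length (fun_orders K) = r - 1" if "(a, K) \<in> set E" for a K
      using E(1) that by (auto simp: wf_contraction_def)
    fix A :: "('a, 'b) atlas" and g us V \<psi> y
    assume *: "riemannian_manifold A g" "set us \<subseteq> Cinf A" "length us = r - 1" "(V, \<psi>) \<in> A" "y \<in> V"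
    then have "\<forall>(V, \<psi>)\<in>A. \<forall>y\<in>V. D A g us (\<psi> y) =
              (\<Sum>(a, K)\<leftarrow>E. a * contract (g (V, \<psi>)) (map (\<lambda>u. u \<circ> \<psi>) us) K y)" using E(2) by blast
    from bspec[OF this *(4), unfolded prod.case] *(5)
    show "D A g us (\<psi> y) = (\<Sum>(a, K)\<leftarrow>E. a * contract (g (V, \<psi>)) (map (\<lambda>u. u \<circ> \<psi>) us) K y)" by blast
  qed
qed

lemma polydiff_op_Cinf:
  assumes "polydiff_op r D" "riemannian_manifold A g" "set us \<subseteq> Cinf A" "length us = r - 1"
  shows "D A g us \<in> Cinf A"
proof (rule CinfI)
  fix V \<psi> assume c: "(V, \<psi>) \<in> A"
  obtain E where E: "\<And>A g us V \<psi> y. riemannian_manifold A g \<Longrightarrow> set us \<subseteq> Cinf A \<Longrightarrow> length us = r - 1 \<Longrightarrow> (V, \<psi>) \<in> A \<Longrightarrow> y \<in> V \<Longrightarrow>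
      D A g us (\<psi> y) = (\<Sum>(a, K)\<leftarrow>E. a * contract (g (V, \<psi>)) (map (\<lambda>u. u \<circ> \<psi>) us) K y)"
    using polydiff_op_formula[OF assms(1)] by metis
  note V = riemannian_chart[OF assms(2) c]
  have "smooth_on V (\<lambda>y. \<Sum>aK\<leftarrow>E. fst aK * contract (g (V, \<psi>)) (map (\<lambda>u. u \<circ> \<psi>) us) (snd aK) y)"
    using assms(3) Cinf_chart[OF _ c]
    by (intro smooth_on_sum_list smooth_on_mult smooth_on_const smooth_on_contract V) (auto simp: comp_def)
  then show "smooth_on V (\<lambda>y. D A g us (\<psi> y))"
    using E[OF assms(2-4) c] by (subst smooth_on_cong[OF V(1)]) (auto simp: case_prod_unfold)
qed

lemma sum_list_linear:
  fixes f g h :: "'a \<Rightarrow> real"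
  assumes "\<And>x. x \<in> set xs \<Longrightarrow> f x = a * g x + b * h x"
  shows "(\<Sum>x\<leftarrow>xs. f x) = a * (\<Sum>x\<leftarrow>xs. g x) + b * (\<Sum>x\<leftarrow>xs. h x)"
  using assms by (induction xs) (auto simp: algebra_simps)

lemma Cinf_linear:
  assumes "smooth_manifold A" "u \<in> Cinf A" "v \<in> Cinf A"
  shows "(\<lambda>q. a * u q + b * v q) \<in> Cinf A"
proof (rule CinfI)
  fix V \<psi> assume c: "(V, \<psi>) \<in> A"
  then have "open V" using assms(1) by (auto simp: smooth_manifold_def)
  then show "smooth_on V (\<lambda>y. a * u (\<psi> y) + b * v (\<psi> y))"
    using Cinf_chart[OF _ c] assms(2,3) by (intro smooth_on_add smooth_on_mult smooth_on_const)
qed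

lemma Cinf_mult:
  assumes "smooth_manifold A" "u \<in> Cinf A" "v \<in> Cinf A"
  shows "(\<lambda>q. u q * v q) \<in> Cinf A"
proof (rule CinfI)
  fix V \<psi> assume c: "(V, \<psi>) \<in> A"
  then have "open V" using assms(1) by (auto simp: smooth_manifold_def)
  then show "smooth_on V (\<lambda>y. u (\<psi> y) * v (\<psi> y))"
    using Cinf_chart[OF _ c] assms(2,3) by (intro smooth_on_mult)
qed

lemma polydiff_op_linear_head:
  assumes "polydiff_op r D" "riemannian_manifold A g" "u \<in> Cinf A" "v \<in> Cinf A" "set us \<subseteq> Cinf A"
    "Suc (length us) = r - 1" "x \<in> carrier A"
  shows "D A g ((\<lambda>q. a * u q + b * v q) # us) x = a * D A g (u # us) x + b * D A g (v # us) x"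
proof -
  obtain E where E: "\<And>a K. (a, K) \<in> set E \<Longrightarrow> length (fun_orders K) = r - 1"
    "\<And>A g us V \<psi> y. riemannian_manifold A g \<Longrightarrow> set us \<subseteq> Cinf A \<Longrightarrow> length us = r - 1 \<Longrightarrow> (V, \<psi>) \<in> A \<Longrightarrow> y \<in> V \<Longrightarrow>
      D A g us (\<psi> y) = (\<Sum>(a, K)\<leftarrow>E. a * contract (g (V, \<psi>)) (map (\<lambda>u. u \<circ> \<psi>) us) K y)"
    using polydiff_op_formula[OF assms(1)] by metis
  obtain V \<psi> y where c: "(V, \<psi>) \<in> A" "y \<in> V" "x = \<psi> y" using assms(7) by (auto simp: carrier_def)
  note V = riemannian_chart[OF assms(2) c(1)]
  have uv: "(\<lambda>q. a * u q + b * v q) \<in> Cinf A"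
    using Cinf_linear assms(2-4) by (auto simp: riemannian_manifold_def)
  have K: "fun_orders K \<noteq> []" if "(a, K) \<in> set E" for a K
    using E(1)[OF that] assms(6) by auto
  have "contract (g (V, \<psi>)) ((\<lambda>y. a * u (\<psi> y) + b * v (\<psi> y)) # map (\<lambda>u. u \<circ> \<psi>) us) K y
    = a * contract (g (V, \<psi>)) ((\<lambda>y. u (\<psi> y)) # map (\<lambda>u. u \<circ> \<psi>) us) K y
    + b * contract (g (V, \<psi>)) ((\<lambda>y. v (\<psi> y)) # map (\<lambda>u. u \<circ> \<psi>) us) K y" if "(e, K) \<in> set E" for e K
    using K[OF that] Cinf_chart[OF _ c(1)] assms(3,4) c(2) by (intro contract_linear_head[OF V]) auto
  then show ?thesis
    unfolding c(3)
    using E(2)[OF assms(2) _ _ c(1,2), of "(\<lambda>q. a * u q + b * v q) # us"] E(2)[OF assms(2) _ _ c(1,2), of "u # us"]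
      E(2)[OF assms(2) _ _ c(1,2), of "v # us"] assms(3-6) uv
    by (simp add: comp_def) (rule sum_list_linear, auto simp: algebra_simps)
qed

text \<open>For \<open>g'\<close> in the chart \<open>\<psi>\<close> and for \<open>g\<close> in the
  chart \<open>\<Phi> \<circ> \<psi>\<close> the universal formula receives the same matrix and the
  same functions, so no transformation law of tensors is involved. The functions are compared on the
  carrier only; with the identity for \<open>\<Phi>\<close> the lemma says that values off the
  carrier do not matter.\<close>

lemma polydiff_op_natural:
  assumes "polydiff_op r D" "riemannian_manifold A g" "riemannian_manifold A g'"
    and \<Phi>: "\<And>V \<psi>. (V, \<psi>) \<in> A \<Longrightarrow> (V, \<Phi> \<circ> \<psi>) \<in> A"
      "\<And>V \<psi> y. (V, \<psi>) \<in> A \<Longrightarrow> y \<in> V \<Longrightarrow> g' (V, \<psi>) y = g (V, \<Phi> \<circ> \<psi>) y"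
    and us: "set us \<subseteq> Cinf A" "length us = r - 1" "set us' \<subseteq> Cinf A"
      "list_all2 (\<lambda>u' u. \<forall>x\<in>carrier A. u' x = u (\<Phi> x)) us' us"
    and x: "x \<in> carrier A"
  shows "D A g' us' x = D A g us (\<Phi> x)"
proof -
  obtain E where E:
    "\<And>A g us V \<psi> y. riemannian_manifold A g \<Longrightarrow> set us \<subseteq> Cinf A \<Longrightarrow> length us = r - 1 \<Longrightarrow> (V, \<psi>) \<in> A \<Longrightarrow> y \<in> V \<Longrightarrow>
      D A g us (\<psi> y) = (\<Sum>(a, K)\<leftarrow>E. a * contract (g (V, \<psi>)) (map (\<lambda>u. u \<circ> \<psi>) us) K y)"
    using polydiff_op_formula[OF assms(1)] by metis
  obtain V \<psi> y where c: "(V, \<psi>) \<in> A" "y \<in> V" "x = \<psi> y" using x by (auto simp: carrier_def)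
  have V: "open V" using riemannian_chart[OF assms(2) c(1)] by blast
  have "contract (g' (V, \<psi>)) (map (\<lambda>u. u \<circ> \<psi>) us') K y = contract (g (V, \<Phi> \<circ> \<psi>)) (map (\<lambda>u. u \<circ> (\<Phi> \<circ> \<psi>)) us) K y" for K
  proof (rule contract_cong[OF V _ _ c(2)])
    show "g' (V, \<psi>) y = g (V, \<Phi> \<circ> \<psi>) y" if "y \<in> V" for y using \<Phi>(2)[OF c(1) that] .
    have "\<psi> y \<in> carrier A" if "y \<in> V" for y using c(1) that unfolding carrier_def by blast
    then show "list_all2 (\<lambda>f f'. \<forall>y\<in>V. f y = f' y) (map (\<lambda>u. u \<circ> \<psi>) us') (map (\<lambda>u. u \<circ> (\<Phi> \<circ> \<psi>)) us)"
      using us(4) by (auto simp: list.rel_map intro: list.rel_mono_strong)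
  qed
  moreover have "length us' = r - 1" using us(2,4) by (auto dest: list_all2_lengthD)
  ultimately show ?thesis
    using E[OF assms(3) us(3) _ c(1,2)] E[OF assms(2) us(1,2) \<Phi>(1)[OF c(1)] c(2)] by (simp add: c(3))
qed

section \<open>Change of variables\<close>

text \<open>
  The change of variables formula of the library needs a well-ordered index type.  This type has the
  cardinality of \<open>'n\<close> and carries such an order.
\<close>

typedef 'n rank_index = "{..<CARD('n::finite)}"
  by (rule exI[of _ 0]) simp

instantiation rank_index :: (finite) linorder
begin
definition less_eq_rank_index :: "'a rank_index \<Rightarrow> 'a rank_index \<Rightarrow> bool" where
  "a \<le> b \<longleftrightarrow> Rep_rank_index a \<le> Rep_rank_index b"
definition less_rank_index :: "'a rank_index \<Rightarrow> 'a rank_index \<Rightarrow> bool" where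
  "a < b \<longleftrightarrow> Rep_rank_index a < Rep_rank_index b"
instance
  by standard (auto simp: less_eq_rank_index_def less_rank_index_def Rep_rank_index_inject)
end

instance rank_index :: (finite) wellorder
proof (rule wf_wellorderI)
  show "wf {(x::'a rank_index, y). x < y}"
    by (rule wf_subset[OF wf_measure[of Rep_rank_index]]) (auto simp: less_rank_index_def)
qed intro_classes

lemma card_rank_index: "card (UNIV :: 'n::finite rank_index set) = CARD('n)"
  using type_definition.card[OF type_definition_rank_index] by simp

instance rank_index :: (finite) finite
proof
  show "finite (UNIV :: 'a rank_index set)"
    by (rule card_ge_0_finite) (simp add: card_rank_index)
qed

lemma permutes_UNIV_iff: "p permutes UNIV \<longleftrightarrow> bij p"
  using permutes_bij bij_imp_permutes[of p UNIV] by auto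

text \<open>Conjugation by a bijection takes transpositions to transpositions, hence a product of n
  of them to a product of n of them.\<close>

lemma sign_conjugate:
  fixes h :: "'a::finite \<Rightarrow> 'b"
  assumes h: "bij h" and p: "p permutes UNIV"
  shows "sign (h \<circ> p \<circ> inv h) = sign p"
proof -
  have inv_h [simp]: "inv h (h x) = x" "h (inv h z) = z" for x z
    using h by (simp_all add: bij_is_inj bij_is_surj surj_f_inv_f)
  have *: "swapidseq n (h \<circ> p \<circ> inv h)" if "swapidseq n p" for n p
    using that
  proof induction
    case id
    have eq: "h \<circ> id \<circ> inv h = id" by (rule ext) (simp only: comp_apply id_apply inv_h)
    show ?case unfolding eq by (rule swapidseq.id)
  next
    case (comp_Suc n p a b)
    have inj: "h x = h y \<longleftrightarrow> x = y" for x y using bij_is_inj[OF h] by (rule inj_eq)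
    have tr: "h (Transposition.transpose a b w) = Transposition.transpose (h a) (h b) (h w)" for w
      unfolding Transposition.transpose_def inj by (cases "w = a"; cases "w = b") simp_all
    have eq: "h \<circ> (Transposition.transpose a b \<circ> p) \<circ> inv h
        = Transposition.transpose (h a) (h b) \<circ> (h \<circ> p \<circ> inv h)"
      by (rule ext) (simp only: comp_apply tr)
    have "h a \<noteq> h b" using comp_Suc(2) by (simp only: inj not_False_eq_True)
    then show ?case unfolding eq by (rule swapidseq.comp_Suc[OF comp_Suc.IH])
  qed
  have "permutation p" using p by (auto simp: permutation_permutes intro!: exI[of _ UNIV])
  then obtain n where n: "swapidseq n p" by (auto simp: permutation_def)
  have "evenperm (h \<circ> p \<circ> inv h) = even n" "evenperm p = even n"
    using evenperm_unique[OF *[OF n] refl] evenperm_unique[OF n refl] by simp_all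
  then show ?thesis by (simp add: sign_def)
qed

text \<open>In the Leibniz formula, conjugation by \<open>h\<close> is a sign-preserving bijection
  between the permutations of the two index types.\<close>

lemma det_reindex:
  fixes M :: "real^'m::finite^'m" and h :: "'n::finite \<Rightarrow> 'm"
  assumes h: "bij h"
  shows "det (\<chi> i j. M $ h i $ h j) = det M"
proof -
  have inv_h [simp]: "inv h (h x) = x" "h (inv h z) = z" for x z
    using h by (simp_all add: bij_is_inj bij_is_surj surj_f_inv_f)
  let ?c = "\<lambda>p. h \<circ> p \<circ> inv h"
  have bij: "bij_betw ?c {p. p permutes UNIV} {p. p permutes UNIV}"
  proof (rule bij_betw_byWitness[where f' = "\<lambda>p. inv h \<circ> p \<circ> h"])
    have "bij (?c p)" if "bij p" for p using h that by (intro bij_comp bij_imp_bij_inv)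
    then show "?c ` {p. p permutes UNIV} \<subseteq> {p. p permutes UNIV}"
      by (auto simp: permutes_UNIV_iff)
    have "bij (inv h \<circ> p \<circ> h)" if "bij p" for p using h that by (intro bij_comp bij_imp_bij_inv)
    then show "(\<lambda>p. inv h \<circ> p \<circ> h) ` {p. p permutes UNIV} \<subseteq> {p. p permutes UNIV}"
      by (auto simp: permutes_UNIV_iff)
    have "inv h \<circ> ?c p \<circ> h = p" for p by (rule ext) (simp only: comp_apply inv_h)
    then show "\<forall>p\<in>{p. p permutes UNIV}. inv h \<circ> ?c p \<circ> h = p" by blast
    have "?c (inv h \<circ> p \<circ> h) = p" for p by (rule ext) (simp only: comp_apply inv_h)
    then show "\<forall>p\<in>{p. p permutes UNIV}. ?c (inv h \<circ> p \<circ> h) = p" by blast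
  qed
  have "det M = (\<Sum>p | p permutes UNIV. of_int (sign (?c p)) * (\<Prod>i\<in>UNIV. M $ i $ ?c p i))"
    unfolding det_def by (rule sum.reindex_bij_betw[OF bij, symmetric])
  also have "\<dots> = (\<Sum>p | p permutes UNIV. of_int (sign p) * (\<Prod>i\<in>UNIV. M $ h i $ h (p i)))"
  proof (rule sum.cong[OF refl])
    fix p :: "'n \<Rightarrow> 'n" assume p: "p \<in> {p. p permutes UNIV}"
    have "(\<Prod>i\<in>UNIV. M $ i $ ?c p i) = (\<Prod>i\<in>UNIV. M $ h i $ ?c p (h i))"
      by (rule prod.reindex_bij_betw[OF h, symmetric])
    then show "of_int (sign (?c p)) * (\<Prod>i\<in>UNIV. M $ i $ ?c p i)
        = of_int (sign p) * (\<Prod>i\<in>UNIV. M $ h i $ h (p i))"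
      using sign_conjugate[OF h, of p] p by simp
  qed
  finally show ?thesis by (simp add: det_def)
qed

lemma emeasure_differentiable_image_wellorder:
  fixes \<tau> :: "real^'m::{finite,wellorder} \<Rightarrow> real^'m::_"
  assumes B: "B \<in> sets borel"
    and der: "\<And>y. y \<in> B \<Longrightarrow> (\<tau> has_derivative \<tau>' y) (at y)" and inj: "inj_on \<tau> B"
    and images: "\<And>C. C \<in> sets borel \<Longrightarrow> C \<subseteq> B \<Longrightarrow> \<tau> ` C \<in> sets borel"
    and meas: "(\<lambda>y. indicator B y * \<bar>det (matrix (\<tau>' y))\<bar>) \<in> borel_measurable borel"
  shows "emeasure lborel (\<tau> ` B) = (\<integral>\<^sup>+ y. ennreal (indicator B y * \<bar>det (matrix (\<tau>' y))\<bar>) \<partial>lborel)"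
proof -
  let ?J = "\<lambda>y. \<bar>det (matrix (\<tau>' y))\<bar>"
  \<comment> \<open>The image formula used below is applied to sets whose image has finite measure.
    The sets \<open>C m\<close>, with images inside balls, increase to \<open>B\<close>, and both
    sides are continuous along increasing sequences.\<close>
  define C where "C m = B \<inter> \<tau> -` cball 0 (real m)" for m :: nat
  let ?M = "density lborel (\<lambda>y. ennreal (indicator B y * ?J y))"
  have "continuous_on B \<tau>"
    using der by (meson continuous_at_imp_continuous_on has_derivative_continuous)
  from borel_measurable_continuous_on_restrict[OF this]
  have "\<tau> -` cball 0 (real m) \<inter> space (restrict_space borel B) \<in> sets (restrict_space borel B)" for m
    by (rule measurable_sets) simp
  then have Cb: "C m \<in> sets borel" for m
    using B by (simp add: C_def sets_restrict_space_iff space_restrict_space Int_commute)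
  have CB: "C m \<subseteq> B" for m by (auto simp: C_def)
  have *: "emeasure lborel (\<tau> ` C m) = emeasure ?M (C m)" for m
  proof -
    have "\<tau> ` C m \<in> lmeasurable"
      using images[OF Cb CB] by (intro bounded_set_imp_lmeasurable)
        (auto simp: C_def intro: bounded_subset[OF bounded_cball])
    moreover have "C m \<in> sets lebesgue" using Cb by (simp add: sets_completionI_sets)
    moreover have "(\<tau> has_derivative \<tau>' y) (at y within C m)" if "y \<in> C m" for y
      using der CB that has_derivative_at_withinI by blast
    moreover have "inj_on \<tau> (C m)" using inj CB inj_on_subset by blast
    ultimately have "(?J has_integral measure lebesgue (\<tau> ` C m)) (C m)"
      using has_measure_differentiable_image by blast
    then have "integral\<^sup>N lborel (\<lambda>y. indicator (C m) y * ?J y) = ennreal (measure lebesgue (\<tau> ` C m))"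
      by (intro nn_integral_has_integral_lebesgue) auto
    also have "\<dots> = emeasure lebesgue (\<tau> ` C m)"
      using fmeasurableD2[OF \<open>\<tau> ` C m \<in> lmeasurable\<close>] by (simp add: emeasure_eq_ennreal_measure)
    also have "\<dots> = emeasure lborel (\<tau> ` C m)" using images[OF Cb CB] by simp
    finally have "emeasure lborel (\<tau> ` C m) = (\<integral>\<^sup>+ y. ennreal (indicator (C m) y * ?J y) \<partial>lborel)"
      by simp
    also have "\<dots> = (\<integral>\<^sup>+ y. ennreal (indicator B y * ?J y) * indicator (C m) y \<partial>lborel)"
      using CB by (intro nn_integral_cong) (auto simp: indicator_def)
    also have "\<dots> = emeasure ?M (C m)" using meas Cb by (subst emeasure_density) auto
    finally show ?thesis .
  qed
  have inc: "incseq C" by (auto simp: incseq_def C_def intro: order_trans)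
  have UN: "(\<Union>m. C m) = B"
  proof
    show "B \<subseteq> (\<Union>m. C m)"
    proof
      fix y assume "y \<in> B"
      moreover obtain m where "norm (\<tau> y) \<le> real m" using real_arch_simple by blast
      ultimately show "y \<in> (\<Union>m. C m)" by (auto simp: C_def)
    qed
  qed (auto simp: C_def)
  have "emeasure lborel (\<tau> ` B) = emeasure lborel (\<Union>m. \<tau> ` C m)" by (metis UN image_UN)
  also have "\<dots> = (SUP m. emeasure lborel (\<tau> ` C m))"
    using inc images[OF Cb CB] by (intro SUP_emeasure_incseq[symmetric]) (auto simp: incseq_def)
  also have "\<dots> = (SUP m. emeasure ?M (C m))" by (simp add: *)
  also have "\<dots> = emeasure ?M B" using inc Cb by (subst SUP_emeasure_incseq) (auto simp: UN)
  also have "\<dots> = (\<integral>\<^sup>+ y. ennreal (indicator B y * ?J y) * indicator B y \<partial>lborel)"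
    using meas B by (subst emeasure_density) auto
  also have "\<dots> = (\<integral>\<^sup>+ y. ennreal (indicator B y * ?J y) \<partial>lborel)"
    by (intro nn_integral_cong) (auto simp: indicator_def)
  finally show ?thesis .
qed

definition vec_reindex :: "('n \<Rightarrow> 'm) \<Rightarrow> real^'m::finite \<Rightarrow> real^'n::finite" where
  "vec_reindex h x = (\<chi> i. x $ h i)"

lemma vec_reindex_nth [simp]: "vec_reindex h x $ i = x $ h i"
  by (simp add: vec_reindex_def)

lemma vec_reindex_inv [simp]:
  assumes "bij h"
  shows "vec_reindex h (vec_reindex (inv h) x) = x" "vec_reindex (inv h) (vec_reindex h y) = y"
  using assms by (simp_all add: vec_eq_iff bij_is_inj bij_is_surj surj_f_inv_f)

lemma bounded_linear_vec_reindex: "bounded_linear (vec_reindex h)"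
  by (intro linear_conv_bounded_linear[THEN iffD1] linearI) (simp_all add: vec_eq_iff)

lemma borel_measurable_vec_reindex [measurable]: "vec_reindex h \<in> borel_measurable borel"
  by (intro borel_measurable_continuous_onI linear_continuous_on bounded_linear_vec_reindex)

lemma prod_Basis_vec:
  fixes f :: "real^'k::finite \<Rightarrow> real"
  shows "(\<Prod>b\<in>Basis. f b) = (\<Prod>i\<in>UNIV. f (axis i 1))"
proof -
  have eq: "(Basis :: (real^'k) set) = range (\<lambda>i. axis i 1)" by (auto simp: Basis_vec_def)
  show ?thesis unfolding eq by (subst prod.reindex) (auto simp: inj_def axis_eq_axis)
qed

text \<open>Boxes determine Lebesgue measure, and the preimage of a box is the box with its sides
  permuted.\<close>

lemma lborel_vec_reindex:
  fixes h :: "'n::finite \<Rightarrow> 'm::finite"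
  assumes h: "bij h"
  shows "distr lborel borel (vec_reindex h) = lborel"
proof (rule lborel_eqI[symmetric])
  fix l u :: "real^'n" assume lu: "\<And>b. b \<in> Basis \<Longrightarrow> l \<bullet> b \<le> u \<bullet> b"
  have prod_Basis: "(\<Prod>b\<in>Basis. (x - y) \<bullet> b) = (\<Prod>i\<in>UNIV. x $ i - y $ i)" for x y :: "real^'k::finite"
    by (simp add: prod_Basis_vec inner_axis)
  have "axis i 1 \<in> (Basis :: (real^'n) set)" for i by (auto simp: Basis_vec_def)
  from lu[OF this] have le: "l $ i \<le> u $ i" for i by (simp add: inner_axis)
  have pre: "vec_reindex h -` box l u = box (vec_reindex (inv h) l) (vec_reindex (inv h) u)"
  proof (rule set_eqI)
    fix x
    have "(\<forall>i. l $ i < x $ h i \<and> x $ h i < u $ i) \<longleftrightarrow> (\<forall>j. l $ inv h j < x $ j \<and> x $ j < u $ inv h j)"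
      using h by (metis bij_inv_eq_iff)
    then show "x \<in> vec_reindex h -` box l u \<longleftrightarrow> x \<in> box (vec_reindex (inv h) l) (vec_reindex (inv h) u)"
      by (simp add: mem_box_cart)
  qed
  have "emeasure (distr lborel borel (vec_reindex h)) (box l u)
      = emeasure lborel (box (vec_reindex (inv h) l) (vec_reindex (inv h) u :: real^'m))"
    by (subst emeasure_distr) (auto simp: pre)
  also have "\<dots> = (\<Prod>b\<in>Basis. (vec_reindex (inv h) u - vec_reindex (inv h) l :: real^'m) \<bullet> b)"
    using le by (intro emeasure_lborel_box) (auto simp: Basis_vec_def inner_axis)
  also have "\<dots> = (\<Prod>j\<in>UNIV. u $ inv h j - l $ inv h j)" unfolding prod_Basis by simp
  also have "\<dots> = (\<Prod>i\<in>UNIV. u $ i - l $ i)"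
    using prod.reindex_bij_betw[OF bij_imp_bij_inv[OF h], of "\<lambda>i. u $ i - l $ i"] by simp
  also have "\<dots> = (\<Prod>b\<in>Basis. (u - l) \<bullet> b)" unfolding prod_Basis by simp
  finally show "emeasure (distr lborel borel (vec_reindex h)) (box l u) = (\<Prod>b\<in>Basis. (u - l) \<bullet> b)" .
qed simp

text \<open>Relabelling the coordinates on both sides moves the formula to the well-ordered index
  type. The relabelling preserves Lebesgue measure, and a simultaneous permutation of rows and
  columns leaves the Jacobian determinant unchanged.\<close>

lemma emeasure_differentiable_image:
  fixes \<tau> :: "real^'n::finite \<Rightarrow> real^'n"
  assumes B: "B \<in> sets borel"
    and der: "\<And>y. y \<in> B \<Longrightarrow> (\<tau> has_derivative \<tau>' y) (at y)" and inj: "inj_on \<tau> B"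
    and images: "\<And>C. C \<in> sets borel \<Longrightarrow> C \<subseteq> B \<Longrightarrow> \<tau> ` C \<in> sets borel"
    and meas: "(\<lambda>y. indicator B y * \<bar>det (matrix (\<tau>' y))\<bar>) \<in> borel_measurable borel"
  shows "emeasure lborel (\<tau> ` B) = (\<integral>\<^sup>+ y. ennreal (indicator B y * \<bar>det (matrix (\<tau>' y))\<bar>) \<partial>lborel)"
proof -
  obtain h :: "'n \<Rightarrow> 'n rank_index" where h: "bij h"
    using finite_same_card_bij[OF finite finite card_rank_index[symmetric]] by auto
  let ?P = "vec_reindex h :: real^'n rank_index \<Rightarrow> real^'n"
  let ?Q = "vec_reindex (inv h) :: real^'n \<Rightarrow> real^'n rank_index"
  note PQ [simp] = vec_reindex_inv[OF h]
  define \<sigma> where "\<sigma> = (\<lambda>x. ?Q (\<tau> (?P x)))"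
  define \<sigma>' where "\<sigma>' = (\<lambda>x v. ?Q (\<tau>' (?P x) (?P v)))"
  have im: "?Q ` X = ?P -` X" for X by (auto intro: image_eqI[where x = "?P _"])
  have borel_Q: "?Q ` X \<in> sets borel" if "X \<in> sets borel" for X
    unfolding im using measurable_sets[OF borel_measurable_vec_reindex that] by simp
  have borel_P: "?P ` X \<in> sets borel" if "X \<in> sets borel" for X
  proof -
    have "?P ` X = ?Q -` X" by (auto intro: image_eqI[where x = "?Q _"])
    then show ?thesis using measurable_sets[OF borel_measurable_vec_reindex that, of "inv h"] by simp
  qed
  have em: "emeasure lborel X = emeasure lborel (?Q ` X)" if "X \<in> sets borel" for X
    using that by (subst lborel_vec_reindex[OF h, symmetric], subst emeasure_distr) (auto simp: im)
  have det: "det (matrix (\<sigma>' x)) = det (matrix (\<tau>' (?P x)))" if "?P x \<in> B" for x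
  proof -
    have P_axis: "?P (axis (h j) 1) = axis j 1" for j
      using h by (auto simp: vec_eq_iff axis_def bij_is_inj inj_eq)
    have "matrix (\<tau>' (?P x)) = (\<chi> i j. matrix (\<sigma>' x) $ h i $ h j)"
      using h by (simp add: vec_eq_iff matrix_def \<sigma>'_def P_axis bij_is_inj)
    then show ?thesis using det_reindex[OF h] by metis
  qed
  have "emeasure lborel (\<tau> ` B) = emeasure lborel (?Q ` \<tau> ` B)" using em images[OF B] by blast
  also have "?Q ` \<tau> ` B = \<sigma> ` ?Q ` B" by (auto simp: \<sigma>_def image_image)
  also have "emeasure lborel (\<sigma> ` ?Q ` B)
      = (\<integral>\<^sup>+ x. ennreal (indicator (?Q ` B) x * \<bar>det (matrix (\<sigma>' x))\<bar>) \<partial>lborel)"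
  proof (rule emeasure_differentiable_image_wellorder)
    show "?Q ` B \<in> sets borel" using borel_Q B .
    show "(\<sigma> has_derivative \<sigma>' y) (at y)" if "y \<in> ?Q ` B" for y
      unfolding \<sigma>_def \<sigma>'_def using that
      by (intro bounded_linear.has_derivative[OF bounded_linear_vec_reindex]
          has_derivative_compose[OF bounded_linear_imp_has_derivative[OF bounded_linear_vec_reindex]] der) auto
    show "inj_on \<sigma> (?Q ` B)"
    proof (rule inj_onI)
      fix x y assume xy: "x \<in> ?Q ` B" "y \<in> ?Q ` B" "\<sigma> x = \<sigma> y"
      then have "\<tau> (?P x) = \<tau> (?P y)" unfolding \<sigma>_def by (metis PQ(1))
      then have "?P x = ?P y" using xy inj by (auto dest: inj_onD)
      then show "x = y" by (metis PQ(2))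
    qed
    fix C assume C: "C \<in> sets (borel :: (real^'n rank_index) measure)" "C \<subseteq> ?Q ` B"
    have "\<sigma> ` C = ?Q ` \<tau> ` ?P ` C" by (auto simp: \<sigma>_def image_image)
    moreover have "?P ` C \<subseteq> B" using C(2) by auto
    ultimately show "\<sigma> ` C \<in> sets borel" using borel_Q[OF images[OF borel_P[OF C(1)]]] by simp
  next
    have "(\<lambda>x. indicator B (?P x) * \<bar>det (matrix (\<tau>' (?P x)))\<bar>) \<in> borel_measurable borel"
      using measurable_compose[OF borel_measurable_vec_reindex meas] .
    also have "(\<lambda>x. indicator B (?P x) * \<bar>det (matrix (\<tau>' (?P x)))\<bar>)
        = (\<lambda>x. indicator (?Q ` B) x * \<bar>det (matrix (\<sigma>' x))\<bar>)"
      using det by (auto simp: im indicator_def fun_eq_iff)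
    finally show "(\<lambda>x. indicator (?Q ` B) x * \<bar>det (matrix (\<sigma>' x))\<bar>) \<in> borel_measurable borel" .
  qed
  also have "\<dots> = (\<integral>\<^sup>+ x. ennreal (indicator B (?P x) * \<bar>det (matrix (\<tau>' (?P x)))\<bar>) \<partial>lborel)"
    using det by (intro nn_integral_cong) (auto simp: im indicator_def)
  also have "\<dots> = (\<integral>\<^sup>+ y. ennreal (indicator B y * \<bar>det (matrix (\<tau>' y))\<bar>) \<partial>distr lborel borel ?P)"
    using meas by (subst nn_integral_distr) auto
  also have "distr lborel borel ?P = lborel" by (rule lborel_vec_reindex[OF h])
  finally show ?thesis .
qed

text \<open>The image under an injective map is the preimage under its inverse, and the inverse is
  measurable because it is continuous.\<close>

lemma borel_image_inverse:
  fixes \<tau> :: "'a::euclidean_space \<Rightarrow> 'b::euclidean_space"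
  assumes "inj_on \<tau> W" "\<tau> ` W \<in> sets borel" "continuous_on (\<tau> ` W) (inv_into W \<tau>)" "C \<in> sets borel" "C \<subseteq> W"
  shows "\<tau> ` C \<in> sets borel"
proof -
  have "inv_into W \<tau> -` C \<inter> space (restrict_space borel (\<tau> ` W)) \<in> sets (restrict_space borel (\<tau> ` W))"
    using borel_measurable_continuous_on_restrict[OF assms(3)] assms(4) by (rule measurable_sets)
  moreover have "inv_into W \<tau> -` C \<inter> space (restrict_space borel (\<tau> ` W)) = \<tau> ` C"
    using assms(1,5) by (auto simp: space_restrict_space)
  ultimately show ?thesis using assms(2) by (simp add: sets_restrict_space_iff)
qed

text \<open>Change of variables as an identity of measures. \<open>\<tau>W\<close> is
  \<open>\<tau>\<close> made total by the default value 0 off \<open>W\<close>; the density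
  \<open>J\<close> vanishes there, so the default carries no mass.\<close>

lemma distr_density_diffeomorphism:
  fixes \<tau> :: "real^'n::finite \<Rightarrow> real^'n"
  assumes W: "open W" "smooth_on W \<tau>" "inj_on \<tau> W" "\<And>y. y \<in> W \<Longrightarrow> inj (frechet_derivative \<tau> (at y))"
  defines "J \<equiv> \<lambda>y. indicator W y * \<bar>det (matrix (frechet_derivative \<tau> (at y)))\<bar>"
    and "\<tau>W \<equiv> \<lambda>y. if y \<in> W then \<tau> y else 0"
  shows "J \<in> borel_measurable borel" "\<tau>W \<in> borel_measurable borel"
    "distr (density lborel (\<lambda>y. ennreal (J y))) borel \<tau>W = density lborel (indicator (\<tau> ` W))"
proof -
  note inv = smooth_on_inv_into[OF W(1,3,2,4)]
  have "continuous_on W (\<lambda>y. \<bar>det (matrix (frechet_derivative \<tau> (at y)))\<bar>)"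
  proof (intro continuous_on_rabs smooth_on_imp_continuous_on smooth_on_det W)
    show "smooth_on W (\<lambda>y. matrix (frechet_derivative \<tau> (at y)) $ i $ j)" for i j
      unfolding matrix_def using smooth_on_vec_nth[OF W(1) smooth_on_frechet_derivative[OF W(2)]] by simp
  qed
  then show J: "J \<in> borel_measurable borel"
    unfolding J_def
    using borel_measurable_continuous_on_indicator[of W "\<lambda>y. \<bar>det (matrix (frechet_derivative \<tau> (at y)))\<bar>"] W(1)
    by simp
  show \<tau>W: "\<tau>W \<in> borel_measurable borel"
    unfolding \<tau>W_def using W(1) smooth_on_imp_continuous_on[OF W(2)]
    by (intro borel_measurable_continuous_on_if) auto
  show "distr (density lborel (\<lambda>y. ennreal (J y))) borel \<tau>W = density lborel (indicator (\<tau> ` W))"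
  proof (rule measure_eqI)
    fix C assume "C \<in> sets (distr (density lborel (\<lambda>y. ennreal (J y))) borel \<tau>W)"
    then have C: "C \<in> sets borel" by simp
    define B where "B = W \<inter> \<tau>W -` C"
    have B: "B \<in> sets borel" "B \<subseteq> W" using measurable_sets[OF \<tau>W C] W(1) by (auto simp: B_def)
    have im: "\<tau> ` B = C \<inter> \<tau> ` W" by (auto simp: B_def \<tau>W_def)
    have "emeasure (distr (density lborel (\<lambda>y. ennreal (J y))) borel \<tau>W) C
        = (\<integral>\<^sup>+ y. ennreal (J y) * indicator (\<tau>W -` C) y \<partial>lborel)"
      using J \<tau>W C by (subst emeasure_distr) (auto simp: emeasure_density measurable_sets_borel)
    also have "\<dots> = (\<integral>\<^sup>+ y. ennreal (indicator B y * \<bar>det (matrix (frechet_derivative \<tau> (at y)))\<bar>) \<partial>lborel)"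
      by (intro nn_integral_cong) (auto simp: B_def J_def indicator_def)
    also have "\<dots> = emeasure lborel (\<tau> ` B)"
    proof (rule emeasure_differentiable_image[symmetric, OF B(1)])
      show "(\<tau> has_derivative frechet_derivative \<tau> (at y)) (at y)" if "y \<in> B" for y
        using smooth_on_has_derivative[OF W(2)] B(2) that by blast
      show "inj_on \<tau> B" using W(3) B(2) inj_on_subset by blast
      show "\<tau> ` C \<in> sets borel" if "C \<in> sets borel" "C \<subseteq> B" for C
        using borel_image_inverse[OF W(3) _ smooth_on_imp_continuous_on[OF inv(2)] that(1)] inv(1) that(2) B(2) by auto
      have "(\<lambda>y. indicator B y * J y) \<in> borel_measurable borel" using J B(1) by auto
      also have "(\<lambda>y. indicator B y * J y) = (\<lambda>y. indicator B y * \<bar>det (matrix (frechet_derivative \<tau> (at y)))\<bar>)"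
        using B(2) by (auto simp: J_def indicator_def fun_eq_iff)
      finally show "(\<lambda>y. indicator B y * \<bar>det (matrix (frechet_derivative \<tau> (at y)))\<bar>) \<in> borel_measurable borel" .
    qed
    also have "\<dots> = emeasure (density lborel (indicator (\<tau> ` W))) C"
      using C inv(1) by (subst emeasure_density)
        (auto simp: im Int_commute nn_integral_indicator[symmetric] indicator_inter_arith mult.commute simp del: nn_integral_indicator)
    finally show "emeasure (distr (density lborel (\<lambda>y. ennreal (J y))) borel \<tau>W) C
        = emeasure (density lborel (indicator (\<tau> ` W))) C" .
  qed simp
qed

section \<open>The volume measure\<close>

text \<open>\<open>dV\<close> is a definite description. Naming the described property separates
  existence from uniqueness, and later identifications of volumes reduce to checking this
  property.\<close>

definition is_volume :: "('n::finite, 'p) atlas \<Rightarrow> ('n, 'p) metric \<Rightarrow> 'p measure \<Rightarrow> bool" where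
  "is_volume A g \<mu> \<longleftrightarrow> space \<mu> = carrier A \<and>
     sets \<mu> = sigma_sets (carrier A) {W. openin (chart_top A) W} \<and>
     (\<forall>(V, \<psi>)\<in>A. \<forall>B\<in>sets borel. B \<subseteq> V \<longrightarrow>
        emeasure \<mu> (\<psi> ` B) = (\<integral>\<^sup>+ y\<in>B. ennreal (sqrt (det (g (V, \<psi>) y))) \<partial>lborel))"

lemma dV_eq: "dV A g = (THE \<mu>. is_volume A g \<mu>)"
  by (simp add: dV_def is_volume_def)

lemma is_volume_emeasure:
  assumes "is_volume A g \<mu>" "(V, \<psi>) \<in> A" "B \<in> sets borel" "B \<subseteq> V"
  shows "emeasure \<mu> (\<psi> ` B) = (\<integral>\<^sup>+ y. ennreal (sqrt (det (g (V, \<psi>) y))) * indicator B y \<partial>lborel)"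
proof -
  note assms(1)[unfolded is_volume_def, THEN conjunct2, THEN conjunct2]
  from bspec[OF this assms(2), unfolded prod.case] assms(3,4) show ?thesis by blast
qed

lemma is_volume_point:
  fixes A :: "('n::finite, 'p) atlas"
  assumes "is_volume A g \<mu>" "(V, \<psi>) \<in> A" "y \<in> V"
  shows "emeasure \<mu> {\<psi> y} = 0"
proof -
  have "emeasure \<mu> (\<psi> ` {y}) = (\<integral>\<^sup>+ z. ennreal (sqrt (det (g (V, \<psi>) z))) * indicator {y} z \<partial>lborel)"
    using assms by (intro is_volume_emeasure) auto
  also have "\<dots> = (\<integral>\<^sup>+ z. 0 \<partial>(lborel :: (real^'n) measure))"
  proof (rule nn_integral_cong_AE)
    show "AE z in lborel. ennreal (sqrt (det (g (V, \<psi>) z))) * indicator {y} z = 0"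
      using AE_lborel_singleton[of y] by eventually_elim (simp add: indicator_def)
  qed
  finally show ?thesis by simp
qed

text \<open>Needed because a pulled-back metric and a conformally changed one coincide only at the
  parameters in \<open>V\<close>; off \<open>V\<close> their values are junk.\<close>

lemma is_volume_cong:
  assumes "\<And>V \<psi> y. (V, \<psi>) \<in> A \<Longrightarrow> y \<in> V \<Longrightarrow> g (V, \<psi>) y = g' (V, \<psi>) y"
  shows "is_volume A g \<mu> \<longleftrightarrow> is_volume A g' \<mu>"
proof -
  have "(\<integral>\<^sup>+ y\<in>B. ennreal (sqrt (det (g (V, \<psi>) y))) \<partial>lborel) = (\<integral>\<^sup>+ y\<in>B. ennreal (sqrt (det (g' (V, \<psi>) y))) \<partial>lborel)"
    if "(V, \<psi>) \<in> A" "B \<subseteq> V" for V \<psi> B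
    using that assms by (intro nn_integral_cong) (auto simp: indicator_def)
  note eq = this
  have "(\<forall>B\<in>sets borel. B \<subseteq> V \<longrightarrow>
        emeasure \<mu> (\<psi> ` B) = (\<integral>\<^sup>+ y\<in>B. ennreal (sqrt (det (g (V, \<psi>) y))) \<partial>lborel)) \<longleftrightarrow>
      (\<forall>B\<in>sets borel. B \<subseteq> V \<longrightarrow>
        emeasure \<mu> (\<psi> ` B) = (\<integral>\<^sup>+ y\<in>B. ennreal (sqrt (det (g' (V, \<psi>) y))) \<partial>lborel))"
    if "(V, \<psi>) \<in> A" for V \<psi>
    by (intro ball_cong refl imp_cong) (simp only: eq[OF that])
  then show ?thesis unfolding is_volume_def by (intro conj_cong refl ball_cong) (simp only: split_paired_all prod.case)
qed

lemma sets_sphere: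
  "sigma_sets (carrier (sphere_atlas :: ('n::finite, real^('n option)) atlas)) {W. openin (chart_top (sphere_atlas :: ('n, real^('n option)) atlas)) W}
    = sets (restrict_space borel (sphere 0 1))"
proof -
  let ?S = "sphere 0 1 :: (real^('n option)) set"
  have "sets (restrict_space borel ?S) = (\<inter>) ?S ` sigma_sets UNIV {U. open U}"
    by (simp add: sets_restrict_space borel_def)
  also have "\<dots> = sigma_sets ?S ((\<inter>) ?S ` {U. open U})"
  proof (cases "?S \<in> sigma_sets UNIV {U. open U}")
    case True
    then show ?thesis by (intro sigma_sets_Int) auto
  next
    \<comment> \<open>The sphere is closed, hence Borel, so this case is contradictory.\<close>
    case False
    then show ?thesis using borel_closed[of ?S] by (simp add: borel_def)
  qed
  also have "(\<inter>) ?S ` {U. open U} = {W. openin (top_of_set ?S) W}" by (auto simp: openin_open)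
  finally show ?thesis by (simp add: chart_top_sphere)
qed

section \<open>Existence and uniqueness of the volume of the sphere\<close>

lemma sphere_pole_unique:
  fixes p q :: "real^('n::finite option)"
  assumes "p \<in> sphere 0 1" "q \<in> sphere 0 1" "p $ None = 1" "q $ None = 1"
  shows "p = q"
proof -
  have "x $ Some j = 0" if "x \<in> sphere 0 1" "x $ None = 1" for x :: "real^('n option)" and j
  proof -
    have "x \<bullet> x = 1" using that(1) by (simp add: norm_eq_1)
    then have "(\<Sum>j\<in>UNIV. x $ Some j * x $ Some j) = 0" using that(2) by (simp add: inner_option)
    then show ?thesis by (subst (asm) sum_nonneg_eq_0_iff) auto
  qed
  then show ?thesis using assms by (simp add: vec_eq_iff split_option_all)
qed

lemma stereo_denominator_nonzero: "s\<^sup>2 = 1 \<Longrightarrow> 1 - s * stereo s y $ None \<noteq> 0"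
  using inner_self_add_one_pos[of y] by (subst stereo_denominator) auto

lemma range_stereo:
  "range (stereo 1 :: real^'n::finite \<Rightarrow> _) = sphere 0 1 \<inter> {p. 1 - 1 * p $ None \<noteq> 0}"
proof (intro equalityI subsetI)
  fix p assume "p \<in> range (stereo 1 :: real^'n \<Rightarrow> _)"
  then obtain y :: "real^'n" where "p = stereo 1 y" by blast
  then show "p \<in> sphere 0 1 \<inter> {p. 1 - 1 * p $ None \<noteq> 0}"
    using stereo_in_sphere[of 1 y] stereo_denominator_nonzero[of 1 y] by (simp del: stereo_nth)
next
  fix p :: "real^('n option)" assume "p \<in> sphere 0 1 \<inter> {p. 1 - 1 * p $ None \<noteq> 0}"
  then have "stereo 1 (stereo_proj 1 p) = p" by (intro stereo_stereo_proj) auto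
  then show "p \<in> range (stereo 1)" by (metis rangeI)
qed

lemma chart_pole_finite:
  assumes "(V, \<psi>) \<in> sphere_atlas"
  shows "finite {y \<in> V. \<not> 1 - 1 * \<psi> y $ None \<noteq> 0}"
proof -
  have "y = y'" if "y \<in> V" "y' \<in> V" "\<psi> y $ None = 1" "\<psi> y' $ None = 1" for y y'
  proof -
    have "\<psi> y = \<psi> y'" using assms that by (intro sphere_pole_unique) (auto simp: sphere_atlas_iff)
    then show ?thesis using assms that by (auto simp: sphere_atlas_iff dest: inj_onD)
  qed
  note uniq = this
  show ?thesis
  proof (cases "\<exists>y\<in>V. \<psi> y $ None = 1")
    case True
    then obtain y0 where "y0 \<in> V" "\<psi> y0 $ None = 1" by blast
    then have "{y \<in> V. \<not> 1 - 1 * \<psi> y $ None \<noteq> 0} \<subseteq> {y0}" using uniq by auto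
    then show ?thesis by (rule finite_subset) simp
  next
    case False
    then have "{y \<in> V. \<not> 1 - 1 * \<psi> y $ None \<noteq> 0} = {}" by auto
    then show ?thesis by (simp only: finite.emptyI)
  qed
qed

text \<open>Away from the pole the image is reached in two steps, first by \<open>\<tau>\<close> and
  then by \<open>stereo 1\<close>, each injective with a continuous inverse. The parameters over the
  pole are finitely many and contribute a finite, hence closed, set.\<close>

lemma borel_chart_image:
  assumes c: "(V, \<psi>) \<in> sphere_atlas" and C: "C \<in> sets borel" "C \<subseteq> V"
  shows "\<psi> ` C \<in> sets borel"
proof -
  define W where "W = {y \<in> V. 1 - 1 * \<psi> y $ None \<noteq> 0}"
  define \<tau> where "\<tau> = (\<lambda>y. stereo_proj 1 (\<psi> y))"
  have t: "open W" "smooth_on W \<tau>" "inj_on \<tau> W" "\<And>y. y \<in> W \<Longrightarrow> inj (frechet_derivative \<tau> (at y))"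
    "\<And>y. y \<in> W \<Longrightarrow> stereo 1 (\<tau> y) = \<psi> y"
    using stereo_coordinates[OF c, of 1] unfolding W_def \<tau>_def by simp_all
  note inv = smooth_on_inv_into[OF t(1,3,2,4)]
  have im: "\<tau> ` (C \<inter> W) \<in> sets borel"
    by (rule borel_image_inverse[OF t(3) borel_open[OF inv(1)] smooth_on_imp_continuous_on[OF inv(2)]])
      (use C(1) borel_open[OF t(1)] in auto)
  have range: "range (stereo 1 :: real^'a \<Rightarrow> _) \<in> sets borel"
    unfolding range_stereo using open_stereo_domain[of 1, where 'n = 'a] by (intro sets.Int) auto
  have cont: "continuous_on (range (stereo 1 :: real^'a \<Rightarrow> _)) (inv_into UNIV (stereo 1))"
  proof -
    have "continuous_on (range (stereo 1 :: real^'a \<Rightarrow> _)) (stereo_proj 1)"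
      by (rule continuous_on_subset[OF smooth_on_imp_continuous_on[OF smooth_on_stereo_proj[of 1]]])
        (simp add: range_stereo)
    moreover have "inv_into UNIV (stereo 1) p = stereo_proj 1 p" if "p \<in> range (stereo 1 :: real^'a \<Rightarrow> _)" for p
      using that by (metis f_inv_into_f power_one stereo_proj_stereo)
    ultimately show ?thesis by (simp cong: continuous_on_cong)
  qed
  have "inj (stereo 1 :: real^'a \<Rightarrow> _)" by (rule inj_on_inverseI[of _ "stereo_proj 1"]) simp
  then have "stereo 1 ` \<tau> ` (C \<inter> W) \<in> sets borel"
    by (rule borel_image_inverse[OF _ range cont im subset_UNIV])
  also have "stereo 1 ` \<tau> ` (C \<inter> W) = \<psi> ` (C \<inter> W)"
    unfolding image_image by (rule image_cong[OF refl]) (simp add: t(5))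
  finally have "\<psi> ` (C \<inter> W) \<in> sets borel" .
  moreover have "finite (C - W)"
    by (rule finite_subset[OF _ chart_pole_finite[OF c]]) (use C in \<open>auto simp: W_def\<close>)
  then have "\<psi> ` (C - W) \<in> sets borel" by (intro finite_imp_closed borel_closed finite_imageI)
  moreover have "\<psi> ` C = \<psi> ` (C \<inter> W) \<union> \<psi> ` (C - W)" by auto
  ultimately show ?thesis by simp
qed

lemma sqrt_det_transform:
  assumes "riemannian_manifold A g" "(V, \<psi>) \<in> A" "(V', \<psi>') \<in> A" "y \<in> V" "\<psi> y \<in> \<psi>' ` V'"
  defines "\<tau> \<equiv> inv_into V' \<psi>' \<circ> \<psi>"
  shows "sqrt (det (g (V, \<psi>) y)) = \<bar>det (matrix (frechet_derivative \<tau> (at y)))\<bar> * sqrt (det (g (V', \<psi>') (\<tau> y)))"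
proof -
  let ?M = "matrix (frechet_derivative \<tau> (at y))" and ?G = "g (V', \<psi>') (\<tau> y)"
  have r: "riemannian_metric A g" using assms(1) by (simp add: riemannian_manifold_def)
  have "g (V, \<psi>) y $ i $ j = (transpose ?M ** ?G ** ?M) $ i $ j" for i j
  proof -
    have "g (V, \<psi>) y $ i $ j = (\<Sum>a\<in>UNIV. \<Sum>b\<in>UNIV. ?M $ a $ i * ?G $ a $ b * ?M $ b $ j)"
      unfolding riemannian_metric_transform[OF r assms(2-5), folded \<tau>_def]
      by (simp add: matrix_def partial_def ac_simps)
    also have "\<dots> = (\<Sum>b\<in>UNIV. \<Sum>a\<in>UNIV. ?M $ a $ i * ?G $ a $ b * ?M $ b $ j)" by (rule sum.swap)
    also have "\<dots> = (transpose ?M ** ?G ** ?M) $ i $ j"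
      by (simp add: matrix_matrix_mult_def transpose_def sum_distrib_right)
    finally show ?thesis .
  qed
  then have "g (V, \<psi>) y = transpose ?M ** ?G ** ?M" by (simp add: vec_eq_iff)
  then have "det (g (V, \<psi>) y) = (det ?M)\<^sup>2 * det ?G" by (simp add: det_mul power2_eq_square)
  then show ?thesis by (simp add: real_sqrt_mult)
qed

text \<open>One chart suffices: \<open>stereo 1\<close> misses a single point of the sphere, and
  points are null for every volume by \<open>is_volume_point\<close>.\<close>

definition sphere_volume :: "('n::finite, real^('n option)) metric \<Rightarrow> (real^('n option)) measure" where
  "sphere_volume g = distr (density lborel (\<lambda>y. ennreal (sqrt (det (g (UNIV, stereo 1) y)))))
     (restrict_space borel (sphere 0 1)) (stereo 1)"

lemma measurable_stereo: "stereo 1 \<in> measurable borel (restrict_space borel (sphere 0 1))"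
  using stereo_in_sphere[of 1] smooth_on_imp_continuous_on[OF smooth_on_stereo]
  by (intro measurable_restrict_space2 borel_measurable_continuous_onI) auto

lemma sphere_density_measurable:
  fixes g :: "('n::finite, real^('n option)) metric"
  assumes "riemannian_manifold sphere_atlas g"
  shows "(\<lambda>y. sqrt (det (g (UNIV, stereo 1) y))) \<in> borel_measurable borel"
  using riemannian_chart[OF assms stereo_in_atlas[of 1]]
  by (intro borel_measurable_continuous_onI continuous_on_real_sqrt smooth_on_imp_continuous_on smooth_on_det) auto

text \<open>The prescribed density has to be verified in every chart. Off the pole a chart is
  \<open>stereo 1\<close> composed with \<open>\<tau>\<close>. The change of variables multiplies
  the stereographic density by the Jacobian of \<open>\<tau>\<close>, which by
  \<open>sqrt_det_transform\<close> is the density of the given chart. Only the finitely many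
  parameters over the pole are lost, a null set.\<close>

lemma is_volume_sphere_volume:
  fixes g :: "('n::finite, real^('n option)) metric"
  assumes g: "riemannian_manifold sphere_atlas g"
  shows "is_volume sphere_atlas g (sphere_volume g)"
  unfolding is_volume_def
proof (intro conjI, goal_cases)
  case 1
  show ?case by (simp add: sphere_volume_def space_restrict_space)
next
  case 2
  show ?case unfolding sets_sphere by (simp add: sphere_volume_def)
next
  case 3
  have "emeasure (sphere_volume g) (\<psi> ` B) = (\<integral>\<^sup>+ y. ennreal (sqrt (det (g (V, \<psi>) y))) * indicator B y \<partial>lborel)"
    if c: "(V, \<psi>) \<in> sphere_atlas" and B: "B \<in> sets borel" "B \<subseteq> V" for V \<psi> B
  proof -
    define \<rho> where "\<rho> y = sqrt (det (g (UNIV, stereo 1) y))" for y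
    define W where "W = {y \<in> V. 1 - 1 * \<psi> y $ None \<noteq> 0}"
    define \<tau> where "\<tau> = (\<lambda>y. stereo_proj 1 (\<psi> y))"
    have t: "open W" "smooth_on W \<tau>" "inj_on \<tau> W" "\<And>y. y \<in> W \<Longrightarrow> inj (frechet_derivative \<tau> (at y))"
      "\<And>y. y \<in> W \<Longrightarrow> stereo 1 (\<tau> y) = \<psi> y"
      using stereo_coordinates[OF c, of 1] unfolding W_def \<tau>_def by simp_all
    note inv = smooth_on_inv_into[OF t(1,3,2,4)]
    define J where "J = (\<lambda>y. indicator W y * \<bar>det (matrix (frechet_derivative \<tau> (at y)))\<bar>)"
    define \<tau>W where "\<tau>W = (\<lambda>y. if y \<in> W then \<tau> y else 0)"
    have d: "J \<in> borel_measurable borel" "\<tau>W \<in> borel_measurable borel"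
      "distr (density lborel (\<lambda>y. ennreal (J y))) borel \<tau>W = density lborel (indicator (\<tau> ` W))"
      using distr_density_diffeomorphism[OF t(1-3)] t(4) unfolding J_def \<tau>W_def by blast+
    have \<rho>: "\<rho> \<in> borel_measurable borel" unfolding \<rho>_def using sphere_density_measurable[OF g] .
    have BW: "\<tau> ` (B \<inter> W) \<in> sets borel"
      by (rule borel_image_inverse[OF t(3) borel_open[OF inv(1)] smooth_on_imp_continuous_on[OF inv(2)]])
        (use B(1) borel_open[OF t(1)] in auto)
    have meas: "(\<lambda>z. ennreal (\<rho> z) * indicator (\<tau> ` (B \<inter> W)) z) \<in> borel_measurable borel"
      using \<rho> BW by measurable
    have pre: "stereo 1 -` (\<psi> ` B) = \<tau> ` (B \<inter> W)"
    proof (intro equalityI subsetI)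
      fix z assume "z \<in> stereo 1 -` (\<psi> ` B)"
      then obtain y where y: "y \<in> B" "stereo 1 z = \<psi> y" by auto
      have "1 - 1 * stereo 1 z $ None \<noteq> 0"
        by (rule stereo_denominator_nonzero) simp
      with y B(2) have "y \<in> W" by (auto simp: W_def simp del: stereo_nth)
      moreover have "\<tau> y = z" unfolding \<tau>_def y(2)[symmetric] by simp
      ultimately show "z \<in> \<tau> ` (B \<inter> W)" using y(1) by blast
    next
      fix z assume "z \<in> \<tau> ` (B \<inter> W)"
      then obtain y where "y \<in> B" "y \<in> W" "z = \<tau> y" by blast
      with t(5)[of y] show "z \<in> stereo 1 -` (\<psi> ` B)" by auto
    qed
    have "\<psi> ` B \<in> sets borel" "\<psi> ` B \<subseteq> sphere 0 1"
      using borel_chart_image[OF c B] c B by (auto simp: sphere_atlas_iff)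
    then have "\<psi> ` B \<in> sets (restrict_space borel (sphere 0 1))"
      by (subst sets_restrict_space_iff) auto
    moreover have "stereo 1 \<in> measurable (density lborel (\<lambda>y. ennreal (\<rho> y))) (restrict_space borel (sphere 0 1))"
      using measurable_stereo by (simp add: measurable_def)
    ultimately have "emeasure (sphere_volume g) (\<psi> ` B) = emeasure (density lborel (\<lambda>y. ennreal (\<rho> y))) (\<tau> ` (B \<inter> W))"
      unfolding sphere_volume_def \<rho>_def[symmetric] by (subst emeasure_distr) (simp_all add: pre)
    also have "\<dots> = (\<integral>\<^sup>+ z. ennreal (\<rho> z) * indicator (\<tau> ` (B \<inter> W)) z \<partial>lborel)"
      using \<rho> BW by (subst emeasure_density) auto
    also have "\<dots> = (\<integral>\<^sup>+ z. indicator (\<tau> ` W) z * (ennreal (\<rho> z) * indicator (\<tau> ` (B \<inter> W)) z) \<partial>lborel)"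
      by (intro nn_integral_cong) (auto simp: indicator_def)
    also have "\<dots> = (\<integral>\<^sup>+ z. ennreal (\<rho> z) * indicator (\<tau> ` (B \<inter> W)) z \<partial>density lborel (indicator (\<tau> ` W)))"
      using meas inv(1) by (subst nn_integral_density) auto
    also have "\<dots> = (\<integral>\<^sup>+ y. ennreal (\<rho> (\<tau>W y)) * indicator (\<tau> ` (B \<inter> W)) (\<tau>W y) \<partial>density lborel (\<lambda>y. ennreal (J y)))"
      unfolding d(3)[symmetric] using meas d(2) by (subst nn_integral_distr) auto
    also have "\<dots> = (\<integral>\<^sup>+ y. ennreal (J y) * (ennreal (\<rho> (\<tau>W y)) * indicator (\<tau> ` (B \<inter> W)) (\<tau>W y)) \<partial>lborel)"
      using d(1) measurable_compose[OF d(2) meas] by (subst nn_integral_density) auto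
    also have "\<dots> = (\<integral>\<^sup>+ y. ennreal (sqrt (det (g (V, \<psi>) y))) * indicator B y \<partial>lborel)"
    proof (rule nn_integral_cong_AE)
      have "{y \<in> V. \<not> 1 - 1 * \<psi> y $ None \<noteq> 0} \<in> null_sets lborel"
        using chart_pole_finite[OF c] by (rule finite_imp_null_set_lborel)
      from AE_not_in[OF this]
      show "AE y in lborel. ennreal (J y) * (ennreal (\<rho> (\<tau>W y)) * indicator (\<tau> ` (B \<inter> W)) (\<tau>W y))
          = ennreal (sqrt (det (g (V, \<psi>) y))) * indicator B y"
      proof eventually_elim
        case (elim y)
        show ?case
        proof (cases "y \<in> W")
          case True
          have eq: "(inv_into UNIV (stereo 1) \<circ> \<psi>) z = \<tau> z" if "z \<in> W" for z
            using t(5)[OF that] inv_into_f_f[of "stereo 1 :: real^'n \<Rightarrow> _" UNIV "\<tau> z"]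
              stereo_in_atlas[of 1, where 'n = 'n] by (simp add: sphere_atlas_iff)
          have "sqrt (det (g (V, \<psi>) y)) = \<bar>det (matrix (frechet_derivative (inv_into UNIV (stereo 1) \<circ> \<psi>) (at y)))\<bar>
              * sqrt (det (g (UNIV, stereo 1) ((inv_into UNIV (stereo 1) \<circ> \<psi>) y)))"
          proof (rule sqrt_det_transform[OF g c stereo_in_atlas])
            show "\<psi> y \<in> range (stereo 1)" using t(5)[OF True] by (metis rangeI)
          qed (use True in \<open>auto simp: W_def\<close>)
          also have "frechet_derivative (inv_into UNIV (stereo 1) \<circ> \<psi>) (at y) = frechet_derivative \<tau> (at y)"
            by (rule frechet_derivative_cong_open[OF t(1) True eq])
          finally have "sqrt (det (g (V, \<psi>) y)) = J y * \<rho> (\<tau> y)"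
            using eq[OF True] True by (simp add: J_def \<rho>_def)
          moreover have "J y \<ge> 0" by (simp add: J_def)
          moreover have "\<tau> y \<in> \<tau> ` (B \<inter> W) \<longleftrightarrow> y \<in> B" using True t(3) by (auto dest: inj_onD)
          ultimately show ?thesis using True by (auto simp: \<tau>W_def ennreal_mult' indicator_def)
        next
          case False
          then have "y \<notin> B" using elim B(2) by (auto simp: W_def)
          then show ?thesis using False by (simp add: J_def)
        qed
      qed
    qed
    finally show ?thesis .
  qed
  then show ?case by blast
qed

text \<open>The formula for the chart \<open>stereo 1\<close> determines the measure off the
  remaining pole \<open>q\<close>. Since \<open>q = stereo (-1) 0\<close> is covered by the other
  stereographic chart, it is null.\<close>

lemma is_volume_unique:
  fixes g :: "('n::finite, real^('n option)) metric"
  assumes "is_volume sphere_atlas g \<mu>" "is_volume sphere_atlas g \<mu>'"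
  shows "\<mu> = \<mu>'"
proof (rule measure_eqI)
  have sets: "sets M = sets (restrict_space borel (sphere 0 1))" if "is_volume sphere_atlas g M" for M
    using that unfolding is_volume_def sets_sphere by blast
  show "sets \<mu> = sets \<mu>'" using sets assms by metis
  fix X assume "X \<in> sets \<mu>"
  then have X: "X \<in> sets borel" "X \<subseteq> sphere 0 1"
    using sets[OF assms(1)] by (auto simp: sets_restrict_space_iff)
  define B where "B = (stereo 1 :: real^'n \<Rightarrow> _) -` X"
  define q where "q = (stereo (-1) 0 :: real^('n option))"
  have B: "B \<in> sets borel"
    using measurable_sets[OF borel_measurable_continuous_onI[OF smooth_on_imp_continuous_on[OF smooth_on_stereo[of 1]]] X(1)]
    by (simp add: B_def)
  have q: "q \<in> sphere 0 1" "q $ None = 1" using stereo_in_sphere[of "-1"] by (simp_all add: q_def)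
  have eq: "emeasure M X = (\<integral>\<^sup>+ y. ennreal (sqrt (det (g (UNIV, stereo 1) y))) * indicator B y \<partial>lborel)"
    if M: "is_volume sphere_atlas g M" for M
  proof -
    have "emeasure M {q} = 0" using is_volume_point[OF M stereo_in_atlas[of "-1"], of 0] by (simp add: q_def)
    moreover have qs: "{q} \<in> sets M" unfolding sets[OF M] using q by (subst sets_restrict_space_iff) auto
    ultimately have qn: "{q} \<in> null_sets M" by auto
    have XM: "X \<in> sets M" unfolding sets[OF M] using X by (subst sets_restrict_space_iff) auto
    have "X - {q} = stereo 1 ` B"
    proof (intro equalityI subsetI)
      fix p assume p: "p \<in> X - {q}"
      then have "p $ None \<noteq> 1" using X(2) q sphere_pole_unique[of p q] by blast
      then have "p \<in> range (stereo 1)" using p X(2) by (auto simp: range_stereo)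
      then show "p \<in> stereo 1 ` B" using p by (auto simp: B_def)
    next
      fix p assume "p \<in> stereo 1 ` B"
      moreover then have "1 - 1 * p $ None \<noteq> 0" using range_stereo by blast
      ultimately show "p \<in> X - {q}" using q(2) by (auto simp: B_def)
    qed
    moreover have "emeasure M X = emeasure M (X - {q})" using emeasure_Diff_null_set[OF qn XM] by simp
    ultimately show ?thesis using is_volume_emeasure[OF M stereo_in_atlas[of 1] B] by simp
  qed
  show "emeasure \<mu> X = emeasure \<mu>' X" using eq assms by simp
qed

lemma dV_eqI:
  fixes g :: "('n::finite, real^('n option)) metric"
  shows "is_volume sphere_atlas g \<mu> \<Longrightarrow> dV sphere_atlas g = \<mu>"
  unfolding dV_eq by (rule the_equality) (auto intro: is_volume_unique)

lemma dV_sphere: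
  fixes g :: "('n::finite, real^('n option)) metric"
  assumes "riemannian_manifold sphere_atlas g"
  shows "dV sphere_atlas g = sphere_volume g" "is_volume sphere_atlas g (dV sphere_atlas g)"
proof -
  show "dV sphere_atlas g = sphere_volume g" by (rule dV_eqI[OF is_volume_sphere_volume[OF assms]])
  then show "is_volume sphere_atlas g (dV sphere_atlas g)" using is_volume_sphere_volume[OF assms] by simp
qed

lemma sets_dV_sphere [measurable_cong]:
  fixes g :: "('n::finite, real^('n option)) metric"
  assumes "riemannian_manifold sphere_atlas g"
  shows "sets (dV sphere_atlas g) = sets (restrict_space borel (sphere 0 1))"
    "space (dV sphere_atlas g) = sphere 0 1"
  using dV_sphere(1)[OF assms] by (simp_all add: sphere_volume_def space_restrict_space)

section \<open>Conformal change, push-forward and finiteness of the volume\<close>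

lemma det_scaleR: "det (c *\<^sub>R M) = c ^ CARD('n) * det (M :: real^'n^'n)"
proof -
  have "c *\<^sub>R M = (\<chi> i. c *s M $ i)" by (simp add: vec_eq_iff)
  then show ?thesis by (simp add: det_rows_mul)
qed

text \<open>The determinant picks up the n-th power of \<open>exp (2 * \<Upsilon> x)\<close>; its
  square root has the exponent n times \<open>\<Upsilon> x\<close>.\<close>

lemma dV_conf_metric:
  fixes g :: "('n::finite, real^('n option)) metric"
  assumes g: "riemannian_manifold sphere_atlas g" and \<Upsilon>: "\<Upsilon> \<in> Cinf sphere_atlas"
    and meas: "\<Upsilon> \<in> borel_measurable (restrict_space borel (sphere 0 1))"
  shows "dV sphere_atlas (conf_metric \<Upsilon> g) = density (dV sphere_atlas g) (\<lambda>x. ennreal (exp (real CARD('n) * \<Upsilon> x)))"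
proof -
  let ?\<rho> = "\<lambda>y. sqrt (det (g (UNIV, stereo 1) y))"
  let ?h = "\<lambda>x. ennreal (exp (real CARD('n) * \<Upsilon> x))"
  have \<rho>: "?\<rho> \<in> borel_measurable borel" by (rule sphere_density_measurable[OF g])
  have h: "?h \<in> borel_measurable (restrict_space borel (sphere 0 1))" using meas by measurable
  have st: "stereo 1 \<in> measurable (density lborel (\<lambda>y. ennreal (?\<rho> y))) (restrict_space borel (sphere 0 1))"
    using measurable_stereo by (simp add: measurable_def)
  have "density (dV sphere_atlas g) ?h
      = distr (density (density lborel (\<lambda>y. ennreal (?\<rho> y))) (\<lambda>y. ?h (stereo 1 y))) (restrict_space borel (sphere 0 1)) (stereo 1)"
    unfolding dV_sphere(1)[OF g] sphere_volume_def by (rule density_distr[OF h st])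
  also have "density (density lborel (\<lambda>y. ennreal (?\<rho> y))) (\<lambda>y. ?h (stereo 1 y))
      = density lborel (\<lambda>y. ennreal (?\<rho> y) * ?h (stereo 1 y))"
    using \<rho> measurable_compose[OF measurable_stereo h] by (intro density_density_eq) auto
  also have "(\<lambda>y. ennreal (?\<rho> y) * ?h (stereo 1 y)) = (\<lambda>y. ennreal (sqrt (det (conf_metric \<Upsilon> g (UNIV, stereo 1) y))))"
  proof
    fix y :: "real^'n"
    have "det (conf_metric \<Upsilon> g (UNIV, stereo 1) y) = (exp (real CARD('n) * \<Upsilon> (stereo 1 y)))\<^sup>2 * det (g (UNIV, stereo 1) y)"
      by (simp add: conf_metric_def det_scaleR exp_of_nat_mult[symmetric] ac_simps exp_double[symmetric])
    then show "ennreal (?\<rho> y) * ?h (stereo 1 y) = ennreal (sqrt (det (conf_metric \<Upsilon> g (UNIV, stereo 1) y)))"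
      by (simp add: real_sqrt_mult ennreal_mult'' mult.commute)
  qed
  also have "distr (density lborel (\<lambda>y. ennreal (sqrt (det (conf_metric \<Upsilon> g (UNIV, stereo 1) y)))))
      (restrict_space borel (sphere 0 1)) (stereo 1) = dV sphere_atlas (conf_metric \<Upsilon> g)"
    unfolding dV_sphere(1)[OF riemannian_manifold_conf_metric[OF g \<Upsilon>]] sphere_volume_def ..
  finally show ?thesis by simp
qed

text \<open>By uniqueness it is enough that the push-forward has the right density in each chart.
  The preimage under \<open>\<Phi>\<close> of an image under \<open>\<psi>\<close> is the image of
  the same parameters under the chart \<open>\<Phi>' \<circ> \<psi>\<close>, so no Jacobian
  appears.\<close>

lemma distr_dV_diffeomorphism:
  fixes g g' :: "('n::finite, real^('n option)) metric"
  assumes g: "riemannian_manifold sphere_atlas g" and g': "riemannian_manifold sphere_atlas g'"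
    and \<Phi>: "\<And>p. p \<in> sphere 0 1 \<Longrightarrow> \<Phi>' (\<Phi> p) = p" "\<And>p. p \<in> sphere 0 1 \<Longrightarrow> \<Phi> (\<Phi>' p) = p"
      "\<Phi> ` sphere 0 1 \<subseteq> sphere 0 1" "continuous_on (sphere 0 1) \<Phi>"
    and \<Phi>': "\<And>V \<psi>. (V, \<psi>) \<in> sphere_atlas \<Longrightarrow> (V, \<Phi>' \<circ> \<psi>) \<in> sphere_atlas"
      "\<And>V \<psi> y. (V, \<psi>) \<in> sphere_atlas \<Longrightarrow> y \<in> V \<Longrightarrow> g' (V, \<Phi>' \<circ> \<psi>) y = g (V, \<psi>) y"
  shows "distr (dV sphere_atlas g') (restrict_space borel (sphere 0 1)) \<Phi> = dV sphere_atlas g"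
proof (rule dV_eqI[symmetric], unfold is_volume_def, intro conjI, goal_cases)
  case 1
  show ?case by (simp add: space_restrict_space)
next
  case 2
  show ?case unfolding sets_sphere by simp
next
  case 3
  have \<Phi>m: "\<Phi> \<in> measurable (dV sphere_atlas g') (restrict_space borel (sphere 0 1))"
  proof -
    have "\<Phi> \<in> measurable (restrict_space borel (sphere 0 1)) (restrict_space borel (sphere 0 1))"
      using \<Phi>(3,4) by (intro measurable_restrict_space2 borel_measurable_continuous_on_restrict)
        (auto simp: space_restrict_space)
    then show ?thesis by (simp add: measurable_def sets_dV_sphere[OF g'] space_restrict_space)
  qed
  have "emeasure (distr (dV sphere_atlas g') (restrict_space borel (sphere 0 1)) \<Phi>) (\<psi> ` B)
      = (\<integral>\<^sup>+ y. ennreal (sqrt (det (g (V, \<psi>) y))) * indicator B y \<partial>lborel)"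
    if c: "(V, \<psi>) \<in> sphere_atlas" and B: "B \<in> sets borel" "B \<subseteq> V" for V \<psi> B
  proof -
    have sub: "\<psi> ` B \<subseteq> sphere 0 1" "(\<Phi>' \<circ> \<psi>) ` B \<subseteq> sphere 0 1"
      using c \<Phi>'(1)[OF c] B by (auto simp: sphere_atlas_iff)
    then have "\<psi> ` B \<in> sets (restrict_space borel (sphere 0 1))"
      using borel_chart_image[OF c B] by (subst sets_restrict_space_iff) auto
    then have "emeasure (distr (dV sphere_atlas g') (restrict_space borel (sphere 0 1)) \<Phi>) (\<psi> ` B)
      = emeasure (dV sphere_atlas g') (\<Phi> -` \<psi> ` B \<inter> space (dV sphere_atlas g'))"
      by (rule emeasure_distr[OF \<Phi>m])
    also have "\<Phi> -` \<psi> ` B \<inter> space (dV sphere_atlas g') = (\<Phi>' \<circ> \<psi>) ` B"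
    proof (intro equalityI subsetI)
      fix p assume "p \<in> \<Phi> -` \<psi> ` B \<inter> space (dV sphere_atlas g')"
      then obtain y where "y \<in> B" "\<Phi> p = \<psi> y" "p \<in> sphere 0 1" by (auto simp: sets_dV_sphere[OF g'])
      then show "p \<in> (\<Phi>' \<circ> \<psi>) ` B" using \<Phi>(1)[of p] by (metis comp_apply image_eqI)
    next
      fix p assume "p \<in> (\<Phi>' \<circ> \<psi>) ` B"
      then show "p \<in> \<Phi> -` \<psi> ` B \<inter> space (dV sphere_atlas g')"
        using sub \<Phi>(2) by (auto simp: sets_dV_sphere[OF g'])
    qed
    also have "emeasure (dV sphere_atlas g') ((\<Phi>' \<circ> \<psi>) ` B)
        = (\<integral>\<^sup>+ y. ennreal (sqrt (det (g' (V, \<Phi>' \<circ> \<psi>) y))) * indicator B y \<partial>lborel)"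
      by (rule is_volume_emeasure[OF dV_sphere(2)[OF g'] \<Phi>'(1)[OF c] B])
    also have "\<dots> = (\<integral>\<^sup>+ y. ennreal (sqrt (det (g (V, \<psi>) y))) * indicator B y \<partial>lborel)"
      using \<Phi>'(2)[OF c] B(2) by (intro nn_integral_cong) (auto simp: indicator_def)
    finally show ?thesis .
  qed
  then show ?case by blast
qed

lemma sphere_hemispheres:
  "sphere 0 1 = stereo 1 ` cball (0 :: real^'n::finite) 1 \<union> stereo (-1) ` cball 0 1"
proof (intro equalityI subsetI)
  fix p :: "real^('n option)" assume p: "p \<in> sphere 0 1"
  have *: "p \<in> stereo s ` cball (0 :: real^'n) 1" if s: "s\<^sup>2 = 1" "s * p $ None \<le> 0" for s
  proof -
    have eq: "stereo s (stereo_proj s p) = p" using p s by (intro stereo_stereo_proj) auto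
    let ?y = "stereo_proj s p"
    have "s * (stereo s ?y $ None) \<le> 0" using s(2) eq by simp
    moreover have "s * (s * a / b) = s\<^sup>2 * a / b" for a b by (simp add: power2_eq_square)
    then have "s * (stereo s ?y $ None) = (?y \<bullet> ?y - 1) / (?y \<bullet> ?y + 1)"
      unfolding stereo_nth using s(1) by (simp only: mult_1)
    ultimately have "(?y \<bullet> ?y - 1) / (?y \<bullet> ?y + 1) \<le> 0" by (simp only:)
    then have "?y \<bullet> ?y \<le> 1" using inner_self_add_one_pos[of ?y] by (simp add: divide_le_0_iff)
    then have "?y \<in> cball 0 1" by (simp add: norm_eq_sqrt_inner)
    then show ?thesis using eq by (metis imageI)
  qed
  show "p \<in> stereo 1 ` cball (0 :: real^'n) 1 \<union> stereo (-1) ` cball 0 1"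
    using *[of 1] *[of "-1"] by (cases "p $ None \<le> 0") auto
qed (use stereo_in_sphere[of 1] stereo_in_sphere[of "-1"] in auto)

text \<open>Two closed unit balls of stereographic parameters, one for each pole, cover the sphere,
  and on each of them the continuous density is bounded.\<close>

lemma finite_measure_dV_sphere:
  fixes g :: "('n::finite, real^('n option)) metric"
  assumes g: "riemannian_manifold sphere_atlas g"
  shows "finite_measure (dV sphere_atlas g)"
proof
  have fin: "emeasure (dV sphere_atlas g) (stereo s ` cball (0 :: real^'n) 1) < \<infinity>" if s: "s\<^sup>2 = 1" for s
  proof -
    let ?f = "\<lambda>y. sqrt (det (g (UNIV, stereo s) y))"
    have "continuous_on UNIV ?f"
      using riemannian_chart[OF g stereo_in_atlas[OF s]]
      by (intro continuous_on_real_sqrt smooth_on_imp_continuous_on smooth_on_det) auto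
    then have "continuous_on (cball 0 1) ?f" by (rule continuous_on_subset) simp
    then have "\<exists>x\<in>cball 0 1. \<forall>y\<in>cball 0 1. ?f y \<le> ?f x" by (intro continuous_attains_sup) auto
    then obtain b where b: "\<And>y. y \<in> cball 0 1 \<Longrightarrow> ?f y \<le> b" by blast
    have "emeasure (dV sphere_atlas g) (stereo s ` cball (0 :: real^'n) 1)
        = (\<integral>\<^sup>+ y. ennreal (?f y) * indicator (cball 0 1) y \<partial>lborel)"
      by (rule is_volume_emeasure[OF dV_sphere(2)[OF g] stereo_in_atlas[OF s]]) auto
    also have "\<dots> \<le> (\<integral>\<^sup>+ y. ennreal b * indicator (cball (0 :: real^'n) 1) y \<partial>lborel)"
    proof (rule nn_integral_mono)
      show "ennreal (?f y) * indicator (cball 0 1) y \<le> ennreal b * indicator (cball 0 1) y" for y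
        using b[of y] by (auto simp: indicator_def intro: ennreal_leI)
    qed
    also have "(\<integral>\<^sup>+ y. ennreal b * indicator (cball (0 :: real^'n) 1) y \<partial>lborel)
        = ennreal b * emeasure lborel (cball (0 :: real^'n) 1)" by (rule nn_integral_cmult_indicator) simp
    also have "\<dots> < \<infinity>" using emeasure_bounded_finite[OF bounded_cball, of "0 :: real^'n" 1] by (simp add: ennreal_mult_less_top)
    finally show ?thesis .
  qed
  have "space (dV sphere_atlas g) = stereo 1 ` cball (0 :: real^'n) 1 \<union> stereo (-1) ` cball 0 1"
    using sets_dV_sphere(2)[OF g] sphere_hemispheres by simp
  moreover have "stereo s ` cball (0 :: real^'n) 1 \<in> sets (dV sphere_atlas g)" if "s\<^sup>2 = 1" for s
    using borel_chart_image[OF stereo_in_atlas[OF that], of "cball 0 1"] stereo_in_sphere[OF that]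
    by (simp add: sets_dV_sphere(1)[OF g], subst sets_restrict_space_iff) auto
  ultimately have "emeasure (dV sphere_atlas g) (space (dV sphere_atlas g))
     \<le> emeasure (dV sphere_atlas g) (stereo 1 ` cball (0 :: real^'n) 1) + emeasure (dV sphere_atlas g) (stereo (-1) ` cball (0 :: real^'n) 1)"
    by (simp add: emeasure_subadditive)
  also have "\<dots> < \<infinity>" using fin[of 1] fin[of "-1"] by simp
  finally show "emeasure (dV sphere_atlas g) (space (dV sphere_atlas g)) \<noteq> \<infinity>" by simp
qed

lemma dV_sphere_point:
  fixes g :: "('n::finite, real^('n option)) metric"
  assumes g: "riemannian_manifold sphere_atlas g"
  shows "AE x in dV sphere_atlas g. x \<noteq> p"
proof (cases "p \<in> sphere 0 1")
  case True
  obtain s :: real where s: "s\<^sup>2 = 1" "1 - s * p $ None \<noteq> 0" by (rule sphere_stereo_cover)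
  let ?y = "stereo_proj s p"
  have "emeasure (dV sphere_atlas g) {p} = 0"
    using is_volume_point[OF dV_sphere(2)[OF g] stereo_in_atlas[OF s(1)], of ?y]
    by (simp add: stereo_stereo_proj[OF s(1) True s(2)])
  moreover have "{p} \<in> sets (dV sphere_atlas g)"
    using True by (simp add: sets_dV_sphere(1)[OF g], subst sets_restrict_space_iff) auto
  ultimately show ?thesis by (intro AE_I[of _ _ "{p}"]) auto
next
  case False
  then show ?thesis using sets_dV_sphere(2)[OF g] by (intro AE_I2) auto
qed

text \<open>The segment from the identity to \<open>M\<close> consists of positive definite matrices.\<close>

lemma det_pos_if_positive:
  fixes M :: "real^'n::finite^'n"
  assumes "\<And>v. v \<noteq> 0 \<Longrightarrow> v \<bullet> (M *v v) > 0"
  shows "det M > 0"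
proof (rule ccontr)
  define P where "P t = (1 - t) *\<^sub>R mat 1 + t *\<^sub>R M" for t :: real
  have "smooth_on UNIV (\<lambda>t. det (P t))"
    unfolding P_def by (intro smooth_on_det)
      (auto intro!: smooth_on_add smooth_on_mult smooth_on_diff smooth_on_ident)
  then have "continuous_on {0..1} (\<lambda>t. det (P t))"
    using smooth_on_imp_continuous_on continuous_on_subset by blast
  moreover assume "\<not> det M > 0"
  then have "det (P 1) \<le> 0" "0 \<le> det (P 0)" by (simp_all add: P_def)
  ultimately obtain t where t: "0 \<le> t" "t \<le> 1" "det (P t) = 0"
    using IVT2'[of "\<lambda>t. det (P t)" 1 0 0] by auto
  have "v \<bullet> (P t *v v) > 0" if v: "v \<noteq> 0" for v
  proof -
    have "P t *v v = (1 - t) *\<^sub>R v + t *\<^sub>R (M *v v)"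
      by (simp add: P_def matrix_vector_mult_add_rdistrib scaleR_matrix_vector_assoc[symmetric])
    then have eq: "v \<bullet> (P t *v v) = (1 - t) * (v \<bullet> v) + t * (v \<bullet> (M *v v))"
      by (simp add: inner_add_right)
    have "v \<bullet> v > 0" "v \<bullet> (M *v v) > 0" using v assms by auto
    then show ?thesis unfolding eq
      using t(1,2) by (cases "t = 0") (auto intro!: add_nonneg_pos mult_nonneg_nonneg)
  qed
  from det_nonzero_if_positive[OF this] t(3) show False by simp
qed

lemma riemannian_det_pos:
  assumes "riemannian_manifold A g" "(V, \<psi>) \<in> A" "y \<in> V"
  shows "det (g (V, \<psi>) y) > 0"
proof -
  have "riemannian_metric A g" using assms(1) by (simp add: riemannian_manifold_def)
  note this[unfolded riemannian_metric_def, THEN conjunct1]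
  from bspec[OF this assms(2), unfolded prod.case] assms(3) show ?thesis
    by (intro det_pos_if_positive) blast
qed

text \<open>In a stereographic chart around \<open>p\<close>, the set contains the image of a
  nonempty open set of parameters, on which the density is positive.\<close>

lemma dV_sphere_open_pos:
  fixes g :: "('n::finite, real^('n option)) metric"
  assumes g: "riemannian_manifold sphere_atlas g" and W: "openin (top_of_set (sphere 0 1)) W" "p \<in> W"
  shows "emeasure (dV sphere_atlas g) W > 0"
proof -
  have p: "p \<in> sphere 0 1" using W openin_imp_subset by blast
  obtain s :: real where s: "s\<^sup>2 = 1" "1 - s * p $ None \<noteq> 0" by (rule sphere_stereo_cover)
  define B where "B = {y :: real^'n. stereo s y \<in> W}"
  have B: "open B" using W(1) stereo_in_atlas[OF s(1)] unfolding B_def chart_top_sphere[symmetric] openin_chart_top by auto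
  have yB: "stereo_proj s p \<in> B" using stereo_stereo_proj[OF s(1) p s(2)] W(2) by (simp add: B_def)
  let ?f = "\<lambda>y. sqrt (det (g (UNIV, stereo s) y))"
  have ch: "continuous_on UNIV ?f"
    using riemannian_chart[OF g stereo_in_atlas[OF s(1)]]
    by (intro continuous_on_real_sqrt smooth_on_imp_continuous_on smooth_on_det) auto
  have "emeasure (dV sphere_atlas g) (stereo s ` B) \<noteq> 0"
  proof
    assume "emeasure (dV sphere_atlas g) (stereo s ` B) = 0"
    then have "(\<integral>\<^sup>+ y. ennreal (?f y) * indicator B y \<partial>lborel) = 0"
      using is_volume_emeasure[OF dV_sphere(2)[OF g] stereo_in_atlas[OF s(1)], of B] B by simp
    moreover have "(\<lambda>y. ennreal (?f y) * indicator B y) \<in> borel_measurable borel"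
      using borel_measurable_continuous_onI[OF ch] borel_open[OF B]
      by (intro borel_measurable_times_ennreal borel_measurable_indicator measurable_compose[OF _ measurable_ennreal]) auto
    ultimately have ae: "AE y in lborel. ennreal (?f y) * indicator B y = 0" by (subst (asm) nn_integral_0_iff_AE) auto
    have pos: "?f y > 0" for y
      using riemannian_det_pos[OF g stereo_in_atlas[OF s(1)], of y] by simp
    from ae have "AE y in lborel. y \<notin> B"
    proof eventually_elim
      case (elim y)
      then show ?case using pos[of y] by (auto simp: indicator_def)
    qed
    then have "emeasure lborel B = 0" using B by (subst (asm) AE_iff_measurable[of B]) auto
    then show False using B yB open_not_negligible[of B] by (auto simp: negligible_iff_null_sets null_sets_def)
  qed
  then have "0 < emeasure (dV sphere_atlas g) (stereo s ` B)" by (simp add: zero_less_iff_neq_zero)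
  also have "\<dots> \<le> emeasure (dV sphere_atlas g) W"
  proof (rule emeasure_mono)
    show "stereo s ` B \<subseteq> W" by (auto simp: B_def)
    obtain U where "open U" "W = sphere 0 1 \<inter> U" using W(1) unfolding openin_open by blast
    then show "W \<in> sets (dV sphere_atlas g)"
      unfolding sets_dV_sphere(1)[OF g] sets_restrict_space by (intro image_eqI[of W _ U] borel_open)
  qed
  finally show ?thesis .
qed

lemma continuous_on_sphere_Cinf:
  fixes u :: "real^('n::finite option) \<Rightarrow> real"
  assumes "u \<in> Cinf (sphere_atlas :: ('n, real^('n option)) atlas)"
  shows "continuous_on (sphere 0 1) u"
proof (rule continuous_on_eq_continuous_within[THEN iffD2], rule ballI)
  fix p :: "real^('n option)" assume p: "p \<in> sphere 0 1"
  obtain s :: real where s: "s\<^sup>2 = 1" "1 - s * p $ None \<noteq> 0" by (rule sphere_stereo_cover)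
  let ?U = "{p :: real^('n option). 1 - s * p $ None \<noteq> 0}"
  have "continuous_on UNIV (\<lambda>y. u (stereo s y))"
    using Cinf_chart[OF assms stereo_in_atlas[OF s(1)]] by (rule smooth_on_imp_continuous_on)
  then have "continuous_on ?U (\<lambda>q. u (stereo s (stereo_proj s q)))"
    using smooth_on_imp_continuous_on[OF smooth_on_stereo_proj[of s]]
    by (rule continuous_on_compose2) auto
  then have "continuous (at p) (\<lambda>q. u (stereo s (stereo_proj s q)))"
    unfolding continuous_on_eq_continuous_at[OF open_stereo_domain] using s(2) by blast
  then have "continuous (at p within sphere 0 1) (\<lambda>q. u (stereo s (stereo_proj s q)))"
    by (rule continuous_at_imp_continuous_at_within)
  then show "continuous (at p within sphere 0 1) u"
  proof (rule continuous_transform_within_openin[where T = "sphere 0 1" and S = "sphere 0 1 \<inter> ?U"])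
    show "openin (top_of_set (sphere 0 1)) (sphere 0 1 \<inter> ?U)" using open_stereo_domain[of s] by (rule openin_open_Int)
    show "p \<in> sphere 0 1 \<inter> ?U" using p s by simp
    show "u (stereo s (stereo_proj s q)) = u q" if "q \<in> sphere 0 1 \<inter> ?U" for q
    proof -
      have "q \<in> sphere 0 1" "1 - s * q $ None \<noteq> 0" using that by blast+
      from stereo_stereo_proj[OF s(1) this] show ?thesis by (simp only:)
    qed
  qed
qed

lemma measurable_sphere_continuous:
  "continuous_on (sphere 0 1) f \<Longrightarrow> f \<in> borel_measurable (restrict_space borel (sphere 0 1))"
  by (rule borel_measurable_continuous_on_restrict)

lemma integrable_dV_sphere:
  fixes g :: "('n::finite, real^('n option)) metric" and f :: "real^('n option) \<Rightarrow> real"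
  assumes g: "riemannian_manifold sphere_atlas g" and f: "continuous_on (sphere 0 1) f"
  shows "integrable (dV sphere_atlas g) f"
proof -
  interpret finite_measure "dV sphere_atlas g" by (rule finite_measure_dV_sphere[OF g])
  have "compact (f ` sphere 0 1)" using f by (rule compact_continuous_image) simp
  then have "bounded (f ` sphere 0 1)" by (rule compact_imp_bounded)
  then obtain b where b: "\<And>p. p \<in> sphere 0 1 \<Longrightarrow> norm (f p) \<le> b" unfolding bounded_iff by blast
  show ?thesis
  proof (rule integrable_const_bound)
    show "AE p in dV sphere_atlas g. norm (f p) \<le> b"
      using b by (intro AE_I2) (simp only: sets_dV_sphere(2)[OF g])
    show "f \<in> borel_measurable (dV sphere_atlas g)"
      using measurable_sphere_continuous[OF f] measurable_cong_sets[OF sets_dV_sphere(1)[OF g] refl] by blast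
  qed
qed

section \<open>Moebius transformations of the sphere\<close>

text \<open>The conformal factor of \<open>mobius a\<close>, positive on the unit sphere when
  \<open>norm a < 1\<close>. For \<open>norm a = 1\<close> it is identically 0, also at
  \<open>x = a\<close>, where the denominator vanishes; this extends the family of maps to the
  closed ball of parameters.\<close>

definition mobius_factor :: "'a::real_inner \<Rightarrow> 'a \<Rightarrow> real" where
  "mobius_factor a x = (1 - a \<bullet> a) / ((x - a) \<bullet> (x - a))"

text \<open>The inversion of power \<open>a \<bullet> a - 1\<close> centred at \<open>a\<close>, which maps the unit sphere to itself, followed by
  \<open>x \<mapsto> -x\<close>.  For
  \<open>norm a = 1\<close> the value is \<open>-a\<close> for every \<open>x\<close>, also for \<open>x = a\<close>.\<close>

definition mobius :: "'a::real_inner \<Rightarrow> 'a \<Rightarrow> 'a" where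
  "mobius a x = mobius_factor a x *\<^sub>R (x - a) - a"

lemma mobius_boundary: "norm a = 1 \<Longrightarrow> mobius a x = - a"
  by (simp add: mobius_def mobius_factor_def norm_eq_1)

lemma norm_less_1_inner: "norm a < 1 \<Longrightarrow> a \<bullet> a < 1"
  by (simp add: norm_lt_square)

lemma mobius_factor_pos:
  assumes "norm a < 1" "norm x = 1"
  shows "mobius_factor a x > 0"
proof -
  have "x \<noteq> a" using assms by auto
  then show ?thesis using norm_less_1_inner[OF assms(1)] by (simp add: mobius_factor_def)
qed

lemma norm_mobius:
  assumes "norm a < 1" "norm x = 1"
  shows "norm (mobius a x) = 1"
proof -
  define d c where "d = (x - a) \<bullet> (x - a)" and "c = 1 - a \<bullet> a"
  have "x \<noteq> a" using assms by auto
  then have d: "d \<noteq> 0" by (simp add: d_def)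
  have xx: "x \<bullet> x = 1" using assms(2) by (simp add: norm_eq_1)
  have "(t *\<^sub>R z - a) \<bullet> (t *\<^sub>R z - a) = t * t * (z \<bullet> z) - t * (2 * (z \<bullet> a)) + a \<bullet> a" for t z
    by (simp add: inner_diff_left inner_diff_right inner_commute algebra_simps)
  then have "mobius a x \<bullet> mobius a x = (c / d) * (c / d) * d - (c / d) * (2 * ((x - a) \<bullet> a)) + a \<bullet> a"
    unfolding mobius_def mobius_factor_def d_def c_def .
  \<comment> \<open>From \<open>norm x = 1\<close>, by expanding the square of
    \<open>(x - a) + a\<close>:
    \<open>1 = d + 2 * ((x - a) \<bullet> a) + a \<bullet> a\<close>.\<close>
  also have "2 * ((x - a) \<bullet> a) = c - d"
    using xx by (simp add: d_def c_def inner_diff_left inner_diff_right inner_commute)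
  also have "(c / d) * (c / d) * d - (c / d) * (c - d) + a \<bullet> a = 1"
    using d by (simp add: c_def field_simps)
  finally show ?thesis by (simp add: norm_eq_1)
qed

lemma mobius_add_inner:
  assumes "norm a < 1" "norm x = 1"
  shows "(mobius a x + a) \<bullet> (mobius a x + a) = (1 - a \<bullet> a) * mobius_factor a x"
proof -
  have "x \<noteq> a" using assms by auto
  then show ?thesis by (simp add: mobius_def mobius_factor_def)
qed

lemma mobius_factor_mobius:
  assumes "norm a < 1" "norm x = 1"
  shows "mobius_factor (- a) (mobius a x) = 1 / mobius_factor a x"
  using norm_less_1_inner[OF assms(1)] mobius_add_inner[OF assms]
  by (simp add: mobius_factor_def[of "- a"])

text \<open>\<open>mobius a x + a\<close> is \<open>x - a\<close> scaled by
  \<open>mobius_factor a x\<close>, and the factor of \<open>mobius (- a)\<close> at the image is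
  the reciprocal. So \<open>mobius (- a)\<close> undoes the scaling and then the
  translation.\<close>

lemma mobius_mobius:
  assumes "norm a < 1" "norm x = 1"
  shows "mobius (- a) (mobius a x) = x"
proof -
  have "mobius (- a) (mobius a x) = (1 / mobius_factor a x) *\<^sub>R (mobius a x + a) + a"
    by (simp add: mobius_def[of "- a"] mobius_factor_mobius[OF assms])
  also have "\<dots> = x" using mobius_factor_pos[OF assms] by (simp add: mobius_def)
  finally show ?thesis .
qed

lemma mobius_has_derivative:
  assumes "x \<noteq> a"
  defines "d \<equiv> (x - a) \<bullet> (x - a)"
  shows "(mobius a has_derivative
    (\<lambda>h. (1 - a \<bullet> a) *\<^sub>R ((1 / d) *\<^sub>R h - (2 * ((x - a) \<bullet> h) / (d * d)) *\<^sub>R (x - a)))) (at x)"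
proof -
  have d: "d \<noteq> 0" using assms by simp
  have two: "(x - a) \<bullet> h + h \<bullet> (x - a) = 2 * ((x - a) \<bullet> h)" for h by (simp add: inner_commute)
  have "((\<lambda>x. ((1 - a \<bullet> a) * inverse ((x - a) \<bullet> (x - a))) *\<^sub>R (x - a) - a) has_derivative
      (\<lambda>h. ((1 - a \<bullet> a) * inverse d) *\<^sub>R h + ((1 - a \<bullet> a) * - (inverse d * (2 * ((x - a) \<bullet> h)) * inverse d)) *\<^sub>R (x - a))) (at x)"
    using assms(1) by (auto intro!: derivative_eq_intros simp: d_def two)
  moreover have "(\<lambda>x. ((1 - a \<bullet> a) * inverse ((x - a) \<bullet> (x - a))) *\<^sub>R (x - a) - a) = mobius a"
    by (simp add: fun_eq_iff mobius_def mobius_factor_def divide_inverse)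
  moreover have "(\<lambda>h. ((1 - a \<bullet> a) * inverse d) *\<^sub>R h + ((1 - a \<bullet> a) * - (inverse d * (2 * ((x - a) \<bullet> h)) * inverse d)) *\<^sub>R (x - a))
    = (\<lambda>h. (1 - a \<bullet> a) *\<^sub>R ((1 / d) *\<^sub>R h - (2 * ((x - a) \<bullet> h) / (d * d)) *\<^sub>R (x - a)))"
    by (simp add: fun_eq_iff divide_inverse algebra_simps)
  ultimately show ?thesis by simp
qed

text \<open>With \<open>z = x - a\<close>, the derivative is \<open>mobius_factor a x\<close> times
  the reflection in the hyperplane orthogonal to \<open>z\<close>, and a reflection is an
  isometry.\<close>

lemma mobius_conformal:
  fixes a x :: "'a::real_inner"
  assumes "x \<noteq> a"
  shows "frechet_derivative (mobius a) (at x) h \<bullet> frechet_derivative (mobius a) (at x) k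
    = (mobius_factor a x)\<^sup>2 * (h \<bullet> k)"
proof -
  define z d where "z = x - a" and "d = z \<bullet> z"
  have d: "d \<noteq> 0" using assms by (simp add: z_def d_def)
  have "frechet_derivative (mobius a) (at x)
      = (\<lambda>h. (1 - a \<bullet> a) *\<^sub>R ((1 / d) *\<^sub>R h - (2 * (z \<bullet> h) / (d * d)) *\<^sub>R z))"
    using frechet_derivative_at[OF mobius_has_derivative[OF assms]] by (simp add: z_def d_def)
  then have "frechet_derivative (mobius a) (at x) h \<bullet> frechet_derivative (mobius a) (at x) k
      = (1 - a \<bullet> a)\<^sup>2 * (((1 / d) *\<^sub>R h - (2 * (z \<bullet> h) / (d * d)) *\<^sub>R z) \<bullet> ((1 / d) *\<^sub>R k - (2 * (z \<bullet> k) / (d * d)) *\<^sub>R z))"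
    by (simp add: power2_eq_square)
  also have "((1 / d) *\<^sub>R h - (2 * (z \<bullet> h) / (d * d)) *\<^sub>R z) \<bullet> ((1 / d) *\<^sub>R k - (2 * (z \<bullet> k) / (d * d)) *\<^sub>R z)
      = (h \<bullet> k) / (d * d) - 4 * (z \<bullet> h) * (z \<bullet> k) / (d * d * d) + 4 * (z \<bullet> h) * (z \<bullet> k) / (d * d * (d * d)) * d"
    by (simp add: inner_diff_left inner_diff_right inner_commute d_def)
  also have "\<dots> = (h \<bullet> k) / (d * d)" using d by (simp add: field_simps)
  finally show ?thesis by (simp add: mobius_factor_def z_def d_def power2_eq_square)
qed

lemma smooth_on_mobius_factor:
  fixes a :: "real^'m::finite"
  shows "smooth_on (- {a}) (mobius_factor a)"
  unfolding mobius_factor_def[abs_def]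
  by (intro smooth_on_divide smooth_on_inner smooth_on_diff smooth_on_ident smooth_on_const) auto

lemma smooth_on_mobius:
  fixes a :: "real^'m::finite"
  shows "smooth_on (- {a}) (mobius a)"
  unfolding mobius_def[abs_def]
  by (intro smooth_on_diff smooth_on_scaleR smooth_on_mobius_factor smooth_on_ident smooth_on_const) auto

section \<open>Moebius maps as conformal diffeomorphisms of the sphere\<close>

context
  fixes a :: "real^('n::finite option)"
  assumes a: "norm a < 1"
begin

lemma sphere_subset_Compl: "sphere 0 1 \<subseteq> - {a}"
  using a by auto

lemma mobius_sphere: "mobius a ` sphere 0 1 \<subseteq> sphere 0 1"
  using norm_mobius[OF a] by auto

text \<open>The derivative of the composite stays injective because \<open>mobius a\<close> scales
  lengths by a positive factor, and the composite stays injective because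
  \<open>mobius (- a)\<close> inverts \<open>mobius a\<close> on the sphere.\<close>

lemma mobius_chart:
  assumes c: "(V, \<psi>) \<in> sphere_atlas"
  shows "(V, mobius a \<circ> \<psi>) \<in> sphere_atlas"
    and "y \<in> V \<Longrightarrow> frechet_derivative (mobius a \<circ> \<psi>) (at y) v = frechet_derivative (mobius a) (at (\<psi> y)) (frechet_derivative \<psi> (at y) v)"
proof -
  have V: "open V" "inj_on \<psi> V" "\<psi> ` V \<subseteq> sphere 0 1" "smooth_on V \<psi>" "\<And>y. y \<in> V \<Longrightarrow> inj (frechet_derivative \<psi> (at y))"
    using c by (auto simp: sphere_atlas_iff)
  have ne: "\<psi> y \<noteq> a" if "y \<in> V" for y using V(3) sphere_subset_Compl that by blast
  have sm: "smooth_on V (mobius a \<circ> \<psi>)" unfolding comp_def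
    by (rule smooth_on_compose[OF V(1) _ V(4) smooth_on_mobius[of a]]) (use ne in auto)
  have der: "frechet_derivative (mobius a \<circ> \<psi>) (at y) v = frechet_derivative (mobius a) (at (\<psi> y)) (frechet_derivative \<psi> (at y) v)"
    if "y \<in> V" for y v
    unfolding comp_def
    by (rule frechet_derivative_compose_apply[OF smooth_on_differentiable[OF V(4) that]])
      (rule smooth_on_differentiable[OF smooth_on_mobius], use ne[OF that] in simp)
  then show "y \<in> V \<Longrightarrow> frechet_derivative (mobius a \<circ> \<psi>) (at y) v = frechet_derivative (mobius a) (at (\<psi> y)) (frechet_derivative \<psi> (at y) v)" .
  have "inj (frechet_derivative (mobius a \<circ> \<psi>) (at y))" if y: "y \<in> V" for y
  proof -
    have l: "linear (frechet_derivative (mobius a \<circ> \<psi>) (at y))" "linear (frechet_derivative \<psi> (at y))"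
      using smooth_on_differentiable[OF sm y] smooth_on_differentiable[OF V(4) y] linear_frechet_derivative by blast+
    have "v = 0" if "frechet_derivative (mobius a \<circ> \<psi>) (at y) v = 0" for v
    proof -
      have "(mobius_factor a (\<psi> y))\<^sup>2 * (frechet_derivative \<psi> (at y) v \<bullet> frechet_derivative \<psi> (at y) v) = 0"
        using that mobius_conformal[OF ne[OF y], of "frechet_derivative \<psi> (at y) v" "frechet_derivative \<psi> (at y) v"]
        by (simp add: der[OF y])
      moreover have "mobius_factor a (\<psi> y) > 0" using V(3) y by (intro mobius_factor_pos[OF a]) auto
      ultimately have "frechet_derivative \<psi> (at y) v = 0" by simp
      then show "v = 0" using V(5)[OF y] linear_injective_0[OF l(2)] by blast
    qed
    then show ?thesis using linear_injective_0[OF l(1)] by blast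
  qed
  moreover have "inj_on (mobius a \<circ> \<psi>) V"
  proof (rule inj_onI)
    fix y z assume yz: "y \<in> V" "z \<in> V" "(mobius a \<circ> \<psi>) y = (mobius a \<circ> \<psi>) z"
    then have "norm (\<psi> y) = 1" "norm (\<psi> z) = 1" using V(3) by auto
    then have "\<psi> y = \<psi> z" using mobius_mobius[OF a] yz(3) by (metis comp_apply)
    then show "y = z" using V(2) yz by (auto dest: inj_onD)
  qed
  moreover have "(mobius a \<circ> \<psi>) ` V \<subseteq> sphere 0 1" using V(3) mobius_sphere by auto
  ultimately show "(V, mobius a \<circ> \<psi>) \<in> sphere_atlas" using V(1) sm by (simp add: sphere_atlas_iff)
qed

lemma mobius_Upsilon_Cinf: "(\<lambda>x. ln (mobius_factor a x)) \<in> Cinf (sphere_atlas :: ('n, real^('n option)) atlas)"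
proof (rule CinfI)
  fix V and \<psi> :: "real^'n \<Rightarrow> real^('n option)" assume c: "(V, \<psi>) \<in> sphere_atlas"
  then have V: "open V" "\<psi> ` V \<subseteq> sphere 0 1" "smooth_on V \<psi>" by (auto simp: sphere_atlas_iff)
  have "smooth_on V (\<lambda>y. mobius_factor a (\<psi> y))"
    by (rule smooth_on_compose[OF V(1) _ V(3) smooth_on_mobius_factor[of a]]) (use V(2) sphere_subset_Compl in auto)
  then show "smooth_on V (\<lambda>y. ln (mobius_factor a (\<psi> y)))"
    using V(2) by (intro smooth_on_ln V mobius_factor_pos[OF a]) auto
qed

lemma mobius_Cinf:
  assumes "u \<in> Cinf (sphere_atlas :: ('n, real^('n option)) atlas)"
  shows "(\<lambda>x. u (mobius a x)) \<in> Cinf (sphere_atlas :: ('n, real^('n option)) atlas)"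
  by (rule CinfI) (use Cinf_chart[OF assms mobius_chart(1)] in simp)

lemma round_metric_mobius:
  assumes c: "(V, \<psi>) \<in> sphere_atlas" and y: "y \<in> V"
  shows "conf_metric (\<lambda>x. ln (mobius_factor a x)) round_metric (V, \<psi>) y = round_metric (V, mobius a \<circ> \<psi>) y"
proof -
  have n: "norm (\<psi> y) = 1" and ne: "\<psi> y \<noteq> a" using c y a by (auto simp: sphere_atlas_iff)
  have "exp (2 * ln (mobius_factor a (\<psi> y))) = (mobius_factor a (\<psi> y))\<^sup>2"
    using mobius_factor_pos[OF a n] by (simp add: exp_double)
  then show ?thesis
    by (simp add: vec_eq_iff conf_metric_def round_metric_nth partial_def mobius_chart(2)[OF c y] mobius_conformal[OF ne])
qed

end

text \<open>The inverse of \<open>mobius a\<close> formed with \<open>inv_into\<close> agrees with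
  \<open>mobius (- a)\<close> only on the sphere, so chart maps have to be exchangeable when they
  agree on \<open>V\<close>.\<close>

lemma sphere_atlas_cong:
  assumes "(V, \<psi>) \<in> sphere_atlas" "\<And>y. y \<in> V \<Longrightarrow> \<psi>' y = \<psi> y"
  shows "(V, \<psi>') \<in> sphere_atlas"
proof -
  have V: "open V" using assms(1) by (simp add: sphere_atlas_iff)
  moreover have "smooth_on V \<psi>' \<longleftrightarrow> smooth_on V \<psi>" by (rule smooth_on_cong[OF V assms(2)])
  moreover have "frechet_derivative \<psi>' (at y) = frechet_derivative \<psi> (at y)" if "y \<in> V" for y
    by (rule frechet_derivative_cong_open[OF V that assms(2)])
  moreover have "inj_on \<psi>' V \<longleftrightarrow> inj_on \<psi> V" "\<psi>' ` V = \<psi> ` V"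
    using assms(2) by (simp_all cong: inj_on_cong image_cong)
  ultimately show ?thesis using assms(1) by (simp add: sphere_atlas_iff)
qed

lemma smooth_map_sphereI:
  fixes \<Phi> :: "real^('n::finite option) \<Rightarrow> real^('n option)"
  assumes "\<Phi> ` sphere 0 1 \<subseteq> sphere 0 1"
    "\<And>V (\<psi> :: real^'n \<Rightarrow> _). (V, \<psi>) \<in> sphere_atlas \<Longrightarrow> (V, \<Phi> \<circ> \<psi>) \<in> sphere_atlas"
  shows "smooth_map (sphere_atlas :: ('n, real^('n option)) atlas) \<Phi>"
  unfolding smooth_map_def using assms sphere_smooth_transition by fastforce

lemma mobius_diffeo:
  fixes a :: "real^('n::finite option)"
  assumes a: "norm a < 1"
  shows "diffeo (sphere_atlas :: ('n, real^('n option)) atlas) (mobius a)"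
proof -
  let ?S = "sphere 0 1 :: (real^('n option)) set"
  have a': "norm (- a) < 1" using a by simp
  have inv: "mobius (- a) (mobius a x) = x" "mobius a (mobius (- a) x) = x" if "x \<in> ?S" for x
    using mobius_mobius[OF a, of x] mobius_mobius[OF a', of x] that by simp_all
  have bij: "bij_betw (mobius a) ?S ?S"
    by (rule bij_betw_byWitness[where f' = "mobius (- a)"]) (use inv mobius_sphere[OF a] mobius_sphere[OF a'] in auto)
  have "inv_into ?S (mobius a) x = mobius (- a) x" if "x \<in> ?S" for x
  proof (rule inv_into_f_eq)
    show "inj_on (mobius a) ?S" using bij by (simp add: bij_betw_def)
    show "mobius (- a) x \<in> ?S" using mobius_sphere[OF a'] that by blast
  qed (rule inv(2)[OF that])
  note inv_eq = this
  have "smooth_map (sphere_atlas :: ('n, real^('n option)) atlas) (mobius a)"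
    by (rule smooth_map_sphereI[OF mobius_sphere[OF a] mobius_chart(1)[OF a]])
  moreover have "smooth_map (sphere_atlas :: ('n, real^('n option)) atlas) (inv_into ?S (mobius a))"
  proof (rule smooth_map_sphereI)
    show "inv_into ?S (mobius a) ` ?S \<subseteq> ?S" using inv_eq mobius_sphere[OF a'] by auto
    fix V and \<psi> :: "real^'n \<Rightarrow> real^('n option)" assume c: "(V, \<psi>) \<in> sphere_atlas"
    have "inv_into ?S (mobius a) (\<psi> y) = mobius (- a) (\<psi> y)" if "y \<in> V" for y
      using c that by (intro inv_eq) (auto simp: sphere_atlas_iff)
    then show "(V, inv_into ?S (mobius a) \<circ> \<psi>) \<in> sphere_atlas"
      by (intro sphere_atlas_cong[OF mobius_chart(1)[OF a' c]]) simp
  qed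
  ultimately show ?thesis using bij by (simp add: diffeo_def)
qed

lemma mobius_in_Conf_group:
  fixes a :: "real^('n::finite option)"
  assumes a: "norm a < 1"
  shows "mobius a \<in> Conf_group (sphere_atlas :: ('n, real^('n option)) atlas) round_metric"
  unfolding Conf_group_def mem_Collect_eq
proof (intro conjI bexI)
  show "diffeo (sphere_atlas :: ('n, real^('n option)) atlas) (mobius a)" by (rule mobius_diffeo[OF a])
  show "(\<lambda>x. ln (mobius_factor a x)) \<in> Cinf (sphere_atlas :: ('n, real^('n option)) atlas)"
    by (rule mobius_Upsilon_Cinf[OF a])
  show "\<forall>(V, \<psi>)\<in>sphere_atlas. \<forall>y\<in>V. pullback_metric (mobius a) round_metric (V, \<psi> :: real^'n \<Rightarrow> _) y
      = conf_metric (\<lambda>x. ln (mobius_factor a x)) round_metric (V, \<psi>) y"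
    using round_metric_mobius[OF a] by (auto simp: pullback_metric_def)
qed

section \<open>Continuous densities and the Jacobian\<close>

lemma AE_dV_sphere_continuous:
  fixes h :: "real^('n::finite option) \<Rightarrow> real" and g :: "('n, real^('n option)) metric"
  assumes g: "riemannian_manifold sphere_atlas g" and h: "continuous_on (sphere 0 1) h"
    and ae: "AE x in dV sphere_atlas g. h x = 0" and p: "p \<in> sphere 0 1"
  shows "h p = 0"
proof (rule ccontr)
  assume ne: "h p \<noteq> 0"
  define W where "W = sphere 0 1 \<inter> h -` (- {0})"
  have W: "openin (top_of_set (sphere 0 1)) W" unfolding W_def
    by (rule continuous_openin_preimage_gen[OF h]) auto
  have W_eq: "{x \<in> space (dV sphere_atlas g). \<not> h x = 0} = W"
    by (auto simp: W_def sets_dV_sphere(2)[OF g])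
  obtain U where "open U" "W = sphere 0 1 \<inter> U" using W unfolding openin_open by blast
  then have W_sets: "W \<in> sets (dV sphere_atlas g)"
    unfolding sets_dV_sphere(1)[OF g] sets_restrict_space by (intro image_eqI[of W _ U] borel_open)
  have "emeasure (dV sphere_atlas g) W = 0" using AE_iff_measurable[OF W_sets W_eq] ae by simp
  moreover have "emeasure (dV sphere_atlas g) W > 0"
    by (rule dV_sphere_open_pos[OF g W, of p]) (use ne p in \<open>simp add: W_def\<close>)
  ultimately show False by simp
qed

lemma integral_dV_sphere_pos:
  fixes f :: "real^('n::finite option) \<Rightarrow> real" and g :: "('n, real^('n option)) metric"
  assumes g: "riemannian_manifold sphere_atlas g" and f: "continuous_on (sphere 0 1) f"
    "\<And>x. x \<in> sphere 0 1 \<Longrightarrow> f x \<ge> 0" and p: "p \<in> sphere 0 1" "f p \<noteq> 0"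
  shows "(LINT x|dV sphere_atlas g. f x) > 0"
proof -
  have nonneg: "AE x in dV sphere_atlas g. f x \<ge> 0"
    using f(2) by (intro AE_I2) (simp only: sets_dV_sphere(2)[OF g])
  have "(LINT x|dV sphere_atlas g. f x) \<noteq> 0"
    using integral_nonneg_eq_0_iff_AE[OF integrable_dV_sphere[OF g f(1)] nonneg]
      AE_dV_sphere_continuous[OF g f(1) _ p(1)] p(2) by blast
  then show ?thesis using integral_nonneg_AE[OF nonneg] by simp
qed

lemma density_eq_imp_eq:
  fixes J J' :: "real^('n::finite option) \<Rightarrow> real" and g :: "('n, real^('n option)) metric"
  assumes g: "riemannian_manifold sphere_atlas g"
    and J: "continuous_on (sphere 0 1) J" "continuous_on (sphere 0 1) J'"
      "\<And>x. x \<in> sphere 0 1 \<Longrightarrow> J x > 0" "\<And>x. x \<in> sphere 0 1 \<Longrightarrow> J' x > 0"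
    and eq: "density (dV sphere_atlas g) (\<lambda>x. ennreal (J x)) = density (dV sphere_atlas g) (\<lambda>x. ennreal (J' x))"
    and p: "p \<in> sphere 0 1"
  shows "J p = J' p"
proof (rule ccontr)
  assume ne: "J p \<noteq> J' p"
  interpret finite_measure "dV sphere_atlas g" by (rule finite_measure_dV_sphere[OF g])
  have meas: "f \<in> borel_measurable (dV sphere_atlas g)" if "continuous_on (sphere 0 1) f" for f :: "_ \<Rightarrow> real"
    using measurable_sphere_continuous[OF that] measurable_cong_sets[OF sets_dV_sphere(1)[OF g] refl] by blast
  have "AE x in dV sphere_atlas g. ennreal (J x) = ennreal (J' x)"
    using density_unique[OF _ _ eq] meas[OF J(1)] meas[OF J(2)] by simp
  then have ae: "AE x in dV sphere_atlas g. \<not> J x \<noteq> J' x"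
  proof (rule AE_mp, intro AE_I2 impI)
    fix x assume "x \<in> space (dV sphere_atlas g)" "ennreal (J x) = ennreal (J' x)"
    then show "\<not> J x \<noteq> J' x" using J(3,4)[of x] sets_dV_sphere(2)[OF g] by (simp add: ennreal_inj less_imp_le)
  qed
  then have "AE x in dV sphere_atlas g. J x - J' x = 0" by eventually_elim simp
  from AE_dV_sphere_continuous[OF g _ this p] show False
    using J(1,2) ne by (simp add: continuous_on_diff)
qed

text \<open>\<open>jacobian\<close> is a choice among smooth positive densities. The n-th power of
  the conformal factor is one of them, and continuous densities of the same measure agree at every
  point of the sphere because nonempty open sets have positive volume.\<close>

lemma jacobian_mobius:
  fixes a p :: "real^('n::finite option)"
  assumes a: "norm a < 1" and p: "p \<in> sphere 0 1"
  shows "jacobian (sphere_atlas :: ('n, real^('n option)) atlas) round_metric (mobius a) p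
    = exp (real CARD('n) * ln (mobius_factor a p))"
proof -
  let ?A = "sphere_atlas :: ('n, real^('n option)) atlas"
  let ?\<Upsilon> = "\<lambda>x. ln (mobius_factor a x)" and ?g = "round_metric :: ('n, real^('n option)) metric"
  define J where "J x = exp (real CARD('n) * ?\<Upsilon> x)" for x
  have g: "riemannian_manifold ?A ?g" by (rule riemannian_manifold_sphere)
  have U: "?\<Upsilon> \<in> Cinf ?A" by (rule mobius_Upsilon_Cinf[OF a])
  have Um: "?\<Upsilon> \<in> borel_measurable (restrict_space borel (sphere 0 1))"
    by (rule measurable_sphere_continuous[OF continuous_on_sphere_Cinf[OF U]])
  have "is_volume ?A (pullback_metric (mobius a) ?g) = is_volume ?A (conf_metric ?\<Upsilon> ?g)"
    by (rule ext, rule is_volume_cong) (simp add: pullback_metric_def round_metric_mobius[OF a])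
  then have "dV ?A (pullback_metric (mobius a) ?g) = dV ?A (conf_metric ?\<Upsilon> ?g)" unfolding dV_eq by simp
  then have J_dens: "dV ?A (pullback_metric (mobius a) ?g) = density (dV ?A ?g) (\<lambda>x. ennreal (J x))"
    unfolding J_def using dV_conf_metric[OF g U Um] by simp
  have J_Cinf: "J \<in> Cinf ?A"
  proof (rule CinfI)
    fix V and \<psi> :: "real^'n \<Rightarrow> real^('n option)" assume c: "(V, \<psi>) \<in> ?A"
    then show "smooth_on V (\<lambda>y. J (\<psi> y))" unfolding J_def using Cinf_chart[OF U c]
      by (intro smooth_on_exp smooth_on_mult smooth_on_const) (auto simp: sphere_atlas_iff)
  qed
  let ?P = "\<lambda>J. J \<in> Cinf ?A \<and> (\<forall>x\<in>carrier ?A. J x > 0) \<and>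
     dV ?A (pullback_metric (mobius a) ?g) = density (dV ?A ?g) (\<lambda>x. ennreal (J x))"
  have PJ: "?P J" using J_Cinf J_dens by (simp add: J_def)
  define K where "K = jacobian ?A ?g (mobius a)"
  have PK: "?P K" unfolding K_def jacobian_def by (rule someI[of ?P, OF PJ])
  have "K p = J p"
  proof (rule density_eq_imp_eq[OF g _ _ _ _ _ p])
    show "density (dV ?A ?g) (\<lambda>x. ennreal (K x)) = density (dV ?A ?g) (\<lambda>x. ennreal (J x))" using PK PJ by metis
  qed (use PK PJ continuous_on_sphere_Cinf in auto)
  then show ?thesis by (simp add: K_def J_def)
qed

section \<open>The centre of mass can be moved to the origin\<close>

lemma norm_mobius_cball:
  assumes "norm a \<le> 1" "norm x = 1"
  shows "norm (mobius a x) = 1"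
  using assms norm_mobius[of a x] mobius_boundary[of a x] by (cases "norm a = 1") auto

lemma mobius_tendsto:
  assumes "a \<longlonglongrightarrow> l" "x \<noteq> l"
  shows "(\<lambda>i. mobius (a i) x) \<longlonglongrightarrow> mobius l x"
  unfolding mobius_def mobius_factor_def using assms by (auto intro!: tendsto_intros)

text \<open>The parameter \<open>a\<close> ranges over the closed ball, on whose boundary
  \<open>mobius a\<close> degenerates to the constant \<open>- a\<close>, so that the weighted
  centre is \<open>G a = - m *\<^sub>R a\<close> there. If \<open>G\<close> had no zero, its
  normalisation would map the ball to the boundary sphere; a fixed point supplied by Brouwer's
  theorem would lie on the boundary and satisfy \<open>a = - a\<close>. The zero obtained is
  interior, since \<open>G\<close> does not vanish on the boundary.\<close>

lemma hersch:
  fixes g :: "('n::finite, real^('n option)) metric" and f :: "real^('n option) \<Rightarrow> real"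
  assumes g: "riemannian_manifold sphere_atlas g"
    and f: "continuous_on (sphere 0 1) f" "\<And>x. x \<in> sphere 0 1 \<Longrightarrow> f x \<ge> 0" "(LINT x|dV sphere_atlas g. f x) > 0"
  obtains a where "norm a < 1" "\<And>i. (LINT x|dV sphere_atlas g. f x * mobius a x $ i) = 0"
proof -
  let ?M = "dV sphere_atlas g" and ?B = "cball 0 1 :: (real^('n option)) set"
  define m where "m = (LINT x|?M. f x)"
  define G where "G a = (LINT x|?M. f x *\<^sub>R mobius a x)" for a
  have m: "m > 0" using f(3) by (simp add: m_def)
  have space: "space ?M = sphere 0 1" by (rule sets_dV_sphere(2)[OF g])
  have int_f: "integrable ?M f" by (rule integrable_dV_sphere[OF g f(1)])
  have meas: "(\<lambda>x. f x *\<^sub>R mobius a x) \<in> borel_measurable ?M" for a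
  proof -
    have "(mobius a) \<in> borel_measurable borel" unfolding mobius_def[abs_def] mobius_factor_def by measurable
    then have "mobius a \<in> borel_measurable (restrict_space borel (sphere 0 1))" by (rule measurable_restrict_space1)
    then have "(\<lambda>x. f x *\<^sub>R mobius a x) \<in> borel_measurable (restrict_space borel (sphere 0 1))"
      using measurable_sphere_continuous[OF f(1)] by measurable
    then show ?thesis using measurable_cong_sets[OF sets_dV_sphere(1)[OF g] refl] by blast
  qed
  have G_bd: "G a = - m *\<^sub>R a" if "norm a = 1" for a
    using that int_f by (simp add: G_def m_def mobius_boundary)
  have cont: "continuous_on ?B G"
    unfolding continuous_on_sequentially
  proof (intro allI ballI impI)
    fix s a assume a: "a \<in> ?B" and s: "(\<forall>i. s i \<in> ?B) \<and> s \<longlonglongrightarrow> a"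
    have "(\<lambda>i. LINT x|?M. f x *\<^sub>R mobius (s i) x) \<longlonglongrightarrow> (LINT x|?M. f x *\<^sub>R mobius a x)"
    proof (rule integral_dominated_convergence[where w = f])
      \<comment> \<open>Convergence can fail only at \<open>x = a\<close> with \<open>a\<close> on
        the boundary: along the radius through \<open>a\<close> the maps keep the value
        \<open>a\<close> there, not the limit value \<open>- a\<close>. A single point is
        null.\<close>
      show "AE x in ?M. (\<lambda>i. f x *\<^sub>R mobius (s i) x) \<longlonglongrightarrow> f x *\<^sub>R mobius a x"
        using dV_sphere_point[OF g, of a]
        by eventually_elim (use s in \<open>auto intro!: tendsto_scaleR mobius_tendsto\<close>)
      show "AE x in ?M. norm (f x *\<^sub>R mobius (s i) x) \<le> f x" for i
      proof (rule AE_I2)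
        fix x assume "x \<in> space ?M"
        then have "norm x = 1" "f x \<ge> 0" using f(2)[of x] by (simp_all add: space)
        moreover have "norm (s i) \<le> 1" using s by auto
        ultimately show "norm (f x *\<^sub>R mobius (s i) x) \<le> f x" by (simp add: norm_mobius_cball)
      qed
    qed (use meas int_f in auto)
    then show "(G \<circ> s) \<longlonglongrightarrow> G a" by (simp add: G_def comp_def)
  qed
  have "\<exists>a\<in>?B. G a = 0"
  proof (rule ccontr)
    assume "\<not> (\<exists>a\<in>?B. G a = 0)"
    then have nz: "G a \<noteq> 0" if "a \<in> ?B" for a using that by blast
    define H where "H a = (1 / norm (G a)) *\<^sub>R G a" for a
    have nH: "norm (H a) = 1" if "a \<in> ?B" for a using nz[OF that] by (simp add: H_def)
    have "continuous_on ?B H" unfolding H_def using cont nz by (intro continuous_intros) auto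
    moreover have "H \<in> ?B \<rightarrow> ?B" using nH by auto
    ultimately obtain a where a: "a \<in> ?B" "H a = a"
      using brouwer[OF compact_cball convex_cball, of 0 1 H] by (metis cball_eq_empty not_one_less_zero)
    then have na: "norm a = 1" using nH by metis
    then have "H a = - a" using m by (simp add: H_def G_bd)
    with a(2) have "a = 0" by (metis eq_neg_iff_add_eq_0 scaleR_2 scaleR_eq_0_iff zero_neq_numeral)
    with na show False by simp
  qed
  then obtain a where a: "a \<in> ?B" "G a = 0" by blast
  have "norm a \<noteq> 1"
  proof
    assume na: "norm a = 1"
    then have "m *\<^sub>R a = 0" using G_bd[OF na] a(2) by simp
    then show False using m na by auto
  qed
  have "(LINT x|?M. f x * mobius a x $ i) = 0" for i
  proof -
    have "integrable ?M (\<lambda>x. f x *\<^sub>R mobius a x)"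
    proof (rule Bochner_Integration.integrable_bound[OF int_f meas], rule AE_I2)
      fix x assume "x \<in> space ?M"
      then have "norm x = 1" by (simp add: space)
      then show "norm (f x *\<^sub>R mobius a x) \<le> norm (f x)" using a(1) by (simp add: norm_mobius_cball)
    qed
    from integral_bounded_linear[OF bounded_linear_vec_nth[of i] this]
    show ?thesis using a(2) by (simp add: G_def)
  qed
  then show thesis using that[of a] a(1) \<open>norm a \<noteq> 1\<close> by simp
qed

section \<open>The second variation\<close>

text \<open>Linearity is assumed in the head only. One copy of the sum is expanded at the head, the
  resulting \<open>u\<close> or \<open>v\<close> is moved by symmetry behind the remaining copies
  into the tail \<open>zs\<close>, which is why the induction generalises \<open>zs\<close>, and
  Pascal's rule joins the two expansions. Used for the constraint operators at a fixed point and for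
  the Dirichlet form.\<close>

lemma symmetric_multilinear_binomial:
  fixes M :: "('p \<Rightarrow> real) list \<Rightarrow> real"
  assumes sym: "\<And>xs ys. set xs \<subseteq> X \<Longrightarrow> length xs = N \<Longrightarrow> mset ys = mset xs \<Longrightarrow> M ys = M xs"
    and lin: "\<And>u v t zs. u \<in> X \<Longrightarrow> v \<in> X \<Longrightarrow> set zs \<subseteq> X \<Longrightarrow> Suc (length zs) = N \<Longrightarrow>
      M ((\<lambda>q. u q + t * v q) # zs) = M (u # zs) + t * M (v # zs)"
    and closed: "\<And>u v t. u \<in> X \<Longrightarrow> v \<in> X \<Longrightarrow> (\<lambda>q. u q + t * v q) \<in> X"
    and uv: "u \<in> X" "v \<in> X"
  shows "j + length zs = N \<Longrightarrow> set zs \<subseteq> X \<Longrightarrow> M (replicate j (\<lambda>q. u q + t * v q) @ zs)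
    = (\<Sum>i\<le>j. real (j choose i) * t ^ i * M (replicate i v @ replicate (j - i) u @ zs))"
proof (induction j arbitrary: zs)
  case (Suc j)
  define x where "x = (\<lambda>q. u q + t * v q)"
  define a where "a i = M (replicate i v @ replicate (Suc j - i) u @ zs)" for i
  have x: "x \<in> X" using closed uv by (simp add: x_def)
  have repl: "set (replicate i w) \<subseteq> X" if "w \<in> X" for i w using that by (auto dest: in_set_replicate[THEN iffD1])
  have perm: "M (x # replicate j x @ zs) = M (u # replicate j x @ zs) + t * M (v # replicate j x @ zs)"
    using Suc.prems x repl unfolding x_def[symmetric] by (subst (1) x_def, intro lin uv) auto
  have "M (w # replicate j x @ zs) = M (replicate j x @ w # zs)" if "w \<in> X" for w
    using Suc.prems x repl that by (intro sym) auto
  then have "M (replicate (Suc j) x @ zs) = M (replicate j x @ u # zs) + t * M (replicate j x @ v # zs)"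
    using perm uv by simp
  also have "M (replicate j x @ u # zs) = (\<Sum>i\<le>j. real (j choose i) * t ^ i * a i)"
    unfolding x_def Suc.IH[of "u # zs", simplified, OF Suc.prems(1)[simplified] conjI[OF uv(1) Suc.prems(2)]]
  proof (rule sum.cong[OF refl])
    fix i assume "i \<in> {..j}"
    then have "M (replicate i v @ replicate (j - i) u @ u # zs) = a i"
      unfolding a_def using Suc.prems repl uv
      by (intro sym) (auto simp: Suc_diff_le)
    then show "real (j choose i) * t ^ i * M (replicate i v @ replicate (j - i) u @ u # zs) = real (j choose i) * t ^ i * a i"
      by simp
  qed
  also have "M (replicate j x @ v # zs) = (\<Sum>i\<le>j. real (j choose i) * t ^ i * a (Suc i))"
    unfolding x_def Suc.IH[of "v # zs", simplified, OF Suc.prems(1)[simplified] conjI[OF uv(2) Suc.prems(2)]]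
  proof (rule sum.cong[OF refl])
    fix i assume "i \<in> {..j}"
    then have "M (replicate i v @ replicate (j - i) u @ v # zs) = a (Suc i)"
      unfolding a_def using Suc.prems repl uv
      by (intro sym) (auto simp: Suc_diff_le)
    then show "real (j choose i) * t ^ i * M (replicate i v @ replicate (j - i) u @ v # zs) = real (j choose i) * t ^ i * a (Suc i)"
      by simp
  qed
  also have "(\<Sum>i\<le>j. real (j choose i) * t ^ i * a i) = (\<Sum>i\<le>Suc j. real (j choose i) * t ^ i * a i)" by simp
  also have "\<dots> = a 0 + (\<Sum>i\<le>j. real (j choose Suc i) * t ^ Suc i * a (Suc i))"
    by (subst sum.atMost_Suc_shift) simp
  also have "a 0 + (\<Sum>i\<le>j. real (j choose Suc i) * t ^ Suc i * a (Suc i)) + t * (\<Sum>i\<le>j. real (j choose i) * t ^ i * a (Suc i))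
    = a 0 + (\<Sum>i\<le>j. real (Suc j choose Suc i) * t ^ Suc i * a (Suc i))"
    by (simp add: sum_distrib_left sum.distrib algebra_simps)
  also have "\<dots> = (\<Sum>i\<le>Suc j. real (Suc j choose i) * t ^ i * a i)"
    by (subst sum.atMost_Suc_shift) simp
  finally show ?case by (simp add: x_def a_def)
qed simp

text \<open>The symmetric difference cancels the odd coefficients. Thus \<open>c 1\<close> may be
  arbitrary, and the quotient isolates \<open>c 2\<close>.\<close>

lemma polynomial_second_difference:
  fixes c :: "nat \<Rightarrow> real" and X :: "nat \<Rightarrow> real"
  assumes X: "X \<longlonglongrightarrow> 0" "\<And>m. X m \<noteq> 0" and r: "r \<ge> 2"
  defines "P \<equiv> \<lambda>t. \<Sum>i\<le>r. c i * t ^ i"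
  shows "(\<lambda>m. (P (X m) + P (- X m) - 2 * c 0) / (X m)\<^sup>2) \<longlonglongrightarrow> 2 * c 2"
proof -
  obtain j where j: "r = Suc (Suc j)" using r by (metis One_nat_def Suc_1 Suc_le_D Suc_le_mono)
  define Q where "Q t = (\<Sum>i\<le>j. c (Suc (Suc i)) * (t ^ i + (- t) ^ i))" for t
  have "P t = c 0 + c 1 * t + t\<^sup>2 * (\<Sum>i\<le>j. c (Suc (Suc i)) * t ^ i)" for t
    unfolding P_def j by (simp only: sum.atMost_Suc_shift)
      (simp add: sum_distrib_left power2_eq_square algebra_simps)
  then have "P t + P (- t) - 2 * c 0 = t\<^sup>2 * Q t" for t
    by (simp add: Q_def distrib_left sum.distrib)
  then have eq: "(P (X m) + P (- X m) - 2 * c 0) / (X m)\<^sup>2 = Q (X m)" for m using X(2) by simp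
  have "isCont Q 0" unfolding Q_def by (intro continuous_intros)
  then have "(\<lambda>m. Q (X m)) \<longlonglongrightarrow> Q 0" using X(1) by (rule isCont_tendsto_compose)
  \<comment> \<open>Only \<open>i = 0\<close> contributes, where \<open>0 ^ 0 = 1\<close> occurs
    twice.\<close>
  moreover have "Q 0 = 2 * c 2"
    unfolding Q_def by (simp add: power_0_left if_distrib numeral_2_eq_2 cong: if_cong)
  ultimately show ?thesis by (simp add: eq)
qed

lemma powr_second_order:
  "((\<lambda>s::real. ((1 + s) powr q - 1 - q * s) / s\<^sup>2) \<longlongrightarrow> q * (q - 1) / 2) (at 0)"
  unfolding filterlim_at_split by (rule conjI; real_asymp)

text \<open>The first-order term integrates to 0 by the balancing hypothesis \<open>fy\<close>. What
  remains is the integral of \<open>f x * ((y x)\<^sup>2 * \<phi> (X m * y x))\<close> with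
  \<open>\<phi>\<close> bounded on [-1/2, 1/2], so dominated convergence applies with a constant
  multiple of \<open>f\<close> as majorant. The bound 1/2 on the steps keeps
  \<open>1 + X m * y x\<close> away from 0.\<close>

lemma second_order_mass:
  fixes g :: "('n::finite, real^('n option)) metric" and f y :: "real^('n option) \<Rightarrow> real"
  assumes g: "riemannian_manifold sphere_atlas g"
    and f: "continuous_on (sphere 0 1) f" "\<And>x. x \<in> sphere 0 1 \<Longrightarrow> f x \<ge> 0"
    and y: "continuous_on (sphere 0 1) y" "\<And>x. x \<in> sphere 0 1 \<Longrightarrow> \<bar>y x\<bar> \<le> 1"
    and fy: "(LINT x|dV sphere_atlas g. f x * y x) = 0" and q: "q > 0"
    and X: "X \<longlonglongrightarrow> 0" "\<And>m. X m \<noteq> 0" "\<And>m. \<bar>X m\<bar> \<le> 1 / 2"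
  defines "N \<equiv> \<lambda>t. LINT x|dV sphere_atlas g. f x * (1 + t * y x) powr q"
  shows "(\<lambda>m. (N (X m) - N 0) / (X m)\<^sup>2) \<longlonglongrightarrow> q * (q - 1) / 2 * (LINT x|dV sphere_atlas g. f x * (y x)\<^sup>2)"
proof -
  let ?M = "dV sphere_atlas g" and ?L = "q * (q - 1) / 2"
  \<comment> \<open>The second-order Taylor quotient with its limit filled in at 0. This makes it
    continuous on a compact interval, hence bounded there, and also covers the points where
    \<open>y x = 0\<close>.\<close>
  define \<phi> where "\<phi> s = (if s = 0 then ?L else ((1 + s) powr q - 1 - q * s) / s\<^sup>2)" for s :: real
  have space: "space ?M = sphere 0 1" by (rule sets_dV_sphere(2)[OF g])
  have int: "integrable ?M h" if "continuous_on (sphere 0 1) h" for h :: "_ \<Rightarrow> real"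
    by (rule integrable_dV_sphere[OF g that])
  have small: "\<bar>X m * y x\<bar> \<le> 1 / 2" if "x \<in> sphere 0 1" for m x
    using mult_mono[OF X(3)[of m] y(2)[OF that]] by (simp add: abs_mult)
  have cont_powr: "continuous_on (sphere 0 1) (\<lambda>x. (1 + X m * y x) powr q)" for m
  proof (intro continuous_on_powr continuous_intros y)
    show "\<forall>x\<in>sphere 0 1. 1 + X m * y x \<noteq> 0" using small[of _ m] by (smt (verit) abs_le_iff field_sum_of_halves)
  qed
  have cont_quot: "continuous_on (sphere 0 1) (\<lambda>x. f x * (((1 + X m * y x) powr q - 1 - q * (X m * y x)) / (X m)\<^sup>2))" for m
    using X(2) by (intro continuous_intros f y cont_powr) auto
  have \<phi>0: "isCont \<phi> 0"
  proof -
    have "(\<phi> \<longlongrightarrow> ?L) (at 0)"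
      by (rule Lim_transform_eventually[OF powr_second_order[of q]])
        (auto simp: \<phi>_def eventually_at_filter)
    then show ?thesis by (simp add: isCont_def \<phi>_def)
  qed
  have "isCont \<phi> s" if "s \<in> {-1/2..1/2}" for s
  proof (cases "s = 0")
    case False
    have "isCont (\<lambda>s. ((1 + s) powr q - 1 - q * s) / s\<^sup>2) s"
      using False that by (intro continuous_intros) auto
    moreover have "open (- {0 :: real})" by (simp add: open_Compl)
    then have "eventually (\<lambda>z. z \<in> - {0}) (nhds s)" using False by (intro eventually_nhds_in_open) auto
    then have "eventually (\<lambda>z. ((1 + z) powr q - 1 - q * z) / z\<^sup>2 = \<phi> z) (nhds s)"
      by eventually_elim (simp add: \<phi>_def)
    ultimately show ?thesis by (simp add: isCont_cong)
  qed (use \<phi>0 in simp)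
  then have "continuous_on {-1/2..1/2} \<phi>" by (rule continuous_at_imp_continuous_on[OF ballI])
  then have "bounded (\<phi> ` {-1/2..1/2})" by (intro compact_imp_bounded compact_continuous_image) auto
  then obtain b where b: "\<And>s. s \<in> {-1/2..1/2} \<Longrightarrow> \<bar>\<phi> s\<bar> \<le> b" unfolding bounded_iff real_norm_def by blast
  have quot: "((1 + X m * y x) powr q - 1 - q * (X m * y x)) / (X m)\<^sup>2 = (y x)\<^sup>2 * \<phi> (X m * y x)" for m x
    using X(2)[of m] by (simp add: \<phi>_def power_mult_distrib)
  have "(N (X m) - N 0) / (X m)\<^sup>2 = (LINT x|?M. f x * (((1 + X m * y x) powr q - 1 - q * (X m * y x)) / (X m)\<^sup>2))" for m
  proof -
    have "(LINT x|?M. f x * (((1 + X m * y x) powr q - 1 - q * (X m * y x)) / (X m)\<^sup>2))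
        = (LINT x|?M. (f x * (1 + X m * y x) powr q - f x - q * X m * (f x * y x)) / (X m)\<^sup>2)"
      by (intro Bochner_Integration.integral_cong refl) (simp add: right_diff_distrib mult.left_commute mult.assoc)
    also have "\<dots> = (LINT x|?M. f x * (1 + X m * y x) powr q - f x - q * X m * (f x * y x)) / (X m)\<^sup>2"
      by (rule integral_divide_zero)
    also have "(LINT x|?M. f x * (1 + X m * y x) powr q - f x - q * X m * (f x * y x)) = N (X m) - N 0"
      using fy by (subst Bochner_Integration.integral_diff, (intro int continuous_intros f y cont_powr)+,
          subst Bochner_Integration.integral_diff) (auto intro!: int continuous_intros f y cont_powr simp: N_def)
    finally show ?thesis by (rule sym)
  qed
  moreover have "(\<lambda>m. LINT x|?M. f x * (((1 + X m * y x) powr q - 1 - q * (X m * y x)) / (X m)\<^sup>2))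
      \<longlonglongrightarrow> (LINT x|?M. f x * ((y x)\<^sup>2 * ?L))"
  proof (rule integral_dominated_convergence[where w = "\<lambda>x. f x * b"])
    show "integrable ?M (\<lambda>x. f x * b)" by (intro int continuous_intros f)
    show "(\<lambda>x. f x * ((y x)\<^sup>2 * ?L)) \<in> borel_measurable ?M"
      by (intro borel_measurable_integrable int continuous_intros f y)
    show "(\<lambda>x. f x * (((1 + X m * y x) powr q - 1 - q * (X m * y x)) / (X m)\<^sup>2)) \<in> borel_measurable ?M" for m
      by (intro borel_measurable_integrable int cont_quot)
    show "AE x in ?M. (\<lambda>m. f x * (((1 + X m * y x) powr q - 1 - q * (X m * y x)) / (X m)\<^sup>2)) \<longlonglongrightarrow> f x * ((y x)\<^sup>2 * ?L)"
    proof (rule AE_I2)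
      fix x
      have "(\<lambda>m. X m * y x) \<longlonglongrightarrow> 0" using tendsto_mult[OF X(1) tendsto_const[of "y x"]] by simp
      then have "(\<lambda>m. \<phi> (X m * y x)) \<longlonglongrightarrow> \<phi> 0" by (rule isCont_tendsto_compose[OF \<phi>0])
      then show "(\<lambda>m. f x * (((1 + X m * y x) powr q - 1 - q * (X m * y x)) / (X m)\<^sup>2)) \<longlonglongrightarrow> f x * ((y x)\<^sup>2 * ?L)"
        unfolding quot by (intro tendsto_mult tendsto_const) (simp add: \<phi>_def[of 0])
    qed
    show "AE x in ?M. norm (f x * (((1 + X m * y x) powr q - 1 - q * (X m * y x)) / (X m)\<^sup>2)) \<le> f x * b" for m
    proof (rule AE_I2)
      fix x assume "x \<in> space ?M"
      then have x: "x \<in> sphere 0 1" by (simp add: space)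
      have "X m * y x \<in> {-1/2..1/2}" using small[OF x, of m] by (auto simp: abs_le_iff)
      then have "\<bar>\<phi> (X m * y x)\<bar> \<le> b" by (rule b)
      moreover have "(y x)\<^sup>2 \<le> 1" using y(2)[OF x] by (simp add: abs_square_le_1)
      ultimately have "(y x)\<^sup>2 * \<bar>\<phi> (X m * y x)\<bar> \<le> 1 * b" by (intro mult_mono) auto
      then show "norm (f x * (((1 + X m * y x) powr q - 1 - q * (X m * y x)) / (X m)\<^sup>2)) \<le> f x * b"
        unfolding quot using f(2)[OF x] by (simp add: abs_mult mult_left_mono)
    qed
  qed
  moreover have "(LINT x|?M. f x * ((y x)\<^sup>2 * ?L)) = ?L * (LINT x|?M. f x * (y x)\<^sup>2)"
    by (subst integral_mult_right_zero[symmetric]) (simp add: ac_simps)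
  ultimately show ?thesis by (simp only:)
qed

text \<open>\<open>P\<close> stands for the Dirichlet form and \<open>N\<close> for the q-th power
  of the norm along a line. After clearing positive denominators, minimality reads
  \<open>P t \<ge> c 0 / E (N 0) * E (N t)\<close> with \<open>E z = z powr (r / q)\<close>,
  whatever the sign of \<open>c 0\<close>. Adding the inequalities for \<open>t\<close> and
  \<open>- t\<close> removes the first-order term of \<open>P\<close>, while that of
  \<open>N\<close> vanishes by balancing. The second-order limits of both sides give the
  conclusion.\<close>

lemma second_variation:
  fixes g :: "('n::finite, real^('n option)) metric" and f y :: "real^('n option) \<Rightarrow> real" and c :: "nat \<Rightarrow> real"
  assumes g: "riemannian_manifold sphere_atlas g"
    and f: "continuous_on (sphere 0 1) f" "\<And>x. x \<in> sphere 0 1 \<Longrightarrow> f x \<ge> 0"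
    and y: "continuous_on (sphere 0 1) y" "\<And>x. x \<in> sphere 0 1 \<Longrightarrow> \<bar>y x\<bar> \<le> 1"
    and fy: "(LINT x|dV sphere_atlas g. f x * y x) = 0" and q: "q > 0" and r: "r \<ge> 2"
  defines "N \<equiv> \<lambda>t. LINT x|dV sphere_atlas g. f x * (1 + t * y x) powr q"
    and "P \<equiv> \<lambda>t. \<Sum>i\<le>r. c i * t ^ i"
  assumes N0: "N 0 > 0"
    and min: "eventually (\<lambda>t. P t / (N t powr (1 / q)) ^ r \<ge> P 0 / (N 0 powr (1 / q)) ^ r) (at 0)"
  shows "2 * c 2 * N 0 \<ge> real r * (q - 1) * c 0 * (LINT x|dV sphere_atlas g. f x * (y x)\<^sup>2)"
proof -
  define m2 where "m2 = (LINT x|dV sphere_atlas g. f x * (y x)\<^sup>2)"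
  define E where "E z = z powr (real r / q)" for z :: real
  \<comment> \<open>A concrete null sequence of nonzero steps; the shift by 2 makes them at most
    \<open>1 / 2\<close>, as \<open>second_order_mass\<close> requires.\<close>
  define X where "X m = 1 / real (m + 2)" for m
  have X: "X \<longlonglongrightarrow> 0" "\<And>m. X m \<noteq> 0" "\<And>m. \<bar>X m\<bar> \<le> 1 / 2"
    unfolding X_def by (real_asymp, auto simp: field_simps)
  have X': "(\<lambda>m. - X m) \<longlonglongrightarrow> 0" "\<And>m. - X m \<noteq> 0" "\<And>m. \<bar>- X m\<bar> \<le> 1 / 2"
    using X tendsto_minus[OF X(1)] by auto
  have P0: "P 0 = c 0" by (simp add: P_def power_0_left if_distrib cong: if_cong)
  have "(E has_real_derivative (real r / q) * N 0 powr (real r / q - 1)) (at (N 0))"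
    unfolding E_def using N0 by (auto intro!: derivative_eq_intros)
  \<comment> \<open>Caratheodory's form of the derivative factors \<open>E z - E (N 0)\<close>
    exactly, so the second-order limit for \<open>N\<close> passes to \<open>E (N t)\<close> as a
    product of limits.\<close>
  then obtain e where e: "\<And>z. E z - E (N 0) = e z * (z - N 0)" "isCont e (N 0)"
    "e (N 0) = (real r / q) * N 0 powr (real r / q - 1)"
    unfolding CARAT_DERIV by blast
  have lim: "(\<lambda>m. (E (N (Y m)) - E (N 0)) / (Y m)\<^sup>2) \<longlonglongrightarrow> e (N 0) * (q * (q - 1) / 2 * m2)"
    and N_lim: "(\<lambda>m. N (Y m)) \<longlonglongrightarrow> N 0"
    if Y: "Y \<longlonglongrightarrow> 0" "\<And>m. Y m \<noteq> 0" "\<And>m. \<bar>Y m\<bar> \<le> 1 / 2" for Y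
  proof -
    have A: "(\<lambda>m. (N (Y m) - N 0) / (Y m)\<^sup>2) \<longlonglongrightarrow> q * (q - 1) / 2 * m2"
      unfolding N_def m2_def by (rule second_order_mass[OF g f y fy q Y])
    have "(\<lambda>m. (N (Y m) - N 0) / (Y m)\<^sup>2 * (Y m)\<^sup>2) \<longlonglongrightarrow> q * (q - 1) / 2 * m2 * 0\<^sup>2"
      by (intro tendsto_mult A tendsto_power Y)
    then have "(\<lambda>m. N (Y m) - N 0) \<longlonglongrightarrow> 0" using Y(2) by simp
    then show NY: "(\<lambda>m. N (Y m)) \<longlonglongrightarrow> N 0" by (rule LIM_zero_cancel)
    have "(\<lambda>m. e (N (Y m)) * ((N (Y m) - N 0) / (Y m)\<^sup>2)) \<longlonglongrightarrow> e (N 0) * (q * (q - 1) / 2 * m2)"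
      by (intro tendsto_mult A isCont_tendsto_compose[OF e(2) NY])
    then show "(\<lambda>m. (E (N (Y m)) - E (N 0)) / (Y m)\<^sup>2) \<longlonglongrightarrow> e (N 0) * (q * (q - 1) / 2 * m2)"
      by (simp add: e(1))
  qed
  have E0: "E (N 0) > 0" using N0 by (simp add: E_def)
  have E_eq: "(z powr (1 / q)) ^ r = E z" if "z > 0" for z
    using that by (simp add: E_def powr_powr flip: powr_realpow)
  have min_Y: "eventually (\<lambda>m. P (Y m) \<ge> c 0 / E (N 0) * E (N (Y m))) sequentially"
    if Y: "Y \<longlonglongrightarrow> 0" "\<And>m. Y m \<noteq> 0" "\<And>m. \<bar>Y m\<bar> \<le> 1 / 2" for Y
  proof -
    have "filterlim Y (at 0) sequentially" using Y by (simp add: filterlim_at)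
    from eventually_compose_filterlim[OF min this] order_tendstoD(1)[OF N_lim[OF Y] N0]
    show ?thesis
    proof eventually_elim
      case (elim m)
      have "E (N (Y m)) > 0" using elim(2) by (simp add: E_def)
      then show ?case using elim E0 by (simp add: E_eq N0 P0 field_simps)
    qed
  qed
  have "(\<lambda>m. (P (X m) + P (- X m) - 2 * c 0) / (X m)\<^sup>2) \<longlonglongrightarrow> 2 * c 2"
    unfolding P_def by (rule polynomial_second_difference[OF X(1,2) r])
  moreover have "(\<lambda>m. c 0 / E (N 0) * ((E (N (X m)) - E (N 0)) / (X m)\<^sup>2 + (E (N (- X m)) - E (N 0)) / (- X m)\<^sup>2))
      \<longlonglongrightarrow> c 0 / E (N 0) * (e (N 0) * (q * (q - 1) / 2 * m2) + e (N 0) * (q * (q - 1) / 2 * m2))"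
    by (intro tendsto_mult tendsto_const tendsto_add lim X X')
  moreover have "eventually (\<lambda>m. c 0 / E (N 0) * ((E (N (X m)) - E (N 0)) / (X m)\<^sup>2 + (E (N (- X m)) - E (N 0)) / (- X m)\<^sup>2)
      \<le> (P (X m) + P (- X m) - 2 * c 0) / (X m)\<^sup>2) sequentially"
    using min_Y[OF X] min_Y[OF X']
  proof eventually_elim
    case (elim m)
    have "c 0 / E (N 0) * (E (N (X m)) + E (N (- X m)) - 2 * E (N 0)) \<le> P (X m) + P (- X m) - 2 * c 0"
      using elim E0 by (simp add: algebra_simps)
    then have "c 0 / E (N 0) * (E (N (X m)) + E (N (- X m)) - 2 * E (N 0)) / (X m)\<^sup>2 \<le> (P (X m) + P (- X m) - 2 * c 0) / (X m)\<^sup>2"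
      by (rule divide_right_mono) simp
    then show ?case by (simp add: algebra_simps add_divide_distrib diff_divide_distrib)
  qed
  ultimately have "c 0 / E (N 0) * (e (N 0) * (q * (q - 1) / 2 * m2) + e (N 0) * (q * (q - 1) / 2 * m2)) \<le> 2 * c 2"
    by (rule tendsto_le[OF trivial_limit_sequentially])
  moreover have e0: "e (N 0) = real r / q * (E (N 0) / N 0)"
    using N0 by (simp add: e(3) E_def powr_diff)
  have "c 0 / E (N 0) * (e (N 0) * (q * (q - 1) / 2 * m2) + e (N 0) * (q * (q - 1) / 2 * m2))
      = c 0 * (real r * (q - 1) * m2 / N 0)"
    unfolding e0 using E0 q N0 by (simp add: field_simps)
  ultimately have "c 0 * (real r * (q - 1) * m2 / N 0) \<le> 2 * c 2" by simp
  then show ?thesis unfolding m2_def[symmetric] using N0 by (simp add: field_simps)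
qed

section \<open>Lines in the space of smooth functions\<close>

lemma partials_linear:
  assumes "open V" "smooth_on V f" "smooth_on V h"
  shows "smooth_on V (partials I f)"
    "y \<in> V \<Longrightarrow> partials I (\<lambda>z. a * f z + b * h z) y = a * partials I f y + b * partials I h y"
proof -
  have sm: "smooth_on V (partials I f)" if "smooth_on V f" for f I
    using that by (induction I) (auto intro: smooth_on_partial)
  show "smooth_on V (partials I f)" using sm assms(2) .
  show "y \<in> V \<Longrightarrow> partials I (\<lambda>z. a * f z + b * h z) y = a * partials I f y + b * partials I h y"
  proof (induction I arbitrary: y)
    case (Cons i I)
    have "partial i (partials I (\<lambda>z. a * f z + b * h z)) y = partial i (\<lambda>z. a * partials I f z + b * partials I h z) y"
      by (rule partial_cong[OF assms(1) Cons.prems Cons.IH])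
    also have "\<dots> = a * partial i (partials I f) y + b * partial i (partials I h) y"
      using sm assms(2,3) Cons.prems by (intro partial_linear smooth_on_differentiable) auto
    finally show ?case by simp
  qed simp
qed

text \<open>By compactness \<open>H t0\<close> has a positive minimum m on a nonempty
  \<open>K\<close>, and for \<open>t\<close> near \<open>t0\<close> the values change by at most m /
  2 uniformly on \<open>K\<close>.\<close>

lemma open_Collect_ball_pos:
  fixes H :: "real \<Rightarrow> 'a::metric_space \<Rightarrow> real"
  assumes K: "compact K" and H: "continuous_on (UNIV \<times> K) (\<lambda>(t, x). H t x)"
  shows "open {t. \<forall>x\<in>K. H t x > 0}"
proof (rule openI)
  fix t0 assume t0: "t0 \<in> {t. \<forall>x\<in>K. H t x > 0}"
  show "\<exists>e>0. ball t0 e \<subseteq> {t. \<forall>x\<in>K. H t x > 0}"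
  proof (cases "K = {}")
    case False
    have "continuous_on K (\<lambda>x. (\<lambda>(t, x). H t x) (t0, x))"
      by (rule continuous_on_compose2[OF H]) (auto intro!: continuous_intros)
    then have "\<exists>x\<in>K. \<forall>z\<in>K. H t0 x \<le> H t0 z"
      using continuous_attains_inf[OF K False, of "H t0"] by simp
    then obtain m where m: "m > 0" "\<And>z. z \<in> K \<Longrightarrow> m \<le> H t0 z" using t0 by blast
    obtain T where T: "t0 \<in> T" "open T" "\<forall>t\<in>T \<inter> UNIV. \<forall>x\<in>K. dist ((\<lambda>(t, x). H t x) (t, x)) ((\<lambda>(t, x). H t x) (t0, x)) \<le> m / 2"
      using continuous_on_prod_compactE[OF H K UNIV_I, of "m / 2"] m(1) by auto
    have "H t x > 0" if "t \<in> T" "x \<in> K" for t x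
    proof -
      have "\<bar>H t x - H t0 x\<bar> \<le> m / 2" using T(3) that by (auto simp: dist_real_def)
      with m(1) m(2)[OF that(2)] show ?thesis by linarith
    qed
    then have "T \<subseteq> {t. \<forall>x\<in>K. H t x > 0}" by blast
    with T(1,2) show ?thesis by (meson open_contains_ball subset_trans)
  qed (auto intro: exI[of _ 1])
qed

text \<open>Along a line every iterated partial derivative in a chart is affine in the parameter, so
  the uniform bounds on compact sets that define the subbasis are open conditions on
  \<open>t\<close>. Local minimality is tested only along such lines.\<close>

lemma continuous_map_line_Cinf_top:
  fixes A :: "('n::finite, 'p) atlas"
  assumes A: "smooth_manifold A" "A \<noteq> {}" and u: "u \<in> Cinf A" and w: "w \<in> Cinf A"
  shows "continuous_map euclideanreal (Cinf_top A) (\<lambda>t q. u q + t * w q)"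
  unfolding Cinf_top_def
proof (rule continuous_on_generated_topo)
  let ?l = "\<lambda>t q. u q + t * w q"
  have line: "?l t \<in> Cinf A" for t using Cinf_linear[OF A(1) u w, of 1 t] by simp
  show "?l ` topspace euclideanreal \<subseteq> \<Union> {{v \<in> Cinf A. \<forall>y\<in>K. \<bar>partials I (\<lambda>z. v (\<psi> z) - u (\<psi> z)) y\<bar> < \<epsilon>} | V \<psi> K I u \<epsilon>.
        (V, \<psi>) \<in> A \<and> compact K \<and> K \<subseteq> V \<and> u \<in> Cinf A \<and> \<epsilon> > 0}"
  proof
    fix v assume "v \<in> ?l ` topspace euclideanreal"
    then have v: "v \<in> Cinf A" using line by auto
    obtain V \<psi> where c: "(V, \<psi>) \<in> A" using A(2) by auto
    \<comment> \<open>With the empty compact set the bound is void, so this subbasic set is all of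
      \<open>Cinf A\<close>, and the line stays in the union of the subbasis.\<close>
    let ?W = "{v \<in> Cinf A. \<forall>y\<in>{}. \<bar>partials [] (\<lambda>z. v (\<psi> z) - u (\<psi> z)) y\<bar> < 1}"
    have "?W \<in> {{v \<in> Cinf A. \<forall>y\<in>K. \<bar>partials I (\<lambda>z. v (\<psi> z) - u (\<psi> z)) y\<bar> < \<epsilon>} | V \<psi> K I u \<epsilon>.
        (V, \<psi>) \<in> A \<and> compact K \<and> K \<subseteq> V \<and> u \<in> Cinf A \<and> \<epsilon> > 0}"
      using c u by (intro CollectI exI[of _ V] exI[of _ \<psi>] exI[of _ "{}"] exI[of _ "[]"] exI[of _ u] exI[of _ 1]) auto
    moreover have "v \<in> ?W" using v by simp
    ultimately show "v \<in> \<Union> {{v \<in> Cinf A. \<forall>y\<in>K. \<bar>partials I (\<lambda>z. v (\<psi> z) - u (\<psi> z)) y\<bar> < \<epsilon>} | V \<psi> K I u \<epsilon>.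
        (V, \<psi>) \<in> A \<and> compact K \<and> K \<subseteq> V \<and> u \<in> Cinf A \<and> \<epsilon> > 0}" by (rule UnionI)
  qed
  fix U assume "U \<in> {{v \<in> Cinf A. \<forall>y\<in>K. \<bar>partials I (\<lambda>z. v (\<psi> z) - u (\<psi> z)) y\<bar> < \<epsilon>} | V \<psi> K I u \<epsilon>.
        (V, \<psi>) \<in> A \<and> compact K \<and> K \<subseteq> V \<and> u \<in> Cinf A \<and> \<epsilon> > 0}"
  then obtain V \<psi> K I u0 \<epsilon> where U: "U = {v \<in> Cinf A. \<forall>y\<in>K. \<bar>partials I (\<lambda>z. v (\<psi> z) - u0 (\<psi> z)) y\<bar> < \<epsilon>}"
    and c: "(V, \<psi>) \<in> A" "compact K" "K \<subseteq> V" "u0 \<in> Cinf A" "\<epsilon> > 0" by blast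
  have V: "open V" using A(1) c(1) by (auto simp: smooth_manifold_def)
  let ?d = "\<lambda>z. u (\<psi> z) - u0 (\<psi> z)" and ?w = "\<lambda>z. w (\<psi> z)"
  have sm: "smooth_on V ?d" "smooth_on V ?w"
    using Cinf_chart[OF u c(1)] Cinf_chart[OF w c(1)] Cinf_chart[OF c(4,1)] V by (auto intro: smooth_on_diff)
  have eq: "partials I (\<lambda>z. ?l t (\<psi> z) - u0 (\<psi> z)) y = partials I ?d y + t * partials I ?w y" if "y \<in> K" for t y
  proof -
    have "(\<lambda>z. ?l t (\<psi> z) - u0 (\<psi> z)) = (\<lambda>z. 1 * ?d z + t * ?w z)" by (simp add: fun_eq_iff)
    then show ?thesis using partials_linear(2)[OF V sm, of y I 1 t] that c(3) by auto
  qed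
  have cd: "continuous_on K (partials I ?d)" "continuous_on K (partials I ?w)"
    using partials_linear(1)[OF V sm(1,2)] partials_linear(1)[OF V sm(2,1)] smooth_on_imp_continuous_on continuous_on_subset c(3) by blast+
  have "open {t. \<forall>y\<in>K. \<epsilon> - \<bar>partials I ?d y + t * partials I ?w y\<bar> > 0}"
  proof (rule open_Collect_ball_pos[OF c(2)])
    have "continuous_on (UNIV \<times> K) (\<lambda>p. partials I ?d (snd p))" "continuous_on (UNIV \<times> K) (\<lambda>p. partials I ?w (snd p))"
      by (auto intro!: continuous_on_compose2[OF cd(1)] continuous_on_compose2[OF cd(2)] continuous_intros)
    then show "continuous_on (UNIV \<times> K) (\<lambda>(t, y). \<epsilon> - \<bar>partials I ?d y + t * partials I ?w y\<bar>)"
      unfolding case_prod_unfold by (intro continuous_intros)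
  qed
  also have "{t. \<forall>y\<in>K. \<epsilon> - \<bar>partials I ?d y + t * partials I ?w y\<bar> > 0} = ?l -` U \<inter> topspace euclideanreal"
    using line eq by (auto simp: U)
  finally show "openin euclideanreal (?l -` U \<inter> topspace euclideanreal)" by simp
qed

section \<open>Operators on the sphere\<close>

text \<open>The sphere is compact, so it serves as the compact set for every function.\<close>

lemma Cinf0_sphere: "Cinf0 (sphere_atlas :: ('n::finite, real^('n option)) atlas) = Cinf sphere_atlas"
proof -
  have "compactin (chart_top (sphere_atlas :: ('n, real^('n option)) atlas)) (sphere 0 1)"
    by (simp add: chart_top_sphere compactin_subtopology)
  then show ?thesis unfolding Cinf0_def by (auto intro!: exI[of _ "sphere 0 1"])
qed

lemma Cinf_coordinate: "(\<lambda>p. p $ i) \<in> Cinf (sphere_atlas :: ('n::finite, real^('n option)) atlas)"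
  by (rule CinfI) (auto simp: sphere_atlas_iff intro: smooth_on_vec_nth)

lemma fsa_dirichlet_symmetric:
  assumes "fsa_conf_cov_op r k D" "riemannian_manifold A g" "set us \<subseteq> Cinf0 A" "length us = r" "mset vs = mset us"
  shows "dirichlet D A g vs = dirichlet D A g us"
  using assms unfolding fsa_conf_cov_op_def by blast

lemma fsa_dirichlet_conformal:
  fixes D :: "('n::finite, 'p) poly_op"
  assumes "fsa_conf_cov_op r k D" "riemannian_manifold A g" "\<Upsilon> \<in> Cinf A" "set us \<subseteq> Cinf0 A" "length us = r"
  shows "dirichlet D A (conf_metric \<Upsilon> g) (map (\<lambda>u q. exp (- (real CARD('n) - 2 * k) / real r * \<Upsilon> q) * u q) us) = dirichlet D A g us"
  using assms unfolding fsa_conf_cov_op_def Let_def by blast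

text \<open>Functions live on the ambient space, while identities such as the one between a
  transported perturbation and a coordinate multiple of \<open>v\<close> hold only on the sphere.
  Naturality with the identity map makes them usable in all slots.\<close>

lemma dirichlet_sphere_cong:
  fixes D :: "('n::finite, real^('n option)) poly_op"
  assumes D: "polydiff_op r D" and g: "riemannian_manifold sphere_atlas g"
    and us: "set us \<subseteq> Cinf sphere_atlas" "set vs \<subseteq> Cinf sphere_atlas" "length us = r"
      "list_all2 (\<lambda>v u. \<forall>x\<in>sphere 0 1. v x = u x) vs us"
  shows "dirichlet D sphere_atlas g vs = dirichlet D sphere_atlas g us"
proof -
  have "r \<ge> 1" using D by (simp add: polydiff_op_def)
  then obtain u us' v vs' where eq: "us = u # us'" "vs = v # vs'"
    using us(3,4) by (cases us; cases vs) auto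
  show ?thesis
    unfolding dirichlet_def eq list.sel
  proof (rule Bochner_Integration.integral_cong[OF refl])
    fix x assume "x \<in> space (dV sphere_atlas g)"
    then have x: "x \<in> carrier (sphere_atlas :: ('n, real^('n option)) atlas)" by (simp add: sets_dV_sphere(2)[OF g])
    have "D sphere_atlas g vs' x = D sphere_atlas g us' (id x)"
      by (rule polydiff_op_natural[OF D g g _ _ _ _ _ _ x]) (use us in \<open>auto simp: eq id_def comp_def\<close>)
    then show "v x * D sphere_atlas g vs' x = u x * D sphere_atlas g us' x"
      using us(4) x by (simp add: eq)
  qed
qed

lemma integrable_dirichlet:
  fixes D :: "('n::finite, real^('n option)) poly_op"
  assumes "polydiff_op r D" "riemannian_manifold sphere_atlas g" "u \<in> Cinf sphere_atlas" "set us \<subseteq> Cinf sphere_atlas" "length us = r - 1"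
  shows "integrable (dV sphere_atlas g) (\<lambda>x. u x * D sphere_atlas g us x)"
  using assms polydiff_op_Cinf[OF assms(1,2,4,5)]
  by (intro integrable_dV_sphere continuous_on_mult continuous_on_sphere_Cinf)

text \<open>The first slot of the Dirichlet form is an ordinary factor of the integrand, so
  linearity there does not involve the operator; formal self-adjointness carries it to the other
  slots.\<close>

lemma dirichlet_linear_head:
  fixes D :: "('n::finite, real^('n option)) poly_op"
  assumes "polydiff_op r D" "riemannian_manifold sphere_atlas g" "u \<in> Cinf sphere_atlas" "v \<in> Cinf sphere_atlas"
    "set us \<subseteq> Cinf sphere_atlas" "length us = r - 1"
  shows "dirichlet D sphere_atlas g ((\<lambda>q. u q + t * v q) # us)
    = dirichlet D sphere_atlas g (u # us) + t * dirichlet D sphere_atlas g (v # us)"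
proof -
  have "(LINT x|dV sphere_atlas g. (u x + t * v x) * D sphere_atlas g us x)
      = (LINT x|dV sphere_atlas g. u x * D sphere_atlas g us x + t * (v x * D sphere_atlas g us x))"
    by (simp add: algebra_simps)
  also have "\<dots> = (LINT x|dV sphere_atlas g. u x * D sphere_atlas g us x) + (LINT x|dV sphere_atlas g. t * (v x * D sphere_atlas g us x))"
    using integrable_dirichlet[OF assms(1,2) _ assms(5,6)] assms(3,4) by (intro Bochner_Integration.integral_add) auto
  finally show ?thesis by (simp add: dirichlet_def)
qed

text \<open>Since \<open>mobius b\<close> has the Jacobian \<open>mobius_factor b ^ n\<close>, the action \<open>u \<cdot> mobius b\<close> is the case
  \<open>s = (n - 2 k) / r\<close>.\<close>

definition mobius_act :: "real \<Rightarrow> 'a::real_inner \<Rightarrow> ('a \<Rightarrow> real) \<Rightarrow> 'a \<Rightarrow> real" where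
  "mobius_act s b u x = exp (s * ln (mobius_factor b x)) * u (mobius b x)"

lemma mobius_act_Cinf:
  fixes b :: "real^('n::finite option)"
  assumes b: "norm b < 1" and u: "u \<in> Cinf (sphere_atlas :: ('n, real^('n option)) atlas)"
  shows "mobius_act s b u \<in> Cinf (sphere_atlas :: ('n, real^('n option)) atlas)"
proof (rule CinfI)
  fix V and \<psi> :: "real^'n \<Rightarrow> real^('n option)" assume c: "(V, \<psi>) \<in> sphere_atlas"
  then have V: "open V" by (simp add: sphere_atlas_iff)
  show "smooth_on V (\<lambda>y. mobius_act s b u (\<psi> y))"
    unfolding mobius_act_def
    using Cinf_chart[OF mobius_Upsilon_Cinf[OF b] c] Cinf_chart[OF mobius_Cinf[OF b u] c]
    by (intro smooth_on_mult smooth_on_exp smooth_on_const V)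
qed

lemma round_metric_mobius_inverse:
  fixes b :: "real^('n::finite option)"
  assumes b: "norm b < 1" and c: "(V, \<psi>) \<in> (sphere_atlas :: ('n, real^('n option)) atlas)" and y: "y \<in> V"
  shows "conf_metric (\<lambda>x. ln (mobius_factor b x)) round_metric (V, mobius (- b) \<circ> \<psi>) y = round_metric (V, \<psi>) y"
proof -
  have b': "norm (- b) < 1" using b by simp
  have V: "open V" "\<psi> ` V \<subseteq> sphere 0 1" using c by (auto simp: sphere_atlas_iff)
  have "mobius b (mobius (- b) (\<psi> z)) = \<psi> z" if "z \<in> V" for z
    using mobius_mobius[OF b', of "\<psi> z"] V(2) that by auto
  then have eq: "partial i (mobius b \<circ> (mobius (- b) \<circ> \<psi>)) y = partial i \<psi> y" for i
    by (intro partial_cong[OF V(1) y]) simp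
  show ?thesis
    unfolding round_metric_mobius[OF b mobius_chart(1)[OF b' c] y] by (simp add: round_metric_def eq)
qed

text \<open>The weight in \<open>mobius_act\<close> is opposite to the weight in the conformal
  invariance of the Dirichlet form. Passing to the metric with exponent
  \<open>ln (mobius_factor b x)\<close> therefore strips the exponentials and leaves compositions
  with \<open>mobius b\<close>. Naturality turns the integrand into the round one evaluated at
  \<open>mobius b x\<close>, and \<open>mobius b\<close> pushes the volume of the changed metric
  forward to the round volume.\<close>

lemma dirichlet_mobius_act:
  fixes D :: "('n::finite, real^('n option)) poly_op"
  assumes D: "fsa_conf_cov_op r k D" and b: "norm b < 1"
    and us: "set us \<subseteq> Cinf sphere_atlas" "length us = r"
  shows "dirichlet D sphere_atlas round_metric (map (mobius_act ((real CARD('n) - 2 * k) / real r) b) us)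
    = dirichlet D sphere_atlas round_metric us"
proof -
  let ?A = "sphere_atlas :: ('n, real^('n option)) atlas" and ?g = "round_metric :: ('n, real^('n option)) metric"
  let ?\<Upsilon> = "\<lambda>x. ln (mobius_factor b x)" and ?s = "(real CARD('n) - 2 * k) / real r"
  let ?h = "conf_metric ?\<Upsilon> ?g"
  have g: "riemannian_manifold ?A ?g" by (rule riemannian_manifold_sphere)
  have h: "riemannian_manifold ?A ?h" by (rule riemannian_manifold_conf_metric[OF g mobius_Upsilon_Cinf[OF b]])
  have b': "norm (- b) < 1" using b by simp
  have pd: "polydiff_op r D" using D by (simp add: fsa_conf_cov_op_def)
  then have "r \<ge> 1" by (simp add: polydiff_op_def)
  then obtain u us' where eq: "us = u # us'" using us(2) by (cases us) auto
  have "dirichlet D ?A ?g (map (mobius_act ?s b) us)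
      = dirichlet D ?A ?h (map (\<lambda>u q. exp (- (real CARD('n) - 2 * k) / real r * ?\<Upsilon> q) * u q) (map (mobius_act ?s b) us))"
    by (rule fsa_dirichlet_conformal[OF D g mobius_Upsilon_Cinf[OF b], symmetric])
      (use us mobius_act_Cinf[OF b] in \<open>auto simp: Cinf0_sphere\<close>)
  also have "map (\<lambda>u q. exp (- (real CARD('n) - 2 * k) / real r * ?\<Upsilon> q) * u q) (map (mobius_act ?s b) us)
      = map (\<lambda>u x. u (mobius b x)) us"
  proof -
    have "- (real CARD('n) - 2 * k) / real r * z = - (?s * z)" for z
      by (simp only: minus_divide_left[symmetric] mult_minus_left)
    moreover have "exp (- z) * (exp z * t) = t" for z t :: real by (simp add: exp_minus)
    ultimately have "exp (- (real CARD('n) - 2 * k) / real r * z) * (exp (?s * z) * t) = t" for z t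
      by (simp only:)
    then show ?thesis by (simp add: mobius_act_def fun_eq_iff)
  qed
  also have "dirichlet D ?A ?h (map (\<lambda>u x. u (mobius b x)) us)
      = (LINT x|dV ?A ?h. (\<lambda>y. u y * D ?A ?g us' y) (mobius b x))"
    unfolding dirichlet_def eq list.map list.sel
  proof (rule Bochner_Integration.integral_cong[OF refl])
    fix x assume "x \<in> space (dV ?A ?h)"
    then have x: "x \<in> carrier ?A" by (simp add: sets_dV_sphere(2)[OF h])
    have "D ?A ?h (map (\<lambda>u x. u (mobius b x)) us') x = D ?A ?g us' (mobius b x)"
    proof (rule polydiff_op_natural[OF pd g h mobius_chart(1)[OF b] round_metric_mobius[OF b] _ _ _ _ x])
      show "set (map (\<lambda>u x. u (mobius b x)) us') \<subseteq> Cinf ?A" using us(1) mobius_Cinf[OF b] by (auto simp: eq)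
      show "list_all2 (\<lambda>u' u. \<forall>x\<in>carrier ?A. u' x = u (mobius b x)) (map (\<lambda>u x. u (mobius b x)) us') us'"
        by (simp add: list.rel_map list.rel_refl)
    qed (use us in \<open>auto simp: eq\<close>)
    then show "u (mobius b x) * D ?A ?h (map (\<lambda>u x. u (mobius b x)) us') x = (\<lambda>y. u y * D ?A ?g us' y) (mobius b x)"
      by simp
  qed
  also have "\<dots> = (LINT y|distr (dV ?A ?h) (restrict_space borel (sphere 0 1)) (mobius b). u y * D ?A ?g us' y)"
  proof (rule integral_distr[symmetric])
    have "continuous_on (sphere 0 1) (mobius b)"
      using smooth_on_imp_continuous_on[OF smooth_on_mobius] sphere_subset_Compl[OF b] by (rule continuous_on_subset)
    then have "mobius b \<in> measurable (restrict_space borel (sphere 0 1)) (restrict_space borel (sphere 0 1))"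
      using mobius_sphere[OF b]
      by (intro measurable_restrict_space2 borel_measurable_continuous_on_restrict) (auto simp: space_restrict_space)
    then show "mobius b \<in> measurable (dV ?A ?h) (restrict_space borel (sphere 0 1))"
      using measurable_cong_sets[OF sets_dV_sphere(1)[OF h] refl] by blast
    show "(\<lambda>y. u y * D ?A ?g us' y) \<in> borel_measurable (restrict_space borel (sphere 0 1))"
      using us polydiff_op_Cinf[OF pd g, of us']
      by (intro measurable_sphere_continuous continuous_on_mult continuous_on_sphere_Cinf) (auto simp: eq)
  qed
  also have "distr (dV ?A ?h) (restrict_space borel (sphere 0 1)) (mobius b) = dV ?A ?g"
  proof (rule distr_dV_diffeomorphism[OF g h])
    show "mobius (- b) (mobius b p) = p" "mobius b (mobius (- b) p) = p" if "p \<in> sphere 0 1" for p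
      using mobius_mobius[OF b, of p] mobius_mobius[OF b', of p] that by simp_all
    show "continuous_on (sphere 0 1) (mobius b)"
      using smooth_on_imp_continuous_on[OF smooth_on_mobius] sphere_subset_Compl[OF b] by (rule continuous_on_subset)
  qed (use mobius_sphere[OF b] mobius_chart(1)[OF b'] round_metric_mobius_inverse[OF b] in auto)
  finally show ?thesis by (simp add: dirichlet_def eq)
qed

text \<open>The Frank-Lieb inequality is applied to the transported function, which must therefore
  satisfy the constraints. Their weight is the one of the action, so covariance and naturality
  reproduce the value of the constraint at the image point up to a positive exponential.\<close>

lemma constrained_cone_mobius_act:
  fixes D :: "('n::finite, real^('n option)) poly_op"
  assumes \<C>: "constrained_op r k D \<C>" and b: "norm b < 1" and u: "u \<in> constrained_cone \<C> sphere_atlas round_metric"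
  shows "mobius_act ((real CARD('n) - 2 * k) / real r) b u \<in> constrained_cone \<C> sphere_atlas round_metric"
  unfolding constrained_cone_def mem_Collect_eq
proof (intro conjI, goal_cases)
  let ?A = "sphere_atlas :: ('n, real^('n option)) atlas" and ?g = "round_metric :: ('n, real^('n option)) metric"
  let ?\<Upsilon> = "\<lambda>x. ln (mobius_factor b x)" and ?s = "(real CARD('n) - 2 * k) / real r"
  have uC: "u \<in> Cinf ?A" using u by (simp add: constrained_cone_def)
  case 1
  show ?case by (rule mobius_act_Cinf[OF b uC])
  case 2
  have g: "riemannian_manifold ?A ?g" by (rule riemannian_manifold_sphere)
  have U: "?\<Upsilon> \<in> Cinf ?A" by (rule mobius_Upsilon_Cinf[OF b])
  have h: "riemannian_manifold ?A (conf_metric ?\<Upsilon> ?g)" by (rule riemannian_manifold_conf_metric[OF g U])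
  have "C ?A ?g (replicate (\<rho> - 1) (mobius_act ?s b u)) x > 0" if C: "(\<rho>, C) \<in> \<C>" and x: "x \<in> carrier ?A" for \<rho> C x
  proof -
    note \<C>[unfolded constrained_op_def, THEN conjunct2, THEN conjunct2]
    from bspec[OF this C, unfolded prod.case] obtain \<beta> :: real where pd: "polydiff_op \<rho> C"
      and cov: "\<And>A g \<Upsilon> u x. riemannian_manifold A g \<Longrightarrow> \<Upsilon> \<in> Cinf A \<Longrightarrow> u \<in> Cinf A \<Longrightarrow> x \<in> carrier A \<Longrightarrow>
        C A (conf_metric \<Upsilon> g) (replicate (\<rho> - 1) u) x = exp (\<beta> * \<Upsilon> x) * C A g (replicate (\<rho> - 1) (\<lambda>q. exp (?s * \<Upsilon> q) * u q)) x"
      by blast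
    have pos: "C ?A ?g (replicate (\<rho> - 1) u) (mobius b x) > 0"
    proof -
      have "mobius b x \<in> carrier ?A" using norm_mobius[OF b, of x] x by simp
      moreover have "\<forall>(\<rho>, C)\<in>\<C>. \<forall>x\<in>carrier ?A. C ?A ?g (replicate (\<rho> - 1) u) x > 0"
        using u by (simp add: constrained_cone_def)
      ultimately show ?thesis using C by blast
    qed
    have "C ?A (conf_metric ?\<Upsilon> ?g) (replicate (\<rho> - 1) (\<lambda>x. u (mobius b x))) x = C ?A ?g (replicate (\<rho> - 1) u) (mobius b x)"
    proof (rule polydiff_op_natural[OF pd g h mobius_chart(1)[OF b] round_metric_mobius[OF b] _ _ _ _ x])
      show "list_all2 (\<lambda>u' u. \<forall>x\<in>carrier ?A. u' x = u (mobius b x)) (replicate (\<rho> - 1) (\<lambda>x. u (mobius b x))) (replicate (\<rho> - 1) u)"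
        by (simp add: list_all2_conv_all_nth)
    qed (use uC mobius_Cinf[OF b uC] in \<open>auto simp: in_set_replicate\<close>)
    also have "C ?A (conf_metric ?\<Upsilon> ?g) (replicate (\<rho> - 1) (\<lambda>x. u (mobius b x))) x
        = exp (\<beta> * ?\<Upsilon> x) * C ?A ?g (replicate (\<rho> - 1) (mobius_act ?s b u)) x"
      using cov[OF g U mobius_Cinf[OF b uC] x] by (simp add: mobius_act_def[abs_def])
    finally have "exp (\<beta> * ?\<Upsilon> x) * C ?A ?g (replicate (\<rho> - 1) (mobius_act ?s b u)) x > 0" using pos by simp
    then show ?thesis by (simp add: zero_less_mult_iff)
  qed
  then show ?case by blast
qed

lemma symmetric_op_perm:
  assumes "symmetric_op r D" "riemannian_manifold A g" "set us \<subseteq> Cinf A" "length us = r - 1" "mset vs = mset us"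
    "x \<in> carrier A"
  shows "D A g vs x = D A g us x"
  using assms unfolding symmetric_op_def by blast

text \<open>Along the line each constraint is a polynomial in \<open>t\<close> whose coefficients
  are continuous on the compact sphere, so strict positivity at \<open>t = 0\<close> persists
  nearby, and finitely many constraints persist together. This makes the perturbations admissible
  competitors.\<close>

lemma constrained_cone_line:
  fixes D :: "('n::finite, real^('n option)) poly_op"
  assumes \<C>: "constrained_op r k D \<C>" and u: "u \<in> constrained_cone \<C> sphere_atlas round_metric" and w: "w \<in> Cinf sphere_atlas"
  shows "\<forall>\<^sub>F t in nhds 0. (\<lambda>q. u q + t * w q) \<in> constrained_cone \<C> sphere_atlas round_metric"
proof -
  let ?A = "sphere_atlas :: ('n, real^('n option)) atlas" and ?g = "round_metric :: ('n, real^('n option)) metric"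
  let ?l = "\<lambda>t q. u q + t * w q"
  have g: "riemannian_manifold ?A ?g" by (rule riemannian_manifold_sphere)
  have uC: "u \<in> Cinf ?A" and pos: "\<forall>(\<rho>, C)\<in>\<C>. \<forall>x\<in>carrier ?A. C ?A ?g (replicate (\<rho> - 1) u) x > 0"
    using u by (simp_all add: constrained_cone_def)
  have closed: "(\<lambda>q. u q + t * v q) \<in> Cinf ?A" if "u \<in> Cinf ?A" "v \<in> Cinf ?A" for u v t
    using Cinf_linear[OF smooth_manifold_sphere that, of 1 t] by simp
  have "\<forall>\<^sub>F t in nhds 0. \<forall>x\<in>sphere 0 1. C ?A ?g (replicate (\<rho> - 1) (?l t)) x > 0" if C: "(\<rho>, C) \<in> \<C>" for \<rho> C
  proof -
    note \<C>[unfolded constrained_op_def, THEN conjunct2, THEN conjunct2]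
    from bspec[OF this C, unfolded prod.case] have pd: "polydiff_op \<rho> C" and sy: "symmetric_op \<rho> C" by blast+
    define c where "c i x = C ?A ?g (replicate i w @ replicate (\<rho> - 1 - i) u) x" for i x
    have exp: "C ?A ?g (replicate (\<rho> - 1) (?l t)) x = (\<Sum>i\<le>\<rho> - 1. real (\<rho> - 1 choose i) * t ^ i * c i x)"
      if x: "x \<in> sphere 0 1" for t x
    proof -
      have "C ?A ?g (replicate (\<rho> - 1) (?l t) @ []) x
          = (\<Sum>i\<le>\<rho> - 1. real (\<rho> - 1 choose i) * t ^ i * C ?A ?g (replicate i w @ replicate (\<rho> - 1 - i) u @ []) x)"
      proof (rule symmetric_multilinear_binomial[where X = "Cinf ?A" and N = "\<rho> - 1" and M = "\<lambda>us. C ?A ?g us x"])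
        show "C ?A ?g ys x = C ?A ?g xs x" if "set xs \<subseteq> Cinf ?A" "length xs = \<rho> - 1" "mset ys = mset xs" for xs ys
          using symmetric_op_perm[OF sy g that] x by simp
        show "C ?A ?g ((\<lambda>q. u q + t * v q) # zs) x = C ?A ?g (u # zs) x + t * C ?A ?g (v # zs) x"
          if "u \<in> Cinf ?A" "v \<in> Cinf ?A" "set zs \<subseteq> Cinf ?A" "Suc (length zs) = \<rho> - 1" for u v t zs
          using polydiff_op_linear_head[OF pd g that, of x 1 t] x by simp
      qed (use closed uC w in auto)
      then show ?thesis by (simp add: c_def)
    qed
    have cc: "continuous_on (sphere 0 1) (c i)" if "i \<le> \<rho> - 1" for i
      unfolding c_def using that uC w
      by (intro continuous_on_sphere_Cinf polydiff_op_Cinf[OF pd g]) (auto simp: in_set_replicate)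
    have "open {t. \<forall>x\<in>sphere 0 1. (\<Sum>i\<le>\<rho> - 1. real (\<rho> - 1 choose i) * t ^ i * c i x) > 0}"
    proof (rule open_Collect_ball_pos[OF compact_sphere])
      have "continuous_on (UNIV \<times> sphere 0 1) (\<lambda>p :: real \<times> _. c i (snd p))" if "i \<le> \<rho> - 1" for i
        by (rule continuous_on_compose2[OF cc[OF that]]) (auto intro!: continuous_intros)
      then show "continuous_on (UNIV \<times> sphere 0 1) (\<lambda>(t, x). \<Sum>i\<le>\<rho> - 1. real (\<rho> - 1 choose i) * t ^ i * c i x)"
        unfolding case_prod_unfold by (intro continuous_intros) auto
    qed
    moreover have "0 \<in> {t. \<forall>x\<in>sphere 0 1. (\<Sum>i\<le>\<rho> - 1. real (\<rho> - 1 choose i) * t ^ i * c i x) > 0}"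
      using pos C exp[of _ 0] by auto
    ultimately have "\<forall>\<^sub>F t in nhds 0. t \<in> {t. \<forall>x\<in>sphere 0 1. (\<Sum>i\<le>\<rho> - 1. real (\<rho> - 1 choose i) * t ^ i * c i x) > 0}"
      by (rule eventually_nhds_in_open)
    then show ?thesis
    proof eventually_elim
      case (elim t)
      show ?case
      proof (rule ballI)
        fix x :: "real^('n option)" assume x: "x \<in> sphere 0 1"
        show "C ?A ?g (replicate (\<rho> - 1) (?l t)) x > 0" unfolding exp[OF x] using elim x by blast
      qed
    qed
  qed
  moreover have "finite \<C>" using \<C> by (simp add: constrained_op_def)
  ultimately have "\<forall>\<^sub>F t in nhds 0. \<forall>\<rho>C\<in>\<C>. \<forall>x\<in>sphere 0 1. snd \<rho>C ?A ?g (replicate (fst \<rho>C - 1) (?l t)) x > 0"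
    by (intro eventually_ball_finite) auto
  then show ?thesis
    by eventually_elim (auto simp: constrained_cone_def closed[OF uC w])
qed

section \<open>Local minimizers\<close>

lemma real_choose_two: "real (r choose 2) = real r * (real r - 1) / 2"
proof -
  have "even (r * (r - 1))" by (cases r) auto
  then have "2 * (r choose 2) = r * (r - 1)" by (simp only: choose_two dvd_mult_div_cancel)
  then have "2 * real (r choose 2) = real r * real (r - 1)" by (metis of_nat_mult of_nat_numeral)
  then show ?thesis by (cases r) simp_all
qed

lemma dirichlet_sphere_binomial:
  fixes D :: "('n::finite, real^('n option)) poly_op"
  assumes D: "fsa_conf_cov_op r k D" and u: "u \<in> Cinf sphere_atlas" and w: "w \<in> Cinf sphere_atlas"
  shows "dirichlet D sphere_atlas round_metric (replicate r (\<lambda>q. u q + t * w q))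
    = (\<Sum>i\<le>r. real (r choose i) * dirichlet D sphere_atlas round_metric (replicate i w @ replicate (r - i) u) * t ^ i)"
proof -
  let ?A = "sphere_atlas :: ('n, real^('n option)) atlas" and ?g = "round_metric :: ('n, real^('n option)) metric"
  have g: "riemannian_manifold ?A ?g" by (rule riemannian_manifold_sphere)
  have pd: "polydiff_op r D" using D by (simp add: fsa_conf_cov_op_def)
  have "dirichlet D ?A ?g (replicate r (\<lambda>q. u q + t * w q) @ [])
      = (\<Sum>i\<le>r. real (r choose i) * t ^ i * dirichlet D ?A ?g (replicate i w @ replicate (r - i) u @ []))"
  proof (rule symmetric_multilinear_binomial[where X = "Cinf ?A" and N = r and M = "dirichlet D ?A ?g"])
    show "dirichlet D ?A ?g ys = dirichlet D ?A ?g xs" if "set xs \<subseteq> Cinf ?A" "length xs = r" "mset ys = mset xs" for xs ys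
      using fsa_dirichlet_symmetric[OF D g _ that(2,3)] that(1) by (simp add: Cinf0_sphere)
    show "dirichlet D ?A ?g ((\<lambda>q. u q + t * v q) # zs) = dirichlet D ?A ?g (u # zs) + t * dirichlet D ?A ?g (v # zs)"
      if "u \<in> Cinf ?A" "v \<in> Cinf ?A" "set zs \<subseteq> Cinf ?A" "Suc (length zs) = r" for u v t zs
      using dirichlet_linear_head[OF pd g that(1-3), of t] that(4) by simp
    show "(\<lambda>q. u q + t * v q) \<in> Cinf ?A" if "u \<in> Cinf ?A" "v \<in> Cinf ?A" for u v t
      using Cinf_linear[OF smooth_manifold_sphere that, of 1 t] by simp
  qed (use u w in auto)
  then show ?thesis by (simp add: mult.assoc mult.commute[of "t ^ _"])
qed

text \<open>The commutator expands into a term with two slots \<open>q $ i * v q\<close> minus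
  \<open>p $ i * p $ i\<close> times the integrand of the Dirichlet form, and these squares sum to 1
  on the sphere. The two-slot terms are, up to a binomial coefficient, the second-order coefficients
  of the perturbed Dirichlet form.\<close>

lemma integral_comm1_coordinates:
  fixes D :: "('n::finite, real^('n option)) poly_op"
  assumes pd: "polydiff_op r D" and r: "r \<ge> 2" and v: "v \<in> Cinf sphere_atlas"
  shows "(LINT p|dV sphere_atlas round_metric. (\<Sum>i\<in>UNIV. p $ i * v p *
      comm1 (D sphere_atlas round_metric) (\<lambda>q. q $ i) (replicate (r - 1) v) p))
    = (\<Sum>i\<in>UNIV. dirichlet D sphere_atlas round_metric
        ([\<lambda>q. q $ i * v q, \<lambda>q. q $ i * v q] @ replicate (r - 2) v)) - dirichlet D sphere_atlas round_metric (replicate r v)"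
proof -
  let ?A = "sphere_atlas :: ('n, real^('n option)) atlas" and ?g = "round_metric :: ('n, real^('n option)) metric"
  let ?D = "D ?A ?g" and ?x = "\<lambda>i q. q $ i * v q"
  have g: "riemannian_manifold ?A ?g" by (rule riemannian_manifold_sphere)
  have xv: "?x i \<in> Cinf ?A" for i by (rule Cinf_mult[OF smooth_manifold_sphere Cinf_coordinate v])
  obtain j where j: "r = Suc (Suc j)" using r by (metis One_nat_def Suc_1 Suc_le_D Suc_le_mono)
  have int1: "integrable (dV ?A ?g) (\<lambda>p. ?x i p * ?D (?x i # replicate j v) p)" for i
    by (rule integrable_dirichlet[OF pd g xv]) (use xv v in \<open>auto simp: j in_set_replicate\<close>)
  have int2: "integrable (dV ?A ?g) (\<lambda>p. v p * ?D (replicate (Suc j) v) p)"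
    by (rule integrable_dirichlet[OF pd g v]) (use v in \<open>auto simp: j in_set_replicate\<close>)
  have "(LINT p|dV ?A ?g. (\<Sum>i\<in>UNIV. p $ i * v p * comm1 ?D (\<lambda>q. q $ i) (replicate (r - 1) v) p))
      = (LINT p|dV ?A ?g. (\<Sum>i\<in>UNIV. ?x i p * ?D (?x i # replicate j v) p) - v p * ?D (replicate (Suc j) v) p)"
  proof (rule Bochner_Integration.integral_cong[OF refl])
    fix p assume "p \<in> space (dV ?A ?g)"
    then have "norm p = 1" by (simp add: sets_dV_sphere(2)[OF g])
    then have pp: "(\<Sum>i\<in>UNIV. p $ i * p $ i) = 1" by (simp add: norm_eq_1 inner_vec_def)
    have "p $ i * v p * comm1 ?D (\<lambda>q. q $ i) (replicate (r - 1) v) p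
        = ?x i p * ?D (?x i # replicate j v) p - (p $ i * p $ i) * (v p * ?D (replicate (Suc j) v) p)" for i
      by (simp add: comm1_def j algebra_simps)
    then show "(\<Sum>i\<in>UNIV. p $ i * v p * comm1 ?D (\<lambda>q. q $ i) (replicate (r - 1) v) p)
        = (\<Sum>i\<in>UNIV. ?x i p * ?D (?x i # replicate j v) p) - v p * ?D (replicate (Suc j) v) p"
      by (simp only: sum_subtractf sum_distrib_right[symmetric] pp mult_1)
  qed
  also have "\<dots> = (\<Sum>i\<in>UNIV. LINT p|dV ?A ?g. ?x i p * ?D (?x i # replicate j v) p) - (LINT p|dV ?A ?g. v p * ?D (replicate (Suc j) v) p)"
    using int1 int2 by (simp add: Bochner_Integration.integral_diff Bochner_Integration.integral_sum)
  finally show ?thesis by (simp add: dirichlet_def j)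
qed

text \<open>For \<open>\<bar>t\<bar> < 1\<close> the factor \<open>1 + t * y x\<close> is positive,
  so it leaves the absolute value and the power splits, also where \<open>u\<close> vanishes. The
  parameter then occurs only in a power with positive base.\<close>

lemma quotient_functional_line:
  fixes D :: "('n::finite, real^('n option)) poly_op" and y :: "real^('n option) \<Rightarrow> real"
    and r :: nat and k :: real
  assumes "\<And>x. x \<in> sphere 0 1 \<Longrightarrow> \<bar>y x\<bar> \<le> 1" "\<bar>t\<bar> < 1"
  defines "q \<equiv> real r * real CARD('n) / (real CARD('n) - 2 * k)"
  shows "quotient_functional r k D (\<lambda>x. u x + t * (u x * y x))
    = dirichlet D sphere_atlas round_metric (replicate r (\<lambda>x. u x + t * (u x * y x))) /
      ((LINT x|dV sphere_atlas (round_metric :: ('n, real^('n option)) metric). \<bar>u x\<bar> powr q * (1 + t * y x) powr q) powr (1 / q)) ^ r"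
proof -
  have "\<bar>u x + t * (u x * y x)\<bar> powr q = \<bar>u x\<bar> powr q * (1 + t * y x) powr q" if "x \<in> sphere 0 1" for x
  proof -
    have "\<bar>t * y x\<bar> < 1"
      using assms(1)[OF that] assms(2) by (simp add: abs_mult) (meson abs_ge_zero le_less_trans mult_left_le)
    then have pos: "1 + t * y x > 0" by (simp add: abs_less_iff)
    have "u x + t * (u x * y x) = u x * (1 + t * y x)" by (simp add: algebra_simps)
    then show ?thesis using pos by (simp add: abs_mult powr_mult)
  qed
  then have "(LINT x|dV sphere_atlas (round_metric :: ('n, real^('n option)) metric). \<bar>u x + t * (u x * y x)\<bar> powr q)
      = (LINT x|dV sphere_atlas (round_metric :: ('n, real^('n option)) metric). \<bar>u x\<bar> powr q * (1 + t * y x) powr q)"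
    by (intro Bochner_Integration.integral_cong refl) (simp add: sets_dV_sphere(2)[OF riemannian_manifold_sphere])
  then show ?thesis by (simp add: quotient_functional_def Lp_norm_def q_def)
qed

theorem theorem1p8:
  fixes D :: "('n::finite, real^('n option)) poly_op"
    and \<C> :: "(nat \<times> ('n, real^('n option)) poly_op) set"
    and r :: nat and k :: real
    and u :: "real^('n option) \<Rightarrow> real"
  assumes "r \<ge> 2" and "0 < 2 * k" and "2 * k < real CARD('n)"
    and "constrained_op r k D \<C>"
    and "frank_lieb r k D \<C>"
    and "local_minimizer_on (Cinf_top (sphere_atlas :: ('n, real^('n option)) atlas))
           {v \<in> constrained_cone \<C> sphere_atlas round_metric. \<exists>p\<in>sphere 0 1. v p \<noteq> 0}
           (quotient_functional r k D) u"
  shows "\<exists>c::real. c \<noteq> 0 \<and>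
           (\<exists>\<Phi>\<in>Conf_group (sphere_atlas :: ('n, real^('n option)) atlas) round_metric.
              \<forall>p\<in>sphere 0 1. u p = conf_act r k (\<lambda>_. c) \<Phi> p)"
proof -
  let ?A = "sphere_atlas :: ('n, real^('n option)) atlas" and ?g = "round_metric :: ('n, real^('n option)) metric"
  let ?n = "real CARD('n)" and ?M = "dV ?A ?g" and ?E = "dirichlet D ?A ?g"
  let ?cone = "constrained_cone \<C> ?A ?g"
  define s where "s = (?n - 2 * k) / real r"
  define q where "q = real r * ?n / (?n - 2 * k)"
  define f where "f x = \<bar>u x\<bar> powr q" for x
  have D: "fsa_conf_cov_op r k D" using assms(4) by (simp add: constrained_op_def)
  have pd: "polydiff_op r D" using D by (simp add: fsa_conf_cov_op_def)
  have g: "riemannian_manifold ?A ?g" by (rule riemannian_manifold_sphere)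
  have q: "q > 0" "q - real r = 2 * real r * k / (?n - 2 * k)"
    using assms(1-3) by (simp_all add: q_def field_simps)
  obtain W p0 where u: "u \<in> ?cone" "p0 \<in> sphere 0 1" "u p0 \<noteq> 0" and W: "openin (Cinf_top ?A) W" "u \<in> W"
    and min: "\<And>v p. v \<in> W \<Longrightarrow> v \<in> ?cone \<Longrightarrow> p \<in> sphere 0 1 \<Longrightarrow> v p \<noteq> 0 \<Longrightarrow> quotient_functional r k D u \<le> quotient_functional r k D v"
    using assms(6) unfolding local_minimizer_on_def by blast
  have uC: "u \<in> Cinf ?A" using u(1) by (simp add: constrained_cone_def)
  have f: "continuous_on (sphere 0 1) f" "\<And>x. f x \<ge> 0"
  proof -
    have "continuous_on (sphere 0 1) (\<lambda>x. \<bar>u x\<bar> powr q)"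
      by (rule continuous_on_powr'[OF continuous_on_rabs[OF continuous_on_sphere_Cinf[OF uC]] continuous_on_const])
        (use q(1) in simp)
    then show "continuous_on (sphere 0 1) f" by (simp add: f_def[abs_def])
  qed (simp add: f_def)
  have f_pos: "(LINT x|?M. f x) > 0"
    by (rule integral_dV_sphere_pos[OF g f u(2)]) (use u(3) in \<open>simp add: f_def\<close>)
  \<comment> \<open>The measure being balanced is that of the minimizer itself: \<open>f\<close>
    becomes orthogonal to the coordinate functions of \<open>mobius a\<close>, which is the
    hypothesis \<open>fy\<close> of the second variation.\<close>
  obtain a where a: "norm a < 1" "\<And>i. (LINT x|?M. f x * mobius a x $ i) = 0"
    using hersch[OF g f f_pos] by blast
  have a': "norm (- a) < 1" using a(1) by simp
  define y where "y i x = mobius a x $ i" for i x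
  define w where "w i x = u x * y i x" for i x
  \<comment> \<open>The transport uses \<open>- a\<close> because \<open>mobius (- a)\<close>
    inverts \<open>mobius a\<close>: composed with it, the functions \<open>y i\<close> become the
    coordinates of the sphere.\<close>
  define v where "v = mobius_act s (- a) u"
  have yC: "y i \<in> Cinf ?A" for i unfolding y_def by (rule mobius_Cinf[OF a(1) Cinf_coordinate])
  have wC: "w i \<in> Cinf ?A" for i unfolding w_def by (rule Cinf_mult[OF smooth_manifold_sphere uC yC])
  have y_le: "\<bar>y i x\<bar> \<le> 1" if "x \<in> sphere 0 1" for i x
    using component_le_norm_cart[of "mobius a x" i] norm_mobius[OF a(1), of x] that by (simp add: y_def)
  have v: "v \<in> ?cone" unfolding v_def s_def by (rule constrained_cone_mobius_act[OF assms(4) a' u(1)])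
  then have vC: "v \<in> Cinf ?A" by (simp add: constrained_cone_def)
  have E_act: "?E (map (mobius_act s (- a)) us) = ?E us" if "set us \<subseteq> Cinf ?A" "length us = r" for us
    unfolding s_def by (rule dirichlet_mobius_act[OF D a' that])
  define m where "m i = (LINT x|?M. f x * (y i x)\<^sup>2)" for i
  define A2 where "A2 i = ?E ([\<lambda>q. q $ i * v q, \<lambda>q. q $ i * v q] @ replicate (r - 2) v)" for i
  have E_v: "?E (replicate r v) = ?E (replicate r u)"
    using E_act[of "replicate r u"] uC by (simp add: v_def set_replicate_conv_if)
  \<comment> \<open>On the sphere \<open>mobius_act s (- a)\<close> takes \<open>w i\<close> to the
    coordinate multiple of \<open>v\<close>. Invariance of the Dirichlet form then expresses the
    second-order coefficient of the line through \<open>u\<close> by means of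
    \<open>v\<close>.\<close>
  have A2: "?E (replicate 2 (w i) @ replicate (r - 2) u) = A2 i" for i
  proof -
    let ?us = "replicate 2 (w i) @ replicate (r - 2) u"
    have us: "set ?us \<subseteq> Cinf ?A" "length ?us = r" using wC uC assms(1) by auto
    have x: "mobius_act s (- a) (w i) x = x $ i * v x" if "x \<in> sphere 0 1" for x
      using mobius_mobius[OF a', of x] that by (simp add: mobius_act_def w_def y_def v_def)
    have xv: "(\<lambda>q. q $ i * v q) \<in> Cinf ?A" by (rule Cinf_mult[OF smooth_manifold_sphere Cinf_coordinate vC])
    have "?E (map (mobius_act s (- a)) ?us) = A2 i"
      unfolding A2_def
    proof (rule dirichlet_sphere_cong[OF pd g])
      show "set (map (mobius_act s (- a)) ?us) \<subseteq> Cinf ?A" using us(1) mobius_act_Cinf[OF a'] by auto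
      show "set ([\<lambda>q. q $ i * v q, \<lambda>q. q $ i * v q] @ replicate (r - 2) v) \<subseteq> Cinf ?A" using xv vC by auto
      show "list_all2 (\<lambda>v u. \<forall>x\<in>sphere 0 1. v x = u x) (map (mobius_act s (- a)) ?us)
          ([\<lambda>q. q $ i * v q, \<lambda>q. q $ i * v q] @ replicate (r - 2) v)"
        using x by (simp add: numeral_2_eq_2 list_all2_conv_all_nth[of _ "replicate _ _"] v_def)
    qed (use assms(1) in simp)
    then show ?thesis using E_act[OF us] by simp
  qed
  \<comment> \<open>The second variation in the direction \<open>w i\<close>, divided by the common
    factor r. The coefficient \<open>c 2\<close> carries \<open>r choose 2\<close>, so
    \<open>2 * c 2\<close> is \<open>real r * (real r - 1) * A2 i\<close>.\<close>
  have ineq: "(real r - 1) * A2 i * (LINT x|?M. f x) \<ge> (q - 1) * ?E (replicate r u) * m i" for i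
  proof -
    define c where "c j = real (r choose j) * ?E (replicate j (w i) @ replicate (r - j) u)" for j
    define l where "l t x = u x + t * w i x" for t x
    have quot: "quotient_functional r k D (l t) = (\<Sum>j\<le>r. c j * t ^ j) / ((LINT x|?M. f x * (1 + t * y i x) powr q) powr (1 / q)) ^ r"
      if "\<bar>t\<bar> < 1" for t
      using quotient_functional_line[where y = "y i" and u = u and r = r and k = k and D = D, OF y_le that, folded q_def] dirichlet_sphere_binomial[OF D uC wC, of t i]
      by (simp add: l_def[abs_def] w_def[abs_def] f_def c_def)
    have l0: "l 0 = u" by (simp add: l_def fun_eq_iff)
    have "continuous_map euclideanreal (Cinf_top ?A) l"
      using continuous_map_line_Cinf_top[OF smooth_manifold_sphere _ uC wC] stereo_in_atlas[of 1]
      by (auto simp: l_def[abs_def])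
    then have "open {t. l t \<in> W}" using openin_continuous_map_preimage[OF _ W(1)] by fastforce
    then have "\<forall>\<^sub>F t in nhds 0. l t \<in> W" using eventually_nhds_in_open[of "{t. l t \<in> W}" 0] W(2) l0 by simp
    moreover have "\<forall>\<^sub>F t in nhds 0. l t \<in> ?cone"
      unfolding l_def using constrained_cone_line[OF assms(4) u(1) wC] .
    moreover have "\<forall>\<^sub>F t in nhds (0::real). \<bar>t\<bar> < 1"
      using eventually_nhds_in_open[of "{-1<..<1}" "0::real"] by (auto elim!: eventually_mono)
    \<comment> \<open>The terms \<open>0 ^ j\<close> and \<open>1 + 0 * y i x\<close> are kept,
      since this is the unfolded shape of \<open>P 0\<close> and \<open>N 0\<close> expected by
      \<open>second_variation\<close>.\<close>
    ultimately have "\<forall>\<^sub>F t in nhds 0. (\<Sum>j\<le>r. c j * 0 ^ j) / ((LINT x|?M. f x * (1 + 0 * y i x) powr q) powr (1 / q)) ^ r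
        \<le> (\<Sum>j\<le>r. c j * t ^ j) / ((LINT x|?M. f x * (1 + t * y i x) powr q) powr (1 / q)) ^ r"
    proof eventually_elim
      case (elim t)
      \<comment> \<open>The functional excludes the zero function; the competitor stays nonzero at
        \<open>p0\<close>, where \<open>u\<close> is nonzero.\<close>
      have "\<bar>t * y i p0\<bar> < 1"
        using y_le[OF u(2), of i] elim(3) by (simp add: abs_mult) (meson abs_ge_zero le_less_trans mult_left_le)
      then have "1 + t * y i p0 \<noteq> 0" by (simp add: abs_less_iff)
      moreover have "l t p0 = u p0 * (1 + t * y i p0)" by (simp add: l_def w_def algebra_simps)
      ultimately have "l t p0 \<noteq> 0" using u(3) by simp
      then have "quotient_functional r k D (l 0) \<le> quotient_functional r k D (l t)"
        unfolding l0 using min elim u(2) by blast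
      then show ?case using quot[of 0] quot[of t] elim(3) by simp
    qed
    then have ev: "\<forall>\<^sub>F t in at 0. (\<Sum>j\<le>r. c j * 0 ^ j) / ((LINT x|?M. f x * (1 + 0 * y i x) powr q) powr (1 / q)) ^ r
        \<le> (\<Sum>j\<le>r. c j * t ^ j) / ((LINT x|?M. f x * (1 + t * y i x) powr q) powr (1 / q)) ^ r"
      unfolding eventually_at_filter by (rule eventually_mono) blast
    have "real r * (q - 1) * c 0 * (LINT x|?M. f x * (y i x)\<^sup>2) \<le> 2 * c 2 * (LINT x|?M. f x * (1 + 0 * y i x) powr q)"
    proof (rule second_variation[OF g f(1) _ continuous_on_sphere_Cinf[OF yC] y_le _ q(1) assms(1) _ ev])
      show "(LINT x|?M. f x * y i x) = 0" using a(2) by (simp add: y_def)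
    qed (use f f_pos in auto)
    moreover have "c 0 = ?E (replicate r u)" "2 * c 2 = real r * (real r - 1) * A2 i"
      by (simp_all add: c_def A2 real_choose_two)
    ultimately have "real r * ((q - 1) * ?E (replicate r u) * m i) \<le> real r * ((real r - 1) * A2 i * (LINT x|?M. f x))"
      by (simp add: m_def ac_simps)
    then show ?thesis using assms(1) by (simp add: mult_le_cancel_left)
  qed
  \<comment> \<open>The second moments add up to the total mass because \<open>mobius a x\<close> is
    a unit vector.\<close>
  have "(\<Sum>i\<in>UNIV. m i) = (LINT x|?M. (\<Sum>i\<in>UNIV. f x * (y i x)\<^sup>2))"
    unfolding m_def
    by (intro Bochner_Integration.integral_sum[symmetric] integrable_dV_sphere[OF g] continuous_on_mult f(1)
        continuous_on_power continuous_on_sphere_Cinf yC)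
  also have "\<dots> = (LINT x|?M. f x)"
  proof (rule Bochner_Integration.integral_cong[OF refl])
    fix x assume "x \<in> space ?M"
    then have "norm (mobius a x) = 1" using norm_mobius[OF a(1), of x] by (simp add: sets_dV_sphere(2)[OF g])
    then have "(\<Sum>i\<in>UNIV. (y i x)\<^sup>2) = 1" by (simp add: norm_eq_1 inner_vec_def y_def power2_eq_square)
    then show "(\<Sum>i\<in>UNIV. f x * (y i x)\<^sup>2) = f x" by (simp add: sum_distrib_left[symmetric])
  qed
  finally have sum_m: "(\<Sum>i\<in>UNIV. m i) = (LINT x|?M. f x)" .
  define I where "I = (LINT p|?M. (\<Sum>i\<in>UNIV. p $ i * v p * comm1 (D ?A ?g) (\<lambda>q. q $ i) (replicate (r - 1) v) p))"
  have I: "I = (\<Sum>i\<in>UNIV. A2 i) - ?E (replicate r v)"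
    unfolding I_def A2_def by (rule integral_comm1_coordinates[OF pd assms(1) vC])
  \<comment> \<open>Summed over all coordinates, the \<open>A2 i\<close> give
    \<open>I + ?E (replicate r v)\<close> and the moments give the mass of \<open>f\<close>, which
    is positive and cancels.\<close>
  have "(\<Sum>i\<in>UNIV. (q - 1) * ?E (replicate r u) * m i) \<le> (\<Sum>i\<in>UNIV. (real r - 1) * A2 i * (LINT x|?M. f x))"
    by (rule sum_mono) (rule ineq)
  then have "((q - 1) * ?E (replicate r v)) * (LINT x|?M. f x) \<le> ((real r - 1) * (I + ?E (replicate r v))) * (LINT x|?M. f x)"
    by (simp add: sum_distrib_left[symmetric] sum_distrib_right[symmetric] sum_m I E_v)
  then have "(q - 1) * ?E (replicate r v) \<le> (real r - 1) * (I + ?E (replicate r v))"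
    using f_pos by (simp add: mult_le_cancel_right)
  then have "(q - real r) * ?E (replicate r v) \<le> (real r - 1) * I" by (simp add: algebra_simps)
  then have le: "?E (replicate r v) \<le> (real r - 1) * (?n - 2 * k) / (2 * real r * k) * I"
    unfolding q(2) using assms(1-3) by (simp add: field_simps)
  have fl: "(let lhs = ?E (replicate r v); rhs = (real r - 1) * (?n - 2 * k) / (2 * real r * k) * I
      in lhs \<ge> rhs \<and> (lhs = rhs \<longleftrightarrow> (\<exists>c. \<forall>p\<in>sphere 0 1. v p = c)))"
    using assms(5) v unfolding frank_lieb_def I_def by blast
  then obtain c where c: "\<And>p. p \<in> sphere 0 1 \<Longrightarrow> v p = c" using le unfolding Let_def by fastforce
  \<comment> \<open>Evaluating \<open>v\<close> at \<open>mobius a p\<close> inverts the transport: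
    the conformal factors of the two maps are reciprocal, so the exponential changes sides.\<close>
  have u_eq: "u p = exp (s * ln (mobius_factor a p)) * c" if p: "p \<in> sphere 0 1" for p
  proof -
    have np: "norm p = 1" using p by simp
    have "c = v (mobius a p)" using c[of "mobius a p"] norm_mobius[OF a(1) np] by simp
    also have "\<dots> = exp (- (s * ln (mobius_factor a p))) * u p"
      using mobius_factor_pos[OF a(1) np]
      by (simp add: v_def mobius_act_def mobius_factor_mobius[OF a(1) np] mobius_mobius[OF a(1) np] ln_div)
    finally show ?thesis by (simp add: exp_minus)
  qed
  have "c \<noteq> 0" using u_eq[OF u(2)] u(3) by auto
  moreover have "u p = conf_act r k (\<lambda>_. c) (mobius a) p" if p: "p \<in> sphere 0 1" for p
  proof -
    \<comment> \<open>The dimension in the Jacobian cancels the one in the exponent of the action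
      and leaves \<open>s\<close>.\<close>
    have "exp (?n * ln (mobius_factor a p)) powr ((?n - 2 * k) / (real r * ?n)) = exp (s * ln (mobius_factor a p))"
      by (simp add: powr_def s_def)
    then show ?thesis unfolding conf_act_def jacobian_mobius[OF a(1) p] using u_eq[OF p] by simp
  qed
  ultimately show ?thesis using mobius_in_Conf_group[OF a(1)] by blast
qed

end
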